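(* The assignments $X\mapsto\tilde\Omega X$ and $f\mapsto\tilde\Omega f$ define a pseudofunctorial assignment $\tilde\Omega:\mathcal T_\star\to\mathcal G$, i.e. the following hold: (Identity) $\tilde\Omega\,\mathrm{id}_X\equiv\mathrm{id}_{\tilde\Omega X}$ for every $X\in\mathcal T_\star$; (Composition) $\tilde\Omega(g\circ f)\equiv(\tilde\Omega g)\circ(\tilde\Omega f)$ for all $f:X\to Y$ and $g:Y\to Z$ in $\mathcal T_\star$.
   Context: Nice objects. $\mathcal T_\star$ is the category of nice pointed spaces (connected pointed spaces admitting a countable CW-decomposition in which the base point is a vertex) and pointed continuous maps. $\mathcal G$ is the category of nice topological groups (topological groups admitting a countable CW-decomposition for which multiplication and inversion are cellular) and continuous homomorphisms. Bundles. For a topological group $G$ and a space $X$, a $G$-bundle over $X$ is a space $P$ with a continuous right $G$-action and a continuous map $\pi:P\to X$ with $\pi(p\cdot g)=\pi(p)$, which is locally trivial: $X$ has an open cover $\{U_i\}$ with $G$-equivariant homeomorphisms $\pi^{-1}(U_i)\cong U_i\times G$ over $U_i$. An equivalence of $G$-bundles over $X$, written $\simeq$, is a $G$-equivariant homeomorphism over $X$. For $f:X\to Y$ and a $G$-bundle $Q$ over $Y$, $f^\star Q:=X\times_YQ$. For a continuous homomorphism $a:G\to H$ and a $G$-bundle $P$ over $X$, the pushforward $a_\star P:=P\otimes_GH$ is the quotient of $P\times H$ by $(p\cdot g,h)\sim(p,a(g)h)$, an $H$-bundle over $X$. A morphism of bundles over $X$ from a $G$-bundle $P$ to an $H$-bundle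 $P'$, equivariant with respect to $a$, is a continuous map $\phi:P\to P'$ over $X$ with $\phi(p\cdot g)=\phi(p)\cdot a(g)$. Classifying space. $\tilde EG$ is Milnor's infinite join of copies of $G$: points are formal sums $\sum_{i\in\mathbb N}t_i g_i$ with $t_i\in[0,1]$, finitely many nonzero, $\sum t_i=1$, $g_i\in G$ ($g_i$ disregarded when $t_i=0$), with right $G$-action by right multiplication on every $g_i$; $\tilde BG$ is its orbit space. For $G\in\mathcal G$ the join carries the CW topology (the quotient topology from $\bigsqcup_n\Delta^n\times G^{n+1}$, i.e. the colimit of the finite joins). Then $\tilde EG$ is a contractible $G$-bundle over $\tilde BG$, $\tilde BG$ is a countable CW-complex, and $\tilde E$, $\tilde B$ are functorial. Two continuous homomorphisms $a,b:G\to H$ are algebraically equivalent, $a\equiv b$, if $\tilde Ba$ is homotopic to $\tilde Bb$. Milnor loop space. For a connected simplicial complex $K$ with chosen vertex $\overline x$, let $L_nK\subset K^{n+1}$ be the subspace of tuples $(x_n,\dots,x_0)$ such that any two consecutive entries lie in a common simplex; $\tilde LK$ is the quotient of $\bigsqcup_nL_nK$ by the relation generated by $(x_n,\dots,x_i,\dots,x_0)\sim(x_n,\dots,\hat x_i,\dots,x_0)$ whenever $x_i=x_{i-1}$ or $x_{i-1}=x_{i+1}$. $\tilde PK\subset\tilde LK$ consists of classes with $x_0=\overline x$, and $\tilde\Omega K\subset\tilde PK$ of classes with $x_n=x_0=\overline x$. Concatenation makes $\tilde\Omega K$ a topological group and $\tilde PK$, with projection to $x_n$, an $\tilde\Omega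 K$-bundle over $K$. For every $X\in\mathcal T_\star$ fix a countable CW-structure with the base point a vertex and a homotopy equivalence $s_X:X\to K(X)$ to a locally finite simplicial complex sending the base point to a vertex, taken as the chosen vertex (with $s_X=\mathrm{id}$ when $X$ itself admits such a structure). Put $\tilde\Omega X:=\tilde\Omega(K(X))$ and $\tilde PX:=s_X^\star\tilde PK(X)$. By Milnor, $\tilde\Omega X\in\mathcal G$, $\tilde PX$ is a contractible $\tilde\Omega X$-bundle over $X$, and for each $G$-bundle $P$ over $X$ there is a morphism $\tilde PX\to P$ of bundles over $X$ equivariant with respect to some continuous homomorphism $\tilde\Omega X\to G$. For each $f:X\to Y$ in $\mathcal T_\star$, one chooses a morphism of bundles over $X$, $\phi_f:\tilde PX\to f^\star\tilde PY$, equivariant with respect to a continuous homomorphism denoted $\tilde\Omega f:\tilde\Omega X\to\tilde\Omega Y$; so $(\tilde\Omega f)_\star\tilde PX\simeq f^\star\tilde PY$. *)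

theory Defs
  imports "HOL-Homology.Homology" "HOL-Algebra.Group"
begin

section \<open>Quotient topologies\<close>

definition quotient_topology :: "'a topology \<Rightarrow> ('a \<Rightarrow> 'b) \<Rightarrow> 'b topology" where
  "quotient_topology X q =
     topology (\<lambda>U. U \<subseteq> q ` topspace X \<and> openin X {x \<in> topspace X. q x \<in> U})"

lemma openin_quotient_topology:
  "openin (quotient_topology X q) U \<longleftrightarrow>
     U \<subseteq> q ` topspace X \<and> openin X {x \<in> topspace X. q x \<in> U}"
proof -
  have "istopology (\<lambda>U. U \<subseteq> q ` topspace X \<and> openin X {x \<in> topspace X. q x \<in> U})"
    unfolding istopology_def
  proof (intro conjI allI impI)
    fix S T
    assume S: "S \<subseteq> q ` topspace X \<and> openin X {x \<in> topspace X. q x \<in> S}"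
      and T: "T \<subseteq> q ` topspace X \<and> openin X {x \<in> topspace X. q x \<in> T}"
    have "{x \<in> topspace X. q x \<in> S \<inter> T} =
          {x \<in> topspace X. q x \<in> S} \<inter> {x \<in> topspace X. q x \<in> T}" by auto
    with S T show "openin X {x \<in> topspace X. q x \<in> S \<inter> T}" by auto
    from S show "S \<inter> T \<subseteq> q ` topspace X" by auto
  next
    fix \<K>
    assume K: "\<forall>K\<in>\<K>. K \<subseteq> q ` topspace X \<and> openin X {x \<in> topspace X. q x \<in> K}"
    have "{x \<in> topspace X. q x \<in> \<Union>\<K>} = (\<Union>K\<in>\<K>. {x \<in> topspace X. q x \<in> K})" by auto
    with K show "openin X {x \<in> topspace X. q x \<in> \<Union>\<K>}" by auto
    from K show "\<Union>\<K> \<subseteq> q ` topspace X" by blast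
  qed
  then show ?thesis
    by (simp add: quotient_topology_def topology_inverse')
qed

lemma topspace_quotient_topology [simp]:
  "topspace (quotient_topology X q) = q ` topspace X"
proof -
  have "{x \<in> topspace X. q x \<in> q ` topspace X} = topspace X" by auto
  then have "openin (quotient_topology X q) (q ` topspace X)"
    by (simp add: openin_quotient_topology)
  then show ?thesis
    by (metis openin_quotient_topology openin_subset openin_topspace subset_antisym)
qed

lemma quotient_map_quotient_topology: "quotient_map X (quotient_topology X q) q"
  by (auto simp: quotient_map_def openin_quotient_topology)


section \<open>CW-decompositions and nice pointed spaces\<close>

definition cw_disc :: "nat \<Rightarrow> (nat \<Rightarrow> real) topology" where
  "cw_disc n = subtopology (Euclidean_space n) {x. (\<Sum>i<n. (x i)\<^sup>2) \<le> 1}"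

definition cw_disc_interior :: "nat \<Rightarrow> (nat \<Rightarrow> real) set" where
  "cw_disc_interior n = {x \<in> topspace (cw_disc n). (\<Sum>i<n. (x i)\<^sup>2) < 1}"

definition characteristic_map ::
  "'a topology \<Rightarrow> 'a set set \<Rightarrow> ('a set \<Rightarrow> nat) \<Rightarrow> 'a set \<Rightarrow> ((nat \<Rightarrow> real) \<Rightarrow> 'a) \<Rightarrow> bool" where
  "characteristic_map X E d e \<Phi> \<longleftrightarrow>
     continuous_map (cw_disc (d e)) X \<Phi> \<and>
     homeomorphic_map (subtopology (cw_disc (d e)) (cw_disc_interior (d e))) (subtopology X e) \<Phi> \<and>
     (\<exists>F. finite F \<and> F \<subseteq> {e' \<in> E. d e' < d e} \<and>
          \<Phi> ` (topspace (cw_disc (d e)) - cw_disc_interior (d e)) \<subseteq> \<Union>F)"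

text \<open>\<open>E\<close> is the set of open cells and \<open>d\<close> assigns to each cell its dimension. The last conjunct
  is the weak topology.\<close>

definition cw_decomposition :: "'a topology \<Rightarrow> 'a set set \<Rightarrow> ('a set \<Rightarrow> nat) \<Rightarrow> bool" where
  "cw_decomposition X E d \<longleftrightarrow>
     Hausdorff_space X \<and> pairwise disjnt E \<and> {} \<notin> E \<and> \<Union>E = topspace X \<and>
     (\<forall>e\<in>E. \<exists>\<Phi>. characteristic_map X E d e \<Phi>) \<and>
     (\<forall>A \<subseteq> topspace X. (\<forall>e\<in>E. closedin X (A \<inter> X closure_of e)) \<longrightarrow> closedin X A)"

definition cw_skeleton :: "'a set set \<Rightarrow> ('a set \<Rightarrow> nat) \<Rightarrow> nat \<Rightarrow> 'a set" where
  "cw_skeleton E d n = \<Union>{e \<in> E. d e \<le> n}"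

type_synonym 'a pointed = "'a topology \<times> 'a"

definition nice_space :: "'a pointed \<Rightarrow> bool" where
  "nice_space X \<longleftrightarrow> connected_space (fst X) \<and>
     (\<exists>E d. countable E \<and> cw_decomposition (fst X) E d \<and> {snd X} \<in> E \<and> d {snd X} = 0)"

definition pointed_map :: "'a pointed \<Rightarrow> 'b pointed \<Rightarrow> ('a \<Rightarrow> 'b) \<Rightarrow> bool" where
  "pointed_map X Y f \<longleftrightarrow> continuous_map (fst X) (fst Y) f \<and> f (snd X) = snd Y"


section \<open>Nice topological groups\<close>

record 'g tgroup = "'g monoid" +
  topol :: "'g topology"

definition topological_group :: "'g tgroup \<Rightarrow> bool" where
  "topological_group G \<longleftrightarrow> group G \<and> topspace (topol G) = carrier G \<and>
     continuous_map (prod_topology (topol G) (topol G)) (topol G) (\<lambda>(x, y). x \<otimes>\<^bsub>G\<^esub> y) \<and>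
     continuous_map (topol G) (topol G) (\<lambda>x. inv\<^bsub>G\<^esub> x)"

text \<open>The \<open>n\<close>-skeleton of the product decomposition of \<open>G \<times> G\<close> is the union of the products of the
  \<open>p\<close>-skeleton with the \<open>q\<close>-skeleton over \<open>p + q = n\<close>; this is how cellularity of the
  multiplication is expressed.\<close>

definition nice_group :: "'g tgroup \<Rightarrow> bool" where
  "nice_group G \<longleftrightarrow> topological_group G \<and>
     (\<exists>E d. countable E \<and> cw_decomposition (topol G) E d \<and>
        (\<forall>p q. \<forall>x \<in> cw_skeleton E d p. \<forall>y \<in> cw_skeleton E d q. x \<otimes>\<^bsub>G\<^esub> y \<in> cw_skeleton E d (p + q)) \<and>
        (\<forall>n. \<forall>x \<in> cw_skeleton E d n. inv\<^bsub>G\<^esub> x \<in> cw_skeleton E d n))"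

definition nice_hom :: "'g tgroup \<Rightarrow> 'h tgroup \<Rightarrow> ('g \<Rightarrow> 'h) \<Rightarrow> bool" where
  "nice_hom G H a \<longleftrightarrow> nice_group G \<and> nice_group H \<and>
     continuous_map (topol G) (topol H) a \<and> a \<in> hom G H"


section \<open>Bundles\<close>

record ('p, 'g, 'x) gbundle =
  total :: "'p topology"
  proj :: "'p \<Rightarrow> 'x"
  act :: "'p \<Rightarrow> 'g \<Rightarrow> 'p"

definition G_bundle :: "'g tgroup \<Rightarrow> 'x topology \<Rightarrow> ('p, 'g, 'x) gbundle \<Rightarrow> bool" where
  "G_bundle G X P \<longleftrightarrow> topological_group G \<and>
     continuous_map (total P) X (proj P) \<and>
     continuous_map (prod_topology (total P) (topol G)) (total P) (\<lambda>(p, g). act P p g) \<and>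
     (\<forall>p \<in> topspace (total P). act P p \<one>\<^bsub>G\<^esub> = p) \<and>
     (\<forall>p \<in> topspace (total P). \<forall>g \<in> carrier G. \<forall>h \<in> carrier G.
        act P (act P p g) h = act P p (g \<otimes>\<^bsub>G\<^esub> h)) \<and>
     (\<forall>p \<in> topspace (total P). \<forall>g \<in> carrier G. proj P (act P p g) = proj P p) \<and>
     (\<forall>x \<in> topspace X. \<exists>U. openin X U \<and> x \<in> U \<and>
        (\<exists>\<theta>. homeomorphic_map (subtopology (total P) {p \<in> topspace (total P). proj P p \<in> U})
               (prod_topology (subtopology X U) (topol G)) \<theta> \<and>
             (\<forall>p \<in> topspace (total P). proj P p \<in> U \<longrightarrow>
                fst (\<theta> p) = proj P p \<and>
                (\<forall>g \<in> carrier G. \<theta> (act P p g) = (fst (\<theta> p), snd (\<theta> p) \<otimes>\<^bsub>G\<^esub> g)))))"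

definition pullback_bundle ::
  "'x topology \<Rightarrow> ('x \<Rightarrow> 'y) \<Rightarrow> ('q, 'g, 'y) gbundle \<Rightarrow> ('x \<times> 'q, 'g, 'x) gbundle" where
  "pullback_bundle X f Q =
     \<lparr> total = subtopology (prod_topology X (total Q)) {(x, q). f x = proj Q q},
       proj = fst,
       act = (\<lambda>(x, q) g. (x, act Q q g)) \<rparr>"

definition bundle_morphism ::
  "'x topology \<Rightarrow> 'g tgroup \<Rightarrow> ('p, 'g, 'x) gbundle \<Rightarrow> 'h tgroup \<Rightarrow> ('q, 'h, 'x) gbundle \<Rightarrow>
   ('g \<Rightarrow> 'h) \<Rightarrow> ('p \<Rightarrow> 'q) \<Rightarrow> bool" where
  "bundle_morphism X G P H Q a \<phi> \<longleftrightarrow>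
     G_bundle G X P \<and> G_bundle H X Q \<and>
     continuous_map (topol G) (topol H) a \<and> a \<in> hom G H \<and>
     continuous_map (total P) (total Q) \<phi> \<and>
     (\<forall>p \<in> topspace (total P). proj Q (\<phi> p) = proj P p) \<and>
     (\<forall>p \<in> topspace (total P). \<forall>g \<in> carrier G. \<phi> (act P p g) = act Q (\<phi> p) (a g))"


section \<open>Milnor's classifying space\<close>

text \<open>A formal sum \<open>\<Sum>i. t i \<cdot> g i\<close> is the pair of \<open>t\<close> and of \<open>g\<close> restricted to the support of
  \<open>t\<close>; the restriction implements disregarding \<open>g i\<close> when \<open>t i = 0\<close>.\<close>

type_synonym 'g join_point = "(nat \<Rightarrow> real) \<times> (nat \<Rightarrow> 'g)"

definition formal_sum :: "(nat \<Rightarrow> real) \<Rightarrow> (nat \<Rightarrow> 'g) \<Rightarrow> 'g join_point" where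
  "formal_sum t g = (t, restrict g {i. t i \<noteq> 0})"

definition milnor_E :: "'g tgroup \<Rightarrow> 'g join_point topology" where
  "milnor_E G =
     quotient_topology
       (sum_topology
          (\<lambda>n. prod_topology (subtopology (powertop_real UNIV) (standard_simplex n))
                              (product_topology (\<lambda>_. topol G) {..n}))
          UNIV)
       (\<lambda>(n, t, g). formal_sum t g)"

definition milnor_E_act :: "'g tgroup \<Rightarrow> 'g join_point \<Rightarrow> 'g \<Rightarrow> 'g join_point" where
  "milnor_E_act G = (\<lambda>(t, g) h. formal_sum t (\<lambda>i. g i \<otimes>\<^bsub>G\<^esub> h))"

definition milnor_orbit :: "'g tgroup \<Rightarrow> 'g join_point \<Rightarrow> 'g join_point set" where
  "milnor_orbit G e = milnor_E_act G e ` carrier G"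

definition milnor_B :: "'g tgroup \<Rightarrow> 'g join_point set topology" where
  "milnor_B G = quotient_topology (milnor_E G) (milnor_orbit G)"

definition milnor_E_map :: "('g \<Rightarrow> 'h) \<Rightarrow> 'g join_point \<Rightarrow> 'h join_point" where
  "milnor_E_map a = (\<lambda>(t, g). formal_sum t (\<lambda>i. a (g i)))"

text \<open>For a homomorphism \<open>a\<close>, all members of the orbit \<open>C\<close> have their images in one \<open>H\<close>-orbit,
  which is the union below.\<close>

definition milnor_B_map :: "'h tgroup \<Rightarrow> ('g \<Rightarrow> 'h) \<Rightarrow> 'g join_point set \<Rightarrow> 'h join_point set" where
  "milnor_B_map H a C = (\<Union>e\<in>C. milnor_orbit H (milnor_E_map a e))"

definition alg_equivalent :: "'g tgroup \<Rightarrow> 'h tgroup \<Rightarrow> ('g \<Rightarrow> 'h) \<Rightarrow> ('g \<Rightarrow> 'h) \<Rightarrow> bool" where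
  "alg_equivalent G H a b \<longleftrightarrow> nice_hom G H a \<and> nice_hom G H b \<and>
     homotopic_with (\<lambda>_. True) (milnor_B G) (milnor_B H) (milnor_B_map H a) (milnor_B_map H b)"


section \<open>Simplicial complexes\<close>

text \<open>A simplicial complex is a space together with a triangulation whose vertices are points of the
  space: \<open>sc_coord C x v\<close> is the barycentric coordinate of the point \<open>x\<close> at the vertex \<open>v\<close>. Having
  the space itself in the record allows a given space to be a simplicial complex on the nose.\<close>

record 'a scomplex =
  sc_space :: "'a topology"
  sc_simplices :: "'a set set"
  sc_coord :: "'a \<Rightarrow> 'a \<Rightarrow> real"

definition geometric_simplex :: "'v set \<Rightarrow> ('v \<Rightarrow> real) set" where
  "geometric_simplex \<sigma> = {t. (\<forall>v. 0 \<le> t v) \<and> (\<forall>v. v \<notin> \<sigma> \<longrightarrow> t v = 0) \<and> sum t \<sigma> = 1}"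

definition geometric_realization :: "'v set set \<Rightarrow> ('v \<Rightarrow> real) topology" where
  "geometric_realization S =
     quotient_topology
       (sum_topology (\<lambda>\<sigma>. subtopology (powertop_real UNIV) (geometric_simplex \<sigma>)) S) snd"

definition simplicial_complex :: "'a scomplex \<Rightarrow> bool" where
  "simplicial_complex C \<longleftrightarrow>
     (\<forall>\<sigma> \<in> sc_simplices C. finite \<sigma> \<and> \<sigma> \<noteq> {} \<and> \<sigma> \<subseteq> topspace (sc_space C)) \<and>
     (\<forall>\<sigma> \<in> sc_simplices C. \<forall>\<tau> \<subseteq> \<sigma>. \<tau> \<noteq> {} \<longrightarrow> \<tau> \<in> sc_simplices C) \<and>
     homeomorphic_map (sc_space C) (geometric_realization (sc_simplices C)) (sc_coord C) \<and>
     (\<forall>v \<in> \<Union>(sc_simplices C). sc_coord C v = (\<lambda>w. if w = v then 1 else 0))"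

definition locally_finite :: "'a scomplex \<Rightarrow> bool" where
  "locally_finite C \<longleftrightarrow> (\<forall>v \<in> \<Union>(sc_simplices C). finite {\<sigma> \<in> sc_simplices C. v \<in> \<sigma>})"

definition sc_vertex :: "'a scomplex \<Rightarrow> 'a \<Rightarrow> bool" where
  "sc_vertex C v \<longleftrightarrow> {v} \<in> sc_simplices C"

definition common_simplex :: "'a scomplex \<Rightarrow> 'a \<Rightarrow> 'a \<Rightarrow> bool" where
  "common_simplex C x y \<longleftrightarrow>
     (\<exists>\<sigma> \<in> sc_simplices C. sc_coord C x \<in> geometric_simplex \<sigma> \<and> sc_coord C y \<in> geometric_simplex \<sigma>)"


section \<open>Milnor's loop space\<close>

text \<open>A tuple \<open>(x\<^sub>n, \<dots>, x\<^sub>0)\<close> is encoded as the pair of \<open>n\<close> and the function \<open>i \<mapsto> x\<^sub>i\<close>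
  restricted to \<open>{..n}\<close>.\<close>

type_synonym 'a tuple = "nat \<times> (nat \<Rightarrow> 'a)"

definition L_tuples :: "'a scomplex \<Rightarrow> nat \<Rightarrow> (nat \<Rightarrow> 'a) set" where
  "L_tuples C n = {x \<in> {..n} \<rightarrow>\<^sub>E topspace (sc_space C). \<forall>i<n. common_simplex C (x (Suc i)) (x i)}"

definition omit_entry :: "nat \<Rightarrow> nat \<Rightarrow> (nat \<Rightarrow> 'a) \<Rightarrow> (nat \<Rightarrow> 'a)" where
  "omit_entry n i x = (\<lambda>j\<in>{..n}. if j < i then x j else x (Suc j))"

inductive tuple_step :: "'a scomplex \<Rightarrow> 'a tuple \<Rightarrow> 'a tuple \<Rightarrow> bool" for C where
  repeat: "x \<in> L_tuples C (Suc n) \<Longrightarrow> 1 \<le> i \<Longrightarrow> i \<le> Suc n \<Longrightarrow> x i = x (i - 1)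
             \<Longrightarrow> tuple_step C (Suc n, x) (n, omit_entry n i x)"
| backtrack: "x \<in> L_tuples C (Suc n) \<Longrightarrow> 1 \<le> i \<Longrightarrow> i \<le> n \<Longrightarrow> x (i - 1) = x (i + 1)
             \<Longrightarrow> tuple_step C (Suc n, x) (n, omit_entry n i x)"

definition tuple_class :: "'a scomplex \<Rightarrow> 'a tuple \<Rightarrow> 'a tuple set" where
  "tuple_class C p = {q. equivclp (tuple_step C) p q}"

definition milnor_L :: "'a scomplex \<Rightarrow> 'a tuple set topology" where
  "milnor_L C =
     quotient_topology
       (sum_topology (\<lambda>n. subtopology (product_topology (\<lambda>_. sc_space C) {..n}) (L_tuples C n)) UNIV)
       (tuple_class C)"

text \<open>The entries \<open>x\<^sub>n\<close> and \<open>x\<^sub>0\<close> are the same for all tuples of a class.\<close>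

definition class_end :: "'a tuple set \<Rightarrow> 'a" where
  "class_end c = the_elem ((\<lambda>(n, x). x n) ` c)"

definition class_start :: "'a tuple set \<Rightarrow> 'a" where
  "class_start c = the_elem ((\<lambda>(n, x). x 0) ` c)"

definition concat_tuple :: "'a tuple \<Rightarrow> 'a tuple \<Rightarrow> 'a tuple" where
  "concat_tuple = (\<lambda>(n, x) (m, y).
     (n + m + 1, \<lambda>j\<in>{..n + m + 1}. if j \<le> m then y j else x (j - (m + 1))))"

definition concat_class :: "'a scomplex \<Rightarrow> 'a tuple set \<Rightarrow> 'a tuple set \<Rightarrow> 'a tuple set" where
  "concat_class C c c' = (\<Union>p\<in>c. \<Union>q\<in>c'. tuple_class C (concat_tuple p q))"

definition loop_classes :: "'a scomplex \<Rightarrow> 'a \<Rightarrow> 'a tuple set set" where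
  "loop_classes C b = {c \<in> topspace (milnor_L C). class_start c = b \<and> class_end c = b}"

definition milnor_loop_group :: "'a scomplex \<Rightarrow> 'a \<Rightarrow> 'a tuple set tgroup" where
  "milnor_loop_group C b =
     \<lparr> carrier = loop_classes C b,
       mult = concat_class C,
       one = tuple_class C (0, \<lambda>j\<in>{..0}. b),
       topol = subtopology (milnor_L C) (loop_classes C b) \<rparr>"

definition milnor_path_bundle :: "'a scomplex \<Rightarrow> 'a \<Rightarrow> ('a tuple set, 'a tuple set, 'a) gbundle" where
  "milnor_path_bundle C b =
     \<lparr> total = subtopology (milnor_L C) {c \<in> topspace (milnor_L C). class_start c = b},
       proj = class_end,
       act = concat_class C \<rparr>"


section \<open>Loop groups of nice spaces\<close>

text \<open>The last conjunct is the convention that \<open>s\<close> is the identity whenever \<open>X\<close> itself is a locally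
  finite simplicial complex with the base point a vertex. The vertex \<open>s (snd X)\<close> serves as the chosen
  vertex of \<open>C\<close>.\<close>

definition simplicial_model :: "'a pointed \<Rightarrow> 'a scomplex \<Rightarrow> ('a \<Rightarrow> 'a) \<Rightarrow> bool" where
  "simplicial_model X C s \<longleftrightarrow>
     simplicial_complex C \<and> locally_finite C \<and> sc_vertex C (s (snd X)) \<and>
     continuous_map (fst X) (sc_space C) s \<and>
     (\<exists>r. continuous_map (sc_space C) (fst X) r \<and>
          homotopic_with (\<lambda>_. True) (fst X) (fst X) (r \<circ> s) id \<and>
          homotopic_with (\<lambda>_. True) (sc_space C) (sc_space C) (s \<circ> r) id) \<and>
     ((\<exists>D. simplicial_complex D \<and> locally_finite D \<and> sc_space D = fst X \<and> sc_vertex D (snd X)) \<longrightarrow>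
        sc_space C = fst X \<and> (\<forall>x \<in> topspace (fst X). s x = x))"

definition Omega :: "('a pointed \<Rightarrow> 'a scomplex) \<Rightarrow> ('a pointed \<Rightarrow> 'a \<Rightarrow> 'a) \<Rightarrow> 'a pointed
    \<Rightarrow> 'a tuple set tgroup" where
  "Omega K s X = milnor_loop_group (K X) (s X (snd X))"

definition path_bundle :: "('a pointed \<Rightarrow> 'a scomplex) \<Rightarrow> ('a pointed \<Rightarrow> 'a \<Rightarrow> 'a) \<Rightarrow> 'a pointed
    \<Rightarrow> ('a \<times> 'a tuple set, 'a tuple set, 'a) gbundle" where
  "path_bundle K s X = pullback_bundle (fst X) (s X) (milnor_path_bundle (K X) (s X (snd X)))"

end

theory Submission
  imports Defs "HOL-Analysis.Abstract_Topological_Spaces"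
begin

text \<open>Both claims compare two morphisms \<open>\<phi>\<close>, \<open>\<psi>\<close> from the path bundle to one \<open>H\<close>-bundle over \<open>X\<close>,
  equivariant along \<open>\<alpha>\<close> and \<open>\<beta>\<close>, and assert that \<open>\<alpha>\<close> and \<open>\<beta>\<close> induce homotopic maps of classifying
  spaces. Contractibility of the path bundle is not needed, because Milnor's loop group is free enough:
  a homomorphism out of it is given by a transport along pairs \<open>(x, y)\<close> of points of a common simplex
  that is trivial for \<open>x = y\<close> and whose values at \<open>(x, y)\<close> and \<open>(y, x)\<close> are inverse to each other.

  Along a homotopy from \<open>id\<close> to \<open>s \<circ> r\<close> on the complex there is a canonical class of tuples from \<open>y\<close> to
  \<open>s (r y)\<close>, so \<open>\<phi>\<close> and \<open>\<psi>\<close> become maps on the paths of the complex, related by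
  \<open>\<phi> c = \<psi> c \<cdot> \<delta> c\<close> with \<open>\<delta> (c g) = inv (\<beta> g) \<delta> c \<alpha> g\<close>. Given a pair \<open>(x, y)\<close>, let \<open>u\<close> and \<open>v\<close> run
  from \<open>x\<close> and \<open>y\<close>, respectively, to the midpoint of the segment, and transport along \<open>\<beta>\<close> from \<open>x\<close>
  to \<open>u\<close>, along \<open>\<alpha>\<close> from \<open>u\<close> to \<open>v\<close>, and along \<open>\<beta>\<close> from \<open>v\<close> to \<open>y\<close>. This joins, through homomorphisms, a
  conjugate of \<open>\<alpha>\<close> to the composite of \<open>\<beta>\<close> with the subdivision of loops, and the same construction for
  \<open>\<alpha> = \<beta>\<close> joins the latter to \<open>\<beta>\<close>. A conjugation does not change the map of classifying spaces up to
  homotopy: in the join, the labels can be multiplied by a fixed element while they are moved to the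
  next positions, and then be moved back.\<close>

section \<open>Classifying spaces and families of homomorphisms\<close>

text \<open>The detour through subdivision is forced: inserting a midpoint changes the class of a
  tuple in general, since Milnor's relations only remove repetitions and backtracks. The family
  therefore ends at \<beta> of the subdivided loop instead of \<beta>, and the case \<alpha> =
  \<beta>, \<delta> = 1 is there to undo the subdivision. The conjugating element is \<delta> of the
  constant path: the homotopy from the identity to \<open>s \<circ> r\<close> may move the base
  vertex, and \<phi> and \<psi> may differ there. Two obstacles are topological. The product of a
  quotient map with a space need not be a quotient map, so continuity of a family is tested on
  tuples of a fixed length times the interval, which is locally compact. And the complex need not be
  compact, so the deformation cannot be cut into a uniform number of short steps; the step length is
  a continuous function of the point, and the result does not depend on the number of steps once
  this is large enough.\<close>

lemma continuous_map_from_sum_topology: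
  assumes "\<And>i. i \<in> I \<Longrightarrow> continuous_map (X i) Y (\<lambda>x. f (i, x))"
  shows "continuous_map (sum_topology X I) Y f"
  unfolding continuous_map_def
proof (intro conjI allI impI)
  show "f \<in> topspace (sum_topology X I) \<rightarrow> topspace Y"
    using assms by (fastforce simp: continuous_map_def Pi_iff)
  fix U assume "openin Y U"
  then have "\<forall>i\<in>I. openin (X i) {x \<in> topspace (X i). f (i, x) \<in> U}"
    using assms by (auto simp: continuous_map_def)
  then show "openin (sum_topology X I) {x \<in> topspace (sum_topology X I). f x \<in> U}"
    by (auto simp: openin_sum_topology)
qed

text \<open>The injections of the summands are open maps, so an open box in
  \<open>Z \<times> X i\<close> yields an open box in the product with the sum, whatever the space
  \<open>Z\<close> is.\<close>

lemma continuous_map_from_Times_sum: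
  assumes "\<And>i. i \<in> I \<Longrightarrow> continuous_map (prod_topology Z (X i)) Y (\<lambda>(z, x). f (z, (i, x)))"
  shows "continuous_map (prod_topology Z (sum_topology X I)) Y f"
  unfolding continuous_map_def
proof (intro conjI allI impI)
  show "f \<in> topspace (prod_topology Z (sum_topology X I)) \<rightarrow> topspace Y"
    using assms by (fastforce simp: continuous_map_def Pi_iff)
  fix U assume U: "openin Y U"
  show "openin (prod_topology Z (sum_topology X I)) {x \<in> topspace (prod_topology Z (sum_topology X I)). f x \<in> U}"
    unfolding openin_prod_topology_alt
  proof (intro allI impI)
    fix z p assume "(z, p) \<in> {x \<in> topspace (prod_topology Z (sum_topology X I)). f x \<in> U}"
    then obtain i x where p: "p = (i, x)" "i \<in> I" "x \<in> topspace (X i)" "z \<in> topspace Z" "f (z, (i, x)) \<in> U"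
      by auto
    have "openin (prod_topology Z (X i)) {q \<in> topspace (prod_topology Z (X i)). (\<lambda>(z, x). f (z, (i, x))) q \<in> U}"
      using assms[OF p(2)] U by (rule openin_continuous_map_preimage)
    moreover have "(z, x) \<in> {q \<in> topspace (prod_topology Z (X i)). (\<lambda>(z, x). f (z, (i, x))) q \<in> U}"
      using p by auto
    ultimately obtain A B where AB: "openin Z A" "openin (X i) B" "z \<in> A" "x \<in> B"
      "A \<times> B \<subseteq> {q \<in> topspace (prod_topology Z (X i)). (\<lambda>(z, x). f (z, (i, x))) q \<in> U}"
      unfolding openin_prod_topology_alt by meson
    have "openin (sum_topology X I) (Pair i ` B)"
      using open_map_component_injection[OF p(2)] AB(2) by (auto simp: open_map_def)
    moreover have "A \<times> (Pair i ` B) \<subseteq> {x \<in> topspace (prod_topology Z (sum_topology X I)). f x \<in> U}"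
      using AB(5) p(2) by auto
    ultimately show "\<exists>A B. openin Z A \<and> openin (sum_topology X I) B \<and> z \<in> A \<and> p \<in> B \<and>
        A \<times> B \<subseteq> {x \<in> topspace (prod_topology Z (sum_topology X I)). f x \<in> U}"
      using AB p(1) by blast
  qed
qed

text \<open>Products preserve quotient maps when the other factor is locally compact Hausdorff.
  Homotopies on orbit spaces and on classes of tuples are descended in this way.\<close>

lemma quotient_map_Times_unit_interval:
  assumes "quotient_map X Y q"
  shows "quotient_map (prod_topology (top_of_set {0..1::real}) X) (prod_topology (top_of_set {0..1}) Y)
           (\<lambda>(s, x). (s, q x))"
proof (rule quotient_map_prod_right[OF _ _ assms])
  show "locally_compact_space (top_of_set {0..1::real})"
    by (simp add: compact_imp_locally_compact_space compact_space_subtopology)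
qed (simp add: Hausdorff_space_subtopology)

section \<open>Maps and homotopies of the orbit space of the join\<close>

definition join_piece :: "'g tgroup \<Rightarrow> nat \<Rightarrow> ((nat \<Rightarrow> real) \<times> (nat \<Rightarrow> 'g)) topology" where
  "join_piece G n = prod_topology (subtopology (powertop_real UNIV) (standard_simplex n))
                              (product_topology (\<lambda>_. topol G) {..n})"

lemma milnor_E_eq: "milnor_E G = quotient_topology (sum_topology (join_piece G) UNIV) (\<lambda>(n, t, g). formal_sum t g)"
  unfolding milnor_E_def join_piece_def ..

lemma continuous_formal_sum:
  "continuous_map (join_piece G n) (milnor_E G) (\<lambda>(t, g). formal_sum t g)"
proof -
  have "continuous_map (sum_topology (join_piece G) UNIV) (milnor_E G) (\<lambda>(n, t, g). formal_sum t g)"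
    unfolding milnor_E_eq by (rule quotient_imp_continuous_map[OF quotient_map_quotient_topology])
  from continuous_map_compose[OF continuous_map_component_injection[of n] this]
  show ?thesis by (simp add: o_def)
qed

lemma quotient_map_milnor_B:
  "quotient_map (sum_topology (join_piece G) UNIV) (milnor_B G) (\<lambda>(n, t, g). milnor_orbit G (formal_sum t g))"
proof -
  have "quotient_map (sum_topology (join_piece G) UNIV) (milnor_B G) (milnor_orbit G \<circ> (\<lambda>(n, t, g). formal_sum t g))"
    unfolding milnor_B_def milnor_E_eq
    by (rule quotient_map_compose[OF quotient_map_quotient_topology quotient_map_quotient_topology])
  then show ?thesis by (simp add: o_def case_prod_unfold)
qed

lemma continuous_orbit: "continuous_map (milnor_E G) (milnor_B G) (milnor_orbit G)"
  unfolding milnor_B_def by (rule quotient_imp_continuous_map[OF quotient_map_quotient_topology])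

lemma topspace_join_piece: "topspace (join_piece G n) = standard_simplex n \<times> ({..n} \<rightarrow>\<^sub>E topspace (topol G))"
  by (simp add: join_piece_def)

lemma topspace_milnor_B:
  "C \<in> topspace (milnor_B G) \<longleftrightarrow>
    (\<exists>n t g. t \<in> standard_simplex n \<and> g \<in> {..n} \<rightarrow>\<^sub>E topspace (topol G) \<and> C = milnor_orbit G (formal_sum t g))"
proof -
  have "topspace (milnor_B G) = (\<lambda>(n, t, g). milnor_orbit G (formal_sum t g)) ` topspace (sum_topology (join_piece G) UNIV)"
    using quotient_imp_surjective_map[OF quotient_map_milnor_B] by metis
  then show ?thesis
    by (auto simp: topspace_join_piece image_iff Bex_def)
qed

text \<open>The homotopy is prescribed on representatives: \<open>milnor_B G\<close> is a quotient
  of the sum of the pieces, so continuity there suffices, and \<open>orbit\<close> lets \<Psi>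
  descend.\<close>

lemma homotopic_milnor_B:
  assumes cont: "\<And>n. continuous_map (prod_topology (top_of_set {0..1::real}) (join_piece G n)) (milnor_E H)
                   (\<lambda>(s, t, g). \<Psi> s (formal_sum t g))"
    and orbit: "\<And>s n t g x. 0 \<le> s \<Longrightarrow> s \<le> 1 \<Longrightarrow> t \<in> standard_simplex n \<Longrightarrow> g \<in> {..n} \<rightarrow>\<^sub>E topspace (topol G) \<Longrightarrow>
        x \<in> milnor_orbit G (formal_sum t g) \<Longrightarrow> milnor_orbit H (\<Psi> s x) = milnor_orbit H (\<Psi> s (formal_sum t g))"
    and ne: "carrier G \<noteq> {}"
    and p: "\<And>n t g. t \<in> standard_simplex n \<Longrightarrow> g \<in> {..n} \<rightarrow>\<^sub>E topspace (topol G) \<Longrightarrow>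
         p (milnor_orbit G (formal_sum t g)) = milnor_orbit H (\<Psi> 0 (formal_sum t g))"
    and q: "\<And>n t g. t \<in> standard_simplex n \<Longrightarrow> g \<in> {..n} \<rightarrow>\<^sub>E topspace (topol G) \<Longrightarrow>
         q (milnor_orbit G (formal_sum t g)) = milnor_orbit H (\<Psi> 1 (formal_sum t g))"
  shows "homotopic_with (\<lambda>_. True) (milnor_B G) (milnor_B H) p q"
proof -
  \<comment> \<open>Any member of the orbit serves: \<open>ne\<close> makes the orbit nonempty, and
    \<open>orbit\<close> makes the value independent of the choice.\<close>
  define h where "h = (\<lambda>(s, C). milnor_orbit H (\<Psi> s (SOME x. x \<in> C)))"
  have h: "h (s, milnor_orbit G (formal_sum t g)) = milnor_orbit H (\<Psi> s (formal_sum t g))"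
    if "s \<in> {0..1}" "t \<in> standard_simplex n" "g \<in> {..n} \<rightarrow>\<^sub>E topspace (topol G)" for s n t g
  proof -
    have "milnor_orbit G (formal_sum t g) \<noteq> {}"
      using ne by (auto simp: milnor_orbit_def)
    then have "(SOME x. x \<in> milnor_orbit G (formal_sum t g)) \<in> milnor_orbit G (formal_sum t g)"
      by (simp add: some_in_eq)
    then show ?thesis using that orbit[of s t n g] by (simp add: h_def)
  qed
  have "continuous_map (prod_topology (top_of_set {0..1::real}) (sum_topology (join_piece G) UNIV)) (milnor_B H)
          (h \<circ> (\<lambda>(s, x). (s, (\<lambda>(n, t, g). milnor_orbit G (formal_sum t g)) x)))"
  proof (rule continuous_map_from_Times_sum)
    fix n
    have "continuous_map (prod_topology (top_of_set {0..1::real}) (join_piece G n)) (milnor_B H)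
            (milnor_orbit H \<circ> (\<lambda>(s, t, g). \<Psi> s (formal_sum t g)))"
      by (rule continuous_map_compose[OF cont continuous_orbit])
    then show "continuous_map (prod_topology (top_of_set {0..1::real}) (join_piece G n)) (milnor_B H)
       (\<lambda>(z, x). (h \<circ> (\<lambda>(s, x). (s, (\<lambda>(n, t, g). milnor_orbit G (formal_sum t g)) x))) (z, (n, x)))"
      by (rule continuous_map_eq) (auto simp: topspace_join_piece h)
  qed
  then have "continuous_map (prod_topology (top_of_set {0..1::real}) (milnor_B G)) (milnor_B H) h"
    by (rule continuous_compose_quotient_map[OF quotient_map_Times_unit_interval[OF quotient_map_milnor_B]])
  then show ?thesis
    by (subst homotopic_with) (auto simp: topspace_milnor_B h p q intro!: exI[of _ h])
qed

lemma formal_sum_cong: "(\<And>i. t i \<noteq> 0 \<Longrightarrow> g i = g' i) \<Longrightarrow> formal_sum t g = formal_sum t g'"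
  by (auto simp: formal_sum_def restrict_def fun_eq_iff)

lemma standard_simplex_support: "t \<in> standard_simplex n \<Longrightarrow> t i \<noteq> 0 \<Longrightarrow> i \<le> n"
  by (rule ccontr) (auto simp: standard_simplex_def not_le)

lemma milnor_E_act_formal_sum: "milnor_E_act G (formal_sum t g) k = formal_sum t (\<lambda>i. g i \<otimes>\<^bsub>G\<^esub> k)"
  by (auto simp: milnor_E_act_def formal_sum_def restrict_def fun_eq_iff)

lemma milnor_E_map_formal_sum: "milnor_E_map a (formal_sum t g) = formal_sum t (\<lambda>i. a (g i))"
  by (auto simp: milnor_E_map_def formal_sum_def restrict_def fun_eq_iff)

lemma milnor_orbit_formal_sum:
  "milnor_orbit G (formal_sum t g) = (\<lambda>k. formal_sum t (\<lambda>i. g i \<otimes>\<^bsub>G\<^esub> k)) ` carrier G"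
  by (simp add: milnor_orbit_def milnor_E_act_formal_sum)

lemma milnor_orbit_translate:
  assumes "group G" "k \<in> carrier G" "\<And>i. t i \<noteq> 0 \<Longrightarrow> g i \<in> carrier G"
  shows "milnor_orbit G (formal_sum t (\<lambda>i. g i \<otimes>\<^bsub>G\<^esub> k)) = milnor_orbit G (formal_sum t g)"
proof -
  interpret group G by fact
  have 1: "formal_sum t (\<lambda>i. g i \<otimes>\<^bsub>G\<^esub> k \<otimes>\<^bsub>G\<^esub> k') = formal_sum t (\<lambda>i. g i \<otimes>\<^bsub>G\<^esub> (k \<otimes>\<^bsub>G\<^esub> k'))"
    if "k' \<in> carrier G" for k'
    using that assms by (intro formal_sum_cong) (simp add: m_assoc)
  have 2: "formal_sum t (\<lambda>i. g i \<otimes>\<^bsub>G\<^esub> k') = formal_sum t (\<lambda>i. g i \<otimes>\<^bsub>G\<^esub> k \<otimes>\<^bsub>G\<^esub> (inv\<^bsub>G\<^esub> k \<otimes>\<^bsub>G\<^esub> k'))"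
    if "k' \<in> carrier G" for k'
    using that assms by (intro formal_sum_cong) (simp add: m_assoc[symmetric], simp add: m_assoc)
  show ?thesis
    unfolding milnor_orbit_formal_sum using assms(2)
    by (auto simp: 1 2 image_iff)
qed

lemma milnor_B_map_orbit:
  assumes G: "group G" and H: "group H" and a: "a \<in> hom G H" and g: "\<And>i. t i \<noteq> 0 \<Longrightarrow> g i \<in> carrier G"
  shows "milnor_B_map H a (milnor_orbit G (formal_sum t g)) = milnor_orbit H (formal_sum t (\<lambda>i. a (g i)))"
proof -
  have "milnor_orbit H (milnor_E_map a (formal_sum t (\<lambda>i. g i \<otimes>\<^bsub>G\<^esub> k))) = milnor_orbit H (formal_sum t (\<lambda>i. a (g i)))"
    if k: "k \<in> carrier G" for k
  proof -
    have "milnor_E_map a (formal_sum t (\<lambda>i. g i \<otimes>\<^bsub>G\<^esub> k)) = formal_sum t (\<lambda>i. a (g i) \<otimes>\<^bsub>H\<^esub> a k)"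
      unfolding milnor_E_map_formal_sum using a g k by (intro formal_sum_cong) (simp add: hom_def)
    then show ?thesis
      using milnor_orbit_translate[OF H] a g k by (simp add: hom_def Pi_iff)
  qed
  moreover have "carrier G \<noteq> {}"
    using G group.is_monoid monoid.one_closed by blast
  ultimately show ?thesis
    unfolding milnor_B_map_def milnor_orbit_formal_sum[of G] by auto
qed

text \<open>The family acts on the labels and leaves the weights alone. Since each
  \<open>F s\<close> is multiplicative, right translation by \<open>k\<close> becomes right
  translation by \<open>F s k\<close>, and orbits go into orbits at every time.\<close>

lemma homotopic_milnor_B_map_family:
  assumes G: "topological_group G" and H: "topological_group H"
    and F: "continuous_map (prod_topology (top_of_set {0..1::real}) (topol G)) (topol H) (\<lambda>(s, x). F s x)"
    and hom: "\<And>s. 0 \<le> s \<Longrightarrow> s \<le> 1 \<Longrightarrow> F s \<in> hom G H"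
  shows "homotopic_with (\<lambda>_. True) (milnor_B G) (milnor_B H) (milnor_B_map H (F 0)) (milnor_B_map H (F 1))"
proof (rule homotopic_milnor_B[where \<Psi> = "\<lambda>s. milnor_E_map (F s)"])
  have gG: "group G" "topspace (topol G) = carrier G" and gH: "group H" "topspace (topol H) = carrier H"
    using G H by (auto simp: topological_group_def)
  show "carrier G \<noteq> {}"
    using gG(1) group.is_monoid monoid.one_closed by blast
  have gc: "g i \<in> carrier G" if "t \<in> standard_simplex n" "g \<in> {..n} \<rightarrow>\<^sub>E topspace (topol G)" "t i \<noteq> 0" for n t g i
    using that standard_simplex_support[of t n i] gG by auto
  show "milnor_B_map H (F 0) (milnor_orbit G (formal_sum t g)) = milnor_orbit H (milnor_E_map (F 0) (formal_sum t g))"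
    "milnor_B_map H (F 1) (milnor_orbit G (formal_sum t g)) = milnor_orbit H (milnor_E_map (F 1) (formal_sum t g))"
    if "t \<in> standard_simplex n" "g \<in> {..n} \<rightarrow>\<^sub>E topspace (topol G)" for n t g
    using that gc by (auto simp: milnor_E_map_formal_sum hom intro!: milnor_B_map_orbit[OF gG(1) gH(1)])
  show "milnor_orbit H (milnor_E_map (F s) x) = milnor_orbit H (milnor_E_map (F s) (formal_sum t g))"
    if st: "0 \<le> s" "s \<le> 1" "t \<in> standard_simplex n" "g \<in> {..n} \<rightarrow>\<^sub>E topspace (topol G)" 
      and x: "x \<in> milnor_orbit G (formal_sum t g)" for s n t g x
  proof -
    obtain k where k: "k \<in> carrier G" "x = formal_sum t (\<lambda>i. g i \<otimes>\<^bsub>G\<^esub> k)"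
      using x by (auto simp: milnor_orbit_formal_sum)
    have "milnor_E_map (F s) x = formal_sum t (\<lambda>i. F s (g i) \<otimes>\<^bsub>H\<^esub> F s k)"
      unfolding k milnor_E_map_formal_sum using hom[OF st(1,2)] gc[OF st(3,4)] k
      by (intro formal_sum_cong) (simp add: hom_def)
    then show ?thesis
      using milnor_orbit_translate[OF gH(1)] hom[OF st(1,2)] gc[OF st(3,4)] k
      by (simp add: hom_def Pi_iff milnor_E_map_formal_sum)
  qed
  show "continuous_map (prod_topology (top_of_set {0..1::real}) (join_piece G n)) (milnor_E H)
          (\<lambda>(s, t, g). milnor_E_map (F s) (formal_sum t g))" for n
  proof -
    have comp: "continuous_map (prod_topology (top_of_set {0..1::real}) (join_piece G n)) (topol H) (\<lambda>(s, t, g). F s (g i))"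
      if i: "i \<le> n" for i
    proof -
      have "continuous_map (join_piece G n) (topol G) ((\<lambda>g. g i) \<circ> snd)"
        unfolding join_piece_def
        by (rule continuous_map_compose[OF continuous_map_snd continuous_map_product_projection]) (simp add: i)
      then have "continuous_map (prod_topology (top_of_set {0..1::real}) (join_piece G n))
            (prod_topology (top_of_set {0..1::real}) (topol G)) (\<lambda>p. (fst p, ((\<lambda>g. g i) \<circ> snd) (snd p)))"
        by (intro continuous_map_pairedI continuous_map_fst) (rule continuous_map_compose[OF continuous_map_snd, unfolded o_def], simp add: o_def)
      from continuous_map_compose[OF this F] show ?thesis by (simp add: o_def case_prod_unfold)
    qed
    have "continuous_map (prod_topology (top_of_set {0..1::real}) (join_piece G n)) (join_piece H n)
            (\<lambda>(s, t, g). (t, \<lambda>i\<in>{..n}. F s (g i)))"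
    proof -
      have 1: "continuous_map (prod_topology (top_of_set {0..1::real}) (join_piece G n))
              (subtopology (powertop_real UNIV) (standard_simplex n)) (fst \<circ> snd)"
        unfolding join_piece_def by (rule continuous_map_compose[OF continuous_map_snd continuous_map_fst])
      have 2: "continuous_map (prod_topology (top_of_set {0..1::real}) (join_piece G n))
              (product_topology (\<lambda>_. topol H) {..n}) (\<lambda>p. (\<lambda>i\<in>{..n}. F (fst p) (snd (snd p) i)))"
        using comp by (auto simp: continuous_map_componentwise case_prod_unfold restrict_def extensional_def)
      show ?thesis
        unfolding join_piece_def[of H] using continuous_map_pairedI[OF 1 2] by (simp add: case_prod_unfold)
    qed
    from continuous_map_compose[OF this continuous_formal_sum]
    show ?thesis
      by (rule continuous_map_eq)
        (auto simp: milnor_E_map_formal_sum topspace_join_piece intro!: formal_sum_cong dest: standard_simplex_support)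
  qed
qed


section \<open>Conjugation\<close>

text \<open>Regard a point of the join as the subdivision of \<open>[0, 1]\<close> into consecutive intervals of lengths
  \<open>t j\<close> that carry the labels \<open>g j\<close>. At time \<open>c\<close>, the part of each interval to the right of \<open>c\<close> has
  been moved to the next position, so that position \<open>j\<close> never receives two labels at once.\<close>

definition cut_weight :: "real \<Rightarrow> (nat \<Rightarrow> real) \<Rightarrow> nat \<Rightarrow> real" where
  "cut_weight c t j = min c (sum t {..<Suc j}) - min c (sum t {..<j})"

definition shift_weight :: "real \<Rightarrow> (nat \<Rightarrow> real) \<Rightarrow> nat \<Rightarrow> real" where
  "shift_weight c t j = cut_weight c t j + (case j of 0 \<Rightarrow> 0 | Suc i \<Rightarrow> t i - cut_weight c t i)"

text \<open>Position \<open>Suc i\<close> can hold the left part of its own interval or the moved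
  right part of interval \<open>i\<close>. The former has positive length only if its left end is
  strictly less than \<open>c\<close>; then interval \<open>i\<close> lies left of \<open>c\<close>
  and none of it has moved. Nothing moves into position 0.\<close>

definition shift_label :: "('h \<Rightarrow> 'h) \<Rightarrow> real \<Rightarrow> (nat \<Rightarrow> real) \<Rightarrow> (nat \<Rightarrow> 'h) \<Rightarrow> nat \<Rightarrow> 'h" where
  "shift_label l c t g j = (case j of 0 \<Rightarrow> g 0 | Suc i \<Rightarrow> if sum t {..<j} < c then g j else l (g i))"

definition shift_join :: "('h \<Rightarrow> 'h) \<Rightarrow> real \<Rightarrow> 'h join_point \<Rightarrow> 'h join_point" where
  "shift_join l c = (\<lambda>(t, g). formal_sum (shift_weight c t) (shift_label l c t g))"

context
  fixes t :: "nat \<Rightarrow> real" and n :: nat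
  assumes t: "t \<in> standard_simplex n"
begin

lemma simplex_nonneg: "0 \<le> t i"
  using t by (auto simp: standard_simplex_def)

lemma simplex_partial_sum_mono: "i \<le> j \<Longrightarrow> sum t {..<i} \<le> sum t {..<j}"
  by (rule sum_mono2) (auto simp: simplex_nonneg)

lemma simplex_partial_sum_total: "n < j \<Longrightarrow> sum t {..<j} = 1"
proof -
  assume "n < j"
  then have "sum t {..<j} = sum t {..n}"
    using t by (intro sum.mono_neutral_right) (auto simp: standard_simplex_def)
  then show ?thesis using t by (simp add: standard_simplex_def)
qed

lemma simplex_partial_sum_le_1: "sum t {..<j} \<le> 1"
  using simplex_partial_sum_mono[of j "Suc (max n j)"] simplex_partial_sum_total[of "Suc (max n j)"] by auto

lemma cut_weight_1: "cut_weight 1 t = t"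
  unfolding cut_weight_def min_absorb2[OF simplex_partial_sum_le_1] by (simp add: fun_eq_iff)

lemma cut_weight_0: "cut_weight 0 t j = 0"
  unfolding cut_weight_def by (simp add: sum_nonneg simplex_nonneg del: sum.lessThan_Suc)

lemma cut_weight_bounds: "0 \<le> cut_weight c t j \<and> cut_weight c t j \<le> t j"
  using simplex_nonneg[of j] by (auto simp: cut_weight_def min_def)

lemma shift_weight_1: "shift_weight 1 t = t"
  by (auto simp: shift_weight_def fun_eq_iff cut_weight_1 split: nat.split)

lemma shift_weight_0: "shift_weight 0 t = (\<lambda>j. case j of 0 \<Rightarrow> 0 | Suc i \<Rightarrow> t i)"
  by (auto simp: shift_weight_def fun_eq_iff cut_weight_0 split: nat.split)

lemma shift_weight_nonneg: "0 \<le> shift_weight c t j"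
  using cut_weight_bounds[of c j] cut_weight_bounds[of c "j - 1"]
  by (cases j) (auto simp: shift_weight_def)

text \<open>The intervals before \<open>m\<close> lie at positions up to \<open>m\<close>, moved or
  not; of interval \<open>m\<close> only the unmoved part does.\<close>

lemma sum_shift_weight: "(\<Sum>j\<le>m. shift_weight c t j) = cut_weight c t m + sum t {..<m}"
  by (induction m) (auto simp: shift_weight_def)

lemma cut_weight_beyond: "n < j \<Longrightarrow> cut_weight c t j = 0"
  using simplex_partial_sum_total[of j] simplex_partial_sum_total[of "Suc j"] unfolding cut_weight_def by simp

lemma shift_weight_simplex: "shift_weight c t \<in> standard_simplex (Suc n)"
proof -
  have tot: "(\<Sum>j\<le>Suc n. shift_weight c t j) = 1"
    unfolding sum_shift_weight using simplex_partial_sum_total by (simp add: cut_weight_beyond del: sum.lessThan_Suc)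
  have van: "shift_weight c t j = 0" if "Suc n < j" for j
    using that t by (cases j) (auto simp: shift_weight_def cut_weight_beyond standard_simplex_def)
  have "shift_weight c t j \<le> 1" for j
  proof (cases "j \<le> Suc n")
    case True
    have "shift_weight c t j \<le> (\<Sum>j\<le>Suc n. shift_weight c t j)"
      by (rule member_le_sum) (use True in \<open>auto simp: shift_weight_nonneg\<close>)
    then show ?thesis using tot by simp
  qed (simp add: van)
  then show ?thesis using tot van shift_weight_nonneg by (auto simp: standard_simplex_def)
qed

text \<open>While \<open>c\<close> stays in interval \<open>k\<close>, the switch from own to moved
  labels stays at \<open>k\<close>, so there the labels are fixed expressions in \<open>g\<close>.
  Continuity of the move rests on this.\<close>

lemma shift_label_piece:
  assumes "sum t {..<k} \<le> c" "c \<le> sum t {..<Suc k}" and "shift_weight c t j \<noteq> 0"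
  shows "shift_label l c t g j = (if j \<le> k then g j else l (g (j - 1)))"
proof (cases "j \<le> k")
  case True
  then have "sum t {..<j} \<le> c"
    using simplex_partial_sum_mono[of j k] assms(1) by simp
  \<comment> \<open>If \<open>c\<close> is the left end of interval \<open>j\<close>, this interval
    has moved entirely and interval \<open>j - 1\<close> not at all, so position \<open>j\<close> is
    empty.\<close>
  moreover have "j = 0" if c: "sum t {..<j} = c"
  proof (rule ccontr)
    assume "j \<noteq> 0"
    then obtain i where j: "j = Suc i" by (cases j) auto
    have "cut_weight c t j = 0"
      using simplex_nonneg[of j] c by (simp add: cut_weight_def)
    moreover have "cut_weight c t i = t i"
      using simplex_nonneg[of i] c by (simp add: cut_weight_def j)
    ultimately show False
      using assms(3) by (simp add: shift_weight_def j)
  qed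
  ultimately show ?thesis using True by (cases "sum t {..<j} = c") (auto simp: shift_label_def simp del: sum.lessThan_Suc split: nat.split)
next
  case False
  then have "c \<le> sum t {..<j}"
    using simplex_partial_sum_mono[of "Suc k" j] assms(2) by linarith
  then show ?thesis using False by (auto simp: shift_label_def simp del: sum.lessThan_Suc split: nat.split)
qed

text \<open>The source \<open>i\<close> is found before \<open>g\<close> is given. It thus serves a
  labelling together with its restriction to the support or its right translates, which gives
  independence of the representative and compatibility with orbits.\<close>

lemma shift_label_source:
  assumes "shift_weight c t j \<noteq> 0"
  obtains i where "t i \<noteq> 0"
    "(\<forall>g. shift_label l c t g j = g i) \<or> (\<forall>g. shift_label l c t g j = l (g i))"
proof (cases j)
  case 0
  with assms cut_weight_bounds[of c 0] show ?thesis
    by (intro that[of 0]) (auto simp: shift_weight_def shift_label_def)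
next
  case (Suc i)
  show ?thesis
  proof (cases "sum t {..<j} < c")
    case True
    then have "cut_weight c t i = t i"
      using simplex_nonneg[of i] by (simp add: cut_weight_def Suc)
    then have "cut_weight c t j \<noteq> 0"
      using assms by (simp add: shift_weight_def Suc)
    then show ?thesis
      using True cut_weight_bounds[of c j] by (intro that[of j]) (auto simp: shift_label_def Suc)
  next
    case False
    then have "cut_weight c t j = 0"
      using simplex_nonneg[of j] by (simp add: cut_weight_def)
    then have "t i - cut_weight c t i \<noteq> 0"
      using assms by (simp add: shift_weight_def Suc)
    then show ?thesis
      using False cut_weight_bounds[of c i] by (intro that[of i]) (auto simp: shift_label_def Suc)
  qed
qed

lemma shift_join_formal_sum:
  "shift_join l c (formal_sum t g) = formal_sum (shift_weight c t) (shift_label l c t g)"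
proof -
  have "shift_label l c t (restrict g {i. t i \<noteq> 0}) j = shift_label l c t g j" if "shift_weight c t j \<noteq> 0" for j
    by (rule shift_label_source[OF that, of l]) auto
  then show ?thesis
    by (auto simp: shift_join_def formal_sum_def[of t] intro!: formal_sum_cong)
qed

end

text \<open>The sets where \<open>1 - s\<close> lies in interval \<open>k\<close>, for
  \<open>k \<le> n\<close>, form a finite closed cover, and on each of them the labels are given by
  one formula. Time is reversed so that \<open>s = 0\<close> is the unmoved join.\<close>

lemma continuous_shift_join:
  assumes a: "continuous_map (topol G) (topol H) a" and l: "continuous_map (topol H) (topol H) l"
  shows "continuous_map (prod_topology (top_of_set {0..1::real}) (join_piece G n)) (milnor_E H)
     (\<lambda>(s, t, g). shift_join l (1 - s) (milnor_E_map a (formal_sum t g)))"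
proof -
  let ?Z = "prod_topology (top_of_set {0..1::real}) (join_piece G n)"
  have s: "continuous_map ?Z euclideanreal (\<lambda>p. 1 - fst p)"
    by (intro continuous_intros continuous_map_into_fulltopology[OF continuous_map_fst])
  have t: "continuous_map ?Z euclideanreal (\<lambda>p. fst (snd p) j)" for j
  proof -
    have 1: "continuous_map ?Z (powertop_real UNIV) (fst \<circ> snd)"
      unfolding join_piece_def
      by (intro continuous_map_compose[OF continuous_map_snd] continuous_map_into_fulltopology[OF continuous_map_fst])
    from continuous_map_compose[OF 1 continuous_map_product_projection[of j]]
    show ?thesis by (simp add: o_def)
  qed
  have S: "continuous_map ?Z euclideanreal (\<lambda>p. sum (fst (snd p)) {..<j})" for j
    by (intro continuous_intros t) simp
  have g: "continuous_map ?Z (topol G) (\<lambda>p. snd (snd p) j)" if "j \<le> n" for j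
  proof -
    have 1: "continuous_map ?Z (product_topology (\<lambda>_. topol G) {..n}) (snd \<circ> snd)"
      unfolding join_piece_def
      by (rule continuous_map_compose[OF continuous_map_snd continuous_map_snd])
    from continuous_map_compose[OF 1 continuous_map_product_projection[of j]]
    show ?thesis using that by (simp add: o_def)
  qed
  have cw: "continuous_map ?Z euclideanreal (\<lambda>p. cut_weight (1 - fst p) (fst (snd p)) j)" for j
    unfolding cut_weight_def by (intro continuous_intros s S)
  have w: "continuous_map ?Z euclideanreal (\<lambda>p. shift_weight (1 - fst p) (fst (snd p)) j)" for j
    by (cases j) (simp_all add: shift_weight_def cw continuous_intros t)
  show ?thesis
  proof (rule pasting_lemma_closed[where I = "{..n}"
        and T = "\<lambda>k. {p \<in> topspace ?Z. sum (fst (snd p)) {..<k} - (1 - fst p) \<in> {..0}} \<inter>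
                     {p \<in> topspace ?Z. (1 - fst p) - sum (fst (snd p)) {..<Suc k} \<in> {..0}}"
        and f = "\<lambda>_ (s, t, g). shift_join l (1 - s) (milnor_E_map a (formal_sum t g))"])
    fix k assume k: "k \<in> {..n}"
    let ?T = "{p \<in> topspace ?Z. sum (fst (snd p)) {..<k} - (1 - fst p) \<in> {..0}} \<inter>
                     {p \<in> topspace ?Z. (1 - fst p) - sum (fst (snd p)) {..<Suc k} \<in> {..0}}"
    show "closedin ?Z ?T"
      by (intro closedin_Int closedin_continuous_map_preimage[where Y = euclideanreal] continuous_intros s S) auto
    let ?f = "\<lambda>p. (shift_weight (1 - fst p) (fst (snd p)),
          \<lambda>j\<in>{..Suc n}. if j \<le> k then a (snd (snd p) j) else l (a (snd (snd p) (j - 1))))"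
    have W: "continuous_map ?Z (subtopology (powertop_real UNIV) (standard_simplex (Suc n)))
        (\<lambda>p. shift_weight (1 - fst p) (fst (snd p)))"
      by (auto simp: continuous_map_in_subtopology continuous_map_componentwise_UNIV w topspace_join_piece shift_weight_simplex)
    have "continuous_map ?Z (topol H)
            (\<lambda>p. if j \<le> k then a (snd (snd p) j) else l (a (snd (snd p) (j - 1))))" if "j \<le> Suc n" for j
    proof (cases "j \<le> k")
      case True
      with k have "j \<le> n" by simp
      from continuous_map_compose[OF g[OF this] a] True show ?thesis by (simp add: o_def)
    next
      case False
      with that have "j - 1 \<le> n" by simp
      from continuous_map_compose[OF continuous_map_compose[OF g[OF this] a] l] False
      show ?thesis by (simp add: o_def)
    qed
    then have L: "continuous_map ?Z (product_topology (\<lambda>_. topol H) {..Suc n})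
        (\<lambda>p. \<lambda>j\<in>{..Suc n}. if j \<le> k then a (snd (snd p) j) else l (a (snd (snd p) (j - 1))))"
      by (auto simp: continuous_map_componentwise cong: restrict_cong)
    have "continuous_map ?Z (join_piece H (Suc n)) ?f"
      unfolding join_piece_def[of H] by (rule continuous_map_pairedI[OF W L])
    from continuous_map_compose[OF this continuous_formal_sum]
    have "continuous_map (subtopology ?Z ?T) (milnor_E H) ((\<lambda>(t, g). formal_sum t g) \<circ> ?f)"
      by (rule continuous_map_from_subtopology)
    then show "continuous_map (subtopology ?Z ?T) (milnor_E H)
        (\<lambda>(s, t, g). shift_join l (1 - s) (milnor_E_map a (formal_sum t g)))"
    proof (rule continuous_map_eq)
      fix p assume "p \<in> topspace (subtopology ?Z ?T)"
      then obtain s t g where p: "p = (s, t, g)" "0 \<le> s" "s \<le> 1" "t \<in> standard_simplex n"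
        "sum t {..<k} \<le> 1 - s" "1 - s \<le> sum t {..<Suc k}"
        by (auto simp: topspace_join_piece)
      have "formal_sum (shift_weight (1 - s) t)
          (\<lambda>j\<in>{..Suc n}. if j \<le> k then a (g j) else l (a (g (j - 1)))) =
        formal_sum (shift_weight (1 - s) t) (shift_label l (1 - s) t (\<lambda>i. a (g i)))"
      proof (rule formal_sum_cong)
        fix j assume j: "shift_weight (1 - s) t j \<noteq> 0"
        then have "j \<le> Suc n"
          using shift_weight_simplex[OF p(4)] standard_simplex_support by blast
        then show "(\<lambda>j\<in>{..Suc n}. if j \<le> k then a (g j) else l (a (g (j - 1)))) j =
            shift_label l (1 - s) t (\<lambda>i. a (g i)) j"
          by (simp add: shift_label_piece[OF p(4-6) j])
      qed
      then show "((\<lambda>(t, g). formal_sum t g) \<circ> ?f) p =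
          (case p of (s, t, g) \<Rightarrow> shift_join l (1 - s) (milnor_E_map a (formal_sum t g)))"
        by (simp add: p(1) milnor_E_map_formal_sum shift_join_formal_sum[OF p(4)] cong: if_cong)
    qed
  next
    fix p assume "p \<in> topspace ?Z"
    then obtain s t g where p: "p = (s, t, g)" "0 \<le> s" "s \<le> 1" "t \<in> standard_simplex n" 
      by (auto simp: topspace_join_piece)
    define k where "k = (LEAST k. 1 - s \<le> sum t {..<Suc k})"
    have n: "1 - s \<le> sum t {..<Suc n}"
      using simplex_partial_sum_total[OF p(4), of "Suc n"] p by simp
    have k1: "1 - s \<le> sum t {..<Suc k}" "k \<le> n"
      unfolding k_def by (rule LeastI, rule n) (rule Least_le, rule n)
    have k2: "sum t {..<k} \<le> 1 - s"
    proof (cases k)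
      case 0
      then show ?thesis using p by simp
    next
      case (Suc i)
      then show ?thesis using not_less_Least[of i "\<lambda>k. 1 - s \<le> sum t {..<Suc k}"] by (simp add: k_def[symmetric] del: sum.lessThan_Suc)
    qed
    show "\<exists>j. j \<in> {..n} \<and> p \<in> {p \<in> topspace ?Z. sum (fst (snd p)) {..<j} - (1 - fst p) \<in> {..0}} \<inter>
                     {p \<in> topspace ?Z. (1 - fst p) - sum (fst (snd p)) {..<Suc j} \<in> {..0}} \<and>
         (case p of (s, t, g) \<Rightarrow> shift_join l (1 - s) (milnor_E_map a (formal_sum t g))) =
         (case p of (s, t, g) \<Rightarrow> shift_join l (1 - s) (milnor_E_map a (formal_sum t g)))"
      using k1 k2 \<open>p \<in> topspace ?Z\<close> by (intro exI[of _ k]) (auto simp: p(1))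
  qed auto
qed

text \<open>The end \<open>c = 0\<close> of the move: everything lies one position further and
  carries the factor \<open>h\<close>. Conjugate homomorphisms are compared through this
  map.\<close>

definition milnor_B_shift :: "'h tgroup \<Rightarrow> 'h \<Rightarrow> ('g \<Rightarrow> 'h) \<Rightarrow> 'g join_point set \<Rightarrow> 'h join_point set" where
  "milnor_B_shift H h a C = (\<Union>e\<in>C. milnor_orbit H (shift_join (\<lambda>x. h \<otimes>\<^bsub>H\<^esub> x) 0 (milnor_E_map a e)))"

text \<open>Multiplication by \<open>h\<close> from the left commutes with the right action, so the
  move respects orbits also at the intermediate times, when only some of the labels carry the
  factor.\<close>

lemma
  assumes G: "topological_group G" and H: "topological_group H" and h: "h \<in> carrier H"
    and a: "continuous_map (topol G) (topol H) a" "a \<in> hom G H"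
  shows homotopic_milnor_B_shift:
      "homotopic_with (\<lambda>_. True) (milnor_B G) (milnor_B H) (milnor_B_map H a) (milnor_B_shift H h a)"
    and milnor_B_shift_orbit: "t \<in> standard_simplex n \<Longrightarrow> g \<in> {..n} \<rightarrow>\<^sub>E topspace (topol G) \<Longrightarrow>
       milnor_B_shift H h a (milnor_orbit G (formal_sum t g)) =
       milnor_orbit H (formal_sum (\<lambda>j. case j of 0 \<Rightarrow> 0 | Suc i \<Rightarrow> t i) (\<lambda>j. h \<otimes>\<^bsub>H\<^esub> a (g (j - 1))))"
proof -
  have gG: "group G" "topspace (topol G) = carrier G" and gH: "group H" "topspace (topol H) = carrier H"
    using G H by (auto simp: topological_group_def)
  interpret G: group G by fact
  interpret H: group H by fact
  let ?l = "\<lambda>x. h \<otimes>\<^bsub>H\<^esub> x"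
  let ?\<Psi> = "\<lambda>s x. shift_join ?l (1 - s) (milnor_E_map a x)"
  have gc: "g i \<in> carrier G" if "t \<in> standard_simplex n" "g \<in> {..n} \<rightarrow>\<^sub>E topspace (topol G)" "t i \<noteq> 0" for n t g i
    using that standard_simplex_support[of t n i] gG by auto
  have ac: "a x \<in> carrier H" if "x \<in> carrier G" for x
    using a(2) that by (auto simp: hom_def)
  have l: "continuous_map (topol H) (topol H) ?l"
  proof -
    have "continuous_map (topol H) (prod_topology (topol H) (topol H)) (\<lambda>x. (h, x))"
      using h gH by (simp add: continuous_map_pairedI)
    from continuous_map_compose[OF this, of "topol H" "\<lambda>(x, y). x \<otimes>\<^bsub>H\<^esub> y"] H show ?thesis
      by (simp add: topological_group_def o_def)
  qed
  have \<Psi>: "?\<Psi> s (formal_sum t g) = formal_sum (shift_weight (1 - s) t) (shift_label ?l (1 - s) t (\<lambda>i. a (g i)))"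
    if "t \<in> standard_simplex n" for s n t g
    by (simp add: milnor_E_map_formal_sum shift_join_formal_sum[OF that])
  have orbit: "milnor_orbit H (?\<Psi> s x) = milnor_orbit H (?\<Psi> s (formal_sum t g))"
    if tg: "t \<in> standard_simplex n" "g \<in> {..n} \<rightarrow>\<^sub>E topspace (topol G)"
      and x: "x \<in> milnor_orbit G (formal_sum t g)" for s n t g x
  proof -
    obtain k where k: "k \<in> carrier G" "x = formal_sum t (\<lambda>i. g i \<otimes>\<^bsub>G\<^esub> k)"
      using x by (auto simp: milnor_orbit_formal_sum)
    have "?\<Psi> s x = formal_sum (shift_weight (1 - s) t) (\<lambda>j. shift_label ?l (1 - s) t (\<lambda>i. a (g i)) j \<otimes>\<^bsub>H\<^esub> a k)"
      unfolding k \<Psi>[OF tg(1)]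
    proof (rule formal_sum_cong)
      fix j assume j: "shift_weight (1 - s) t j \<noteq> 0"
      show "shift_label ?l (1 - s) t (\<lambda>i. a (g i \<otimes>\<^bsub>G\<^esub> k)) j = shift_label ?l (1 - s) t (\<lambda>i. a (g i)) j \<otimes>\<^bsub>H\<^esub> a k"
        by (rule shift_label_source[OF tg(1) j, of ?l])
          (use gc[OF tg] k(1) a(2) h ac in \<open>auto simp: hom_def H.m_assoc\<close>)
    qed
    moreover have "shift_label ?l (1 - s) t (\<lambda>i. a (g i)) j \<in> carrier H" if j: "shift_weight (1 - s) t j \<noteq> 0" for j
      by (rule shift_label_source[OF tg(1) j, of ?l]) (use gc[OF tg] h ac in auto)
    ultimately show ?thesis
      unfolding \<Psi>[OF tg(1)] using milnor_orbit_translate[OF gH(1) ac[OF k(1)]] by simp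
  qed
  have U: "milnor_B_shift H h a (milnor_orbit G (formal_sum t g)) = milnor_orbit H (?\<Psi> 1 (formal_sum t g))"
    if "t \<in> standard_simplex n" "g \<in> {..n} \<rightarrow>\<^sub>E topspace (topol G)" for n t g
  proof -
    have "milnor_orbit G (formal_sum t g) \<noteq> {}"
      by (auto simp: milnor_orbit_def)
    then show ?thesis using orbit[OF that, of _ 1] by (auto simp: milnor_B_shift_def)
  qed
  show "homotopic_with (\<lambda>_. True) (milnor_B G) (milnor_B H) (milnor_B_map H a) (milnor_B_shift H h a)"
  proof (rule homotopic_milnor_B[where \<Psi> = ?\<Psi>])
    show "milnor_B_map H a (milnor_orbit G (formal_sum t g)) = milnor_orbit H (?\<Psi> 0 (formal_sum t g))"
      if tg: "t \<in> standard_simplex n" "g \<in> {..n} \<rightarrow>\<^sub>E topspace (topol G)" for n t g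
    proof -
      have "formal_sum t (shift_label ?l 1 t (\<lambda>i. a (g i))) = formal_sum t (\<lambda>i. a (g i))"
      proof (rule formal_sum_cong)
        fix i assume "t i \<noteq> 0"
        then have "sum t {..<i} < 1"
          using simplex_partial_sum_le_1[OF tg(1), of "Suc i"] simplex_nonneg[OF tg(1), of i] by auto
        then show "shift_label ?l 1 t (\<lambda>i. a (g i)) i = a (g i)"
          by (auto simp: shift_label_def split: nat.split simp del: sum.lessThan_Suc)
      qed
      then show ?thesis
        using milnor_B_map_orbit[OF gG(1) gH(1) a(2), of t g] gc[OF tg] \<Psi>[OF tg(1), of 0 g]
        by (simp add: shift_weight_1[OF tg(1)])
    qed
  qed (use orbit U continuous_shift_join[OF a(1) l] in auto)
  show "milnor_B_shift H h a (milnor_orbit G (formal_sum t g)) =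
       milnor_orbit H (formal_sum (\<lambda>j. case j of 0 \<Rightarrow> 0 | Suc i \<Rightarrow> t i) (\<lambda>j. h \<otimes>\<^bsub>H\<^esub> a (g (j - 1))))"
    if tg: "t \<in> standard_simplex n" "g \<in> {..n} \<rightarrow>\<^sub>E topspace (topol G)"
  proof -
    \<comment> \<open>At \<open>c = 0\<close> no interval starts left of the cut, so every label of
      positive weight is a moved one.\<close>
    have "\<not> sum t {..<j} < 0" for j
      using simplex_nonneg[OF tg(1)] by (simp add: sum_nonneg not_less)
    then show ?thesis
      unfolding U[OF tg] \<Psi>[OF tg(1)]
      by (auto simp: shift_weight_0[OF tg(1)] shift_label_def intro!: arg_cong[where f = "milnor_orbit H"] formal_sum_cong split: nat.splits simp del: sum.lessThan_Suc)
  qed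
qed

text \<open>Moved with the factor 1, the labels of \<open>a'\<close> are \<open>h a(g)\<close> times
  the inverse of \<open>h\<close>; moved with the factor \<open>h\<close>, those of \<open>a\<close>
  are \<open>h a(g)\<close>. They differ by a right translation, so both moves end in the same map
  of orbit spaces.\<close>

lemma homotopic_milnor_B_map_conjugate:
  assumes G: "topological_group G" and H: "topological_group H" and h: "h \<in> carrier H"
    and a: "continuous_map (topol G) (topol H) a" "a \<in> hom G H"
    and a': "continuous_map (topol G) (topol H) a'" "a' \<in> hom G H"
    and conj: "\<And>x. x \<in> carrier G \<Longrightarrow> a' x = h \<otimes>\<^bsub>H\<^esub> a x \<otimes>\<^bsub>H\<^esub> inv\<^bsub>H\<^esub> h"
  shows "homotopic_with (\<lambda>_. True) (milnor_B G) (milnor_B H) (milnor_B_map H a') (milnor_B_map H a)"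
proof -
  have gG: "group G" "topspace (topol G) = carrier G" and gH: "group H" "topspace (topol H) = carrier H"
    using G H by (auto simp: topological_group_def)
  interpret H: group H by fact
  have ac: "a x \<in> carrier H" if "x \<in> carrier G" for x
    using a(2) that by (auto simp: hom_def)
  have "milnor_B_shift H \<one>\<^bsub>H\<^esub> a' C = milnor_B_shift H h a C" if C: "C \<in> topspace (milnor_B G)" for C
  proof -
    obtain n t g where tg: "t \<in> standard_simplex n" "g \<in> {..n} \<rightarrow>\<^sub>E topspace (topol G)"
      and C: "C = milnor_orbit G (formal_sum t g)"
      using C by (auto simp: topspace_milnor_B)
    let ?t = "\<lambda>j. case j of 0 \<Rightarrow> 0 | Suc i \<Rightarrow> t i"
    have gc: "g (j - 1) \<in> carrier G" if "?t j \<noteq> 0" for j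
      using that tg standard_simplex_support[OF tg(1), of "j - 1"] gG by (auto split: nat.splits)
    have "formal_sum ?t (\<lambda>j. \<one>\<^bsub>H\<^esub> \<otimes>\<^bsub>H\<^esub> a' (g (j - 1))) =
        formal_sum ?t (\<lambda>j. h \<otimes>\<^bsub>H\<^esub> a (g (j - 1)) \<otimes>\<^bsub>H\<^esub> inv\<^bsub>H\<^esub> h)"
      by (rule formal_sum_cong, drule gc) (use h ac in \<open>simp add: conj\<close>)
    moreover have "milnor_orbit H (formal_sum ?t (\<lambda>j. h \<otimes>\<^bsub>H\<^esub> a (g (j - 1)) \<otimes>\<^bsub>H\<^esub> inv\<^bsub>H\<^esub> h)) =
       milnor_orbit H (formal_sum ?t (\<lambda>j. h \<otimes>\<^bsub>H\<^esub> a (g (j - 1))))"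
      by (rule milnor_orbit_translate[OF gH(1)]) (use h ac gc in auto)
    ultimately show ?thesis
      unfolding C milnor_B_shift_orbit[OF G H h a tg] milnor_B_shift_orbit[OF G H H.one_closed a' tg] by simp
  qed
  then have "homotopic_with (\<lambda>_. True) (milnor_B G) (milnor_B H) (milnor_B_shift H \<one>\<^bsub>H\<^esub> a') (milnor_B_shift H h a)"
    using homotopic_with_imp_continuous_maps[OF homotopic_milnor_B_shift[OF G H H.one_closed a']]
    by (intro homotopic_with_equal) auto
  with homotopic_milnor_B_shift[OF G H H.one_closed a'] 
  have "homotopic_with (\<lambda>_. True) (milnor_B G) (milnor_B H) (milnor_B_map H a') (milnor_B_shift H h a)"
    by (rule homotopic_with_trans)
  then show ?thesis
    using homotopic_with_symD[OF homotopic_milnor_B_shift[OF G H h a]] by (rule homotopic_with_trans)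
qed

section \<open>Points of locally finite complexes\<close>

lemma closedin_geometric_simplex:
  assumes "finite \<sigma>"
  shows "closedin (powertop_real UNIV) (geometric_simplex \<sigma>)"
proof -
  have "closed (geometric_simplex \<sigma>)"
    unfolding geometric_simplex_def
    by (intro closed_Collect_conj closed_Collect_all closed_Collect_imp closed_Collect_le closed_Collect_eq
        continuous_intros continuous_on_product_coordinates) auto
  then show ?thesis by (simp add: euclidean_product_topology)
qed

locale lf_complex =
  fixes C :: "'a scomplex"
  assumes complex: "simplicial_complex C" and finite_stars: "locally_finite C"
begin

abbreviation "X \<equiv> sc_space C"
abbreviation "S \<equiv> sc_simplices C"
abbreviation "cd \<equiv> sc_coord C"

definition point :: "('a \<Rightarrow> real) \<Rightarrow> 'a" where
  "point = inv_into (topspace X) cd"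

lemma finite_simplex: "\<sigma> \<in> S \<Longrightarrow> finite \<sigma>"
  using complex by (auto simp: simplicial_complex_def)

lemma coord_homeomorphic: "homeomorphic_map X (geometric_realization S) cd"
  using complex by (auto simp: simplicial_complex_def)

lemma topspace_realization: "topspace (geometric_realization S) = (\<Union>\<sigma>\<in>S. geometric_simplex \<sigma>)"
  by (force simp: geometric_realization_def)

lemma coord_image: "cd ` topspace X = (\<Union>\<sigma>\<in>S. geometric_simplex \<sigma>)"
  using homeomorphic_imp_surjective_map[OF coord_homeomorphic] by (simp add: topspace_realization)

lemma coord_inj: "inj_on cd (topspace X)"
  using homeomorphic_imp_injective_map[OF coord_homeomorphic] .

lemma carrier_simplex:
  assumes "x \<in> topspace X"
  obtains \<sigma> where "\<sigma> \<in> S" "cd x \<in> geometric_simplex \<sigma>"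
  using assms coord_image by blast

lemma point_in: "\<sigma> \<in> S \<Longrightarrow> t \<in> geometric_simplex \<sigma> \<Longrightarrow> point t \<in> topspace X"
  unfolding point_def by (rule inv_into_into) (use coord_image in blast)

lemma coord_point: "\<sigma> \<in> S \<Longrightarrow> t \<in> geometric_simplex \<sigma> \<Longrightarrow> cd (point t) = t"
  unfolding point_def by (rule f_inv_into_f) (use coord_image in blast)

lemma point_coord: "x \<in> topspace X \<Longrightarrow> point (cd x) = x"
  unfolding point_def by (rule inv_into_f_f[OF coord_inj])

lemma coord_nonneg: "x \<in> topspace X \<Longrightarrow> 0 \<le> cd x v"
  by (erule carrier_simplex) (auto simp: geometric_simplex_def)

lemma simplex_support: "t \<in> geometric_simplex \<sigma> \<Longrightarrow> t v \<noteq> 0 \<Longrightarrow> v \<in> \<sigma>"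
  by (auto simp: geometric_simplex_def)

lemma exists_positive_coord:
  assumes "x \<in> topspace X"
  obtains v where "0 < cd x v"
proof -
  obtain \<sigma> where \<sigma>: "\<sigma> \<in> S" "cd x \<in> geometric_simplex \<sigma>" by (rule carrier_simplex[OF assms])
  then have "sum (cd x) \<sigma> \<noteq> 0" by (simp add: geometric_simplex_def)
  then obtain v where "cd x v \<noteq> 0" using sum.neutral by metis
  with coord_nonneg[OF assms, of v] show ?thesis by (intro that[of v]) simp
qed

lemma continuous_coord: "continuous_map X euclideanreal (\<lambda>x. cd x v)"
proof -
  have "continuous_map (geometric_realization S) euclideanreal (\<lambda>t. t v)"
    unfolding geometric_realization_def
  proof (rule continuous_compose_quotient_map[OF quotient_map_quotient_topology])
    show "continuous_map (sum_topology (\<lambda>\<sigma>. subtopology (powertop_real UNIV) (geometric_simplex \<sigma>)) S) euclideanreal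
       ((\<lambda>t. t v) \<circ> snd)"
      by (rule continuous_map_from_sum_topology)
        (auto simp: o_def intro!: continuous_map_from_subtopology continuous_map_product_projection)
  qed
  from continuous_map_compose[OF homeomorphic_imp_continuous_map[OF coord_homeomorphic] this]
  show ?thesis by (simp add: o_def)
qed

lemma continuous_coord_compose:
  "continuous_map Z X f \<Longrightarrow> continuous_map Z euclideanreal (\<lambda>z. cd (f z) v)"
  using continuous_map_compose[OF _ continuous_coord, of Z f v] by (simp add: o_def)

lemma finite_star: "0 < cd x v \<Longrightarrow> x \<in> topspace X \<Longrightarrow> finite {\<sigma> \<in> S. v \<in> \<sigma>}"
  using finite_stars carrier_simplex[of x] simplex_support[of "cd x" _ v]
  unfolding locally_finite_def by (metis (no_types, lifting) UnionI less_irrefl)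

text \<open>The realization has the weak topology, which coordinates detect thanks to local
  finiteness: where the coordinate at \<open>v\<close> is positive, only the finitely many simplices
  containing \<open>v\<close> occur. They give a finite closed cover, and over each member the map
  runs in one simplex.\<close>

lemma continuous_map_into_complex:
  assumes f: "\<And>z. z \<in> topspace Z \<Longrightarrow> f z \<in> topspace X"
    and cont: "\<And>v. continuous_map Z euclideanreal (\<lambda>z. cd (f z) v)"
  shows "continuous_map Z X f"
proof -
  let ?R = "geometric_realization S"
  let ?T = "\<lambda>v. {z \<in> topspace Z. cd (f z) v \<in> {0<..}}"
  have "continuous_map Z ?R (\<lambda>z. cd (f z))"
  proof (rule pasting_lemma[where I = UNIV and T = ?T and f = "\<lambda>_ z. cd (f z)"])
    show "openin Z (?T v)" for v
      by (intro openin_continuous_map_preimage[OF cont]) auto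
    show "continuous_map (subtopology Z (?T v)) ?R (\<lambda>z. cd (f z))" for v
    proof (cases "?T v = {}")
      case True
      show ?thesis unfolding True by simp
    next
      case False
      then have fin: "finite {\<sigma> \<in> S. v \<in> \<sigma>}" using finite_star f by fastforce
      let ?Z = "subtopology Z (?T v)"
      have fp: "continuous_map ?Z (powertop_real UNIV) (\<lambda>z. cd (f z))"
        by (auto simp: continuous_map_componentwise_UNIV intro!: continuous_map_from_subtopology cont)
      show ?thesis
      proof (rule pasting_lemma_closed[where T = "\<lambda>\<sigma>. {z \<in> topspace ?Z. cd (f z) \<in> geometric_simplex \<sigma>}"
            and f = "\<lambda>_ z. cd (f z)", OF fin])
        fix \<sigma> assume \<sigma>: "\<sigma> \<in> {\<sigma> \<in> S. v \<in> \<sigma>}"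
        let ?D = "{z \<in> topspace ?Z. cd (f z) \<in> geometric_simplex \<sigma>}"
        show "closedin ?Z ?D"
          by (rule closedin_continuous_map_preimage[OF fp closedin_geometric_simplex]) (use \<sigma> finite_simplex in auto)
        have 1: "continuous_map (subtopology ?Z ?D) (subtopology (powertop_real UNIV) (geometric_simplex \<sigma>)) (\<lambda>z. cd (f z))"
          using continuous_map_from_subtopology[OF fp] by (auto simp: continuous_map_in_subtopology)
        have 2: "continuous_map (subtopology (powertop_real UNIV) (geometric_simplex \<sigma>)) ?R (snd \<circ> Pair \<sigma>)"
          unfolding geometric_realization_def
          by (rule continuous_map_compose[OF continuous_map_component_injection quotient_imp_continuous_map[OF quotient_map_quotient_topology]])
            (use \<sigma> in auto)
        from continuous_map_compose[OF 1 2] show "continuous_map (subtopology ?Z ?D) ?R (\<lambda>z. cd (f z))"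
          by (simp add: o_def)
      next
        fix z assume z: "z \<in> topspace ?Z"
        then have "f z \<in> topspace X" using f by auto
        then obtain \<sigma> where "\<sigma> \<in> S" "cd (f z) \<in> geometric_simplex \<sigma>" by (rule carrier_simplex)
        moreover from this z have "v \<in> \<sigma>" using simplex_support[of "cd (f z)" \<sigma> v] by auto
        ultimately show "\<exists>j. j \<in> {\<sigma> \<in> S. v \<in> \<sigma>} \<and> z \<in> {z \<in> topspace ?Z. cd (f z) \<in> geometric_simplex j} \<and> cd (f z) = cd (f z)"
          using z by blast
      qed auto
    qed
    show "\<exists>v. v \<in> UNIV \<and> z \<in> ?T v \<and> cd (f z) = cd (f z)" if z: "z \<in> topspace Z" for z
      using exists_positive_coord[OF f[OF z]] z by auto
  qed auto
  moreover have "continuous_map ?R X point"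
  proof -
    obtain g where g: "homeomorphic_maps X ?R cd g"
      using coord_homeomorphic by (auto simp: homeomorphic_map_maps)
    then have "continuous_map ?R X g" by (simp add: homeomorphic_maps_def)
    then show ?thesis
    proof (rule continuous_map_eq)
      fix t assume "t \<in> topspace ?R"
      then have "g t \<in> topspace X" "cd (g t) = t"
        using g by (auto simp: homeomorphic_maps_def continuous_map_def)
      then show "g t = point t" using point_coord by metis
    qed
  qed
  ultimately have "continuous_map Z X (point \<circ> (\<lambda>z. cd (f z)))"
    by (rule continuous_map_compose)
  then show ?thesis
    by (rule continuous_map_eq) (use f point_coord in auto)
qed

lemma closedin_singleton: "b \<in> topspace X \<Longrightarrow> closedin X {b}"
proof -
  assume b: "b \<in> topspace X"
  have "closedin X {x \<in> topspace X. cd x v \<in> {cd b v}}" for v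
    by (rule closedin_continuous_map_preimage[OF continuous_coord]) simp
  then have "closedin X (\<Inter>v. {x \<in> topspace X. cd x v \<in> {cd b v}})"
    by (intro closedin_Inter) blast+
  moreover have "x = b" if "x \<in> topspace X" "\<And>v. cd x v = cd b v" for x
    by (rule inj_onD[OF coord_inj ext]) (use that b in auto)
  then have "(\<Inter>v. {x \<in> topspace X. cd x v \<in> {cd b v}}) = {b}"
    using b by auto
  ultimately show ?thesis by simp
qed

section \<open>Segments in a common simplex\<close>

lemma common_simplexI:
  "\<sigma> \<in> S \<Longrightarrow> cd x \<in> geometric_simplex \<sigma> \<Longrightarrow> cd y \<in> geometric_simplex \<sigma> \<Longrightarrow> common_simplex C x y"
  by (auto simp: common_simplex_def)

lemma common_simplex_refl: "x \<in> topspace X \<Longrightarrow> common_simplex C x x"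
  by (erule carrier_simplex) (rule common_simplexI)

lemma common_simplex_sym: "common_simplex C x y \<Longrightarrow> common_simplex C y x"
  by (auto simp: common_simplex_def)

definition segment :: "real \<Rightarrow> 'a \<Rightarrow> 'a \<Rightarrow> 'a" where
  "segment s x y = point (\<lambda>v. (1 - s) * cd x v + s * cd y v)"

lemma segment_coord_simplex:
  assumes "\<sigma> \<in> S" "cd x \<in> geometric_simplex \<sigma>" "cd y \<in> geometric_simplex \<sigma>" "0 \<le> s" "s \<le> 1"
  shows "(\<lambda>v. (1 - s) * cd x v + s * cd y v) \<in> geometric_simplex \<sigma>"
  using assms by (auto simp: geometric_simplex_def sum.distrib simp flip: sum_distrib_left)

lemma coord_segment:
  assumes "common_simplex C x y" "0 \<le> s" "s \<le> 1"
  shows "cd (segment s x y) v = (1 - s) * cd x v + s * cd y v"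
proof -
  obtain \<sigma> where \<sigma>: "\<sigma> \<in> S" "cd x \<in> geometric_simplex \<sigma>" "cd y \<in> geometric_simplex \<sigma>"
    using assms(1) by (auto simp: common_simplex_def)
  show ?thesis
    unfolding segment_def coord_point[OF \<sigma>(1) segment_coord_simplex[OF \<sigma> assms(2,3)]] ..
qed

lemma segment_simplex:
  assumes "\<sigma> \<in> S" "cd x \<in> geometric_simplex \<sigma>" "cd y \<in> geometric_simplex \<sigma>" "0 \<le> s" "s \<le> 1"
  shows "cd (segment s x y) \<in> geometric_simplex \<sigma>" "segment s x y \<in> topspace X"
  unfolding segment_def coord_point[OF assms(1) segment_coord_simplex[OF assms]]
  using segment_coord_simplex[OF assms] point_in[OF assms(1) segment_coord_simplex[OF assms]] by blast+

lemma segment_in: "common_simplex C x y \<Longrightarrow> 0 \<le> s \<Longrightarrow> s \<le> 1 \<Longrightarrow> segment s x y \<in> topspace X"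
  using segment_simplex(2) by (auto simp: common_simplex_def)

lemma segment_0: "x \<in> topspace X \<Longrightarrow> segment 0 x y = x"
  by (simp add: segment_def point_coord)

lemma segment_same: "x \<in> topspace X \<Longrightarrow> segment s x x = x"
  by (simp add: segment_def point_coord algebra_simps)

lemma segment_half: "segment (1/2) x y = segment (1/2) y x"
  by (simp add: segment_def algebra_simps)

lemma continuous_segment:
  assumes "continuous_map Z X f" "continuous_map Z X g" "continuous_map Z euclideanreal s"
    and "\<And>z. z \<in> topspace Z \<Longrightarrow> common_simplex C (f z) (g z)"
    and "\<And>z. z \<in> topspace Z \<Longrightarrow> 0 \<le> s z \<and> s z \<le> 1"
  shows "continuous_map Z X (\<lambda>z. segment (s z) (f z) (g z))"
proof (rule continuous_map_into_complex)
  show "segment (s z) (f z) (g z) \<in> topspace X" if "z \<in> topspace Z" for z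
    using segment_in assms(4,5) that by blast
  fix v
  have "continuous_map Z euclideanreal (\<lambda>z. (1 - s z) * cd (f z) v + s z * cd (g z) v)"
    by (intro continuous_intros assms continuous_coord_compose)
  then show "continuous_map Z euclideanreal (\<lambda>z. cd (segment (s z) (f z) (g z)) v)"
    by (rule continuous_map_eq) (use assms coord_segment in auto)
qed

text \<open>Two nearby points need not lie in a common simplex, but as soon as their supports meet, the
  normalised minimum of their coordinates lies in a common simplex with either of them.\<close>

definition overlap :: "'a \<Rightarrow> 'a \<Rightarrow> real" where
  "overlap x y = (\<Sum>v | cd x v \<noteq> 0. min (cd x v) (cd y v))"

text \<open>The index set in \<open>overlap\<close> varies with the point. It may be replaced by any
  finite set containing the common support: the vertices of a star for continuity, a carrier simplex
  for \<open>meet\<close>.\<close>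

lemma overlap_eq:
  assumes x: "x \<in> topspace X" and y: "y \<in> topspace X" and F: "finite F" 
    and sub: "\<And>v. cd x v \<noteq> 0 \<Longrightarrow> cd y v \<noteq> 0 \<Longrightarrow> v \<in> F"
  shows "overlap x y = (\<Sum>v\<in>F. min (cd x v) (cd y v))"
proof -
  obtain \<sigma> where \<sigma>: "\<sigma> \<in> S" "cd x \<in> geometric_simplex \<sigma>" by (rule carrier_simplex[OF x])
  have "{v. cd x v \<noteq> 0} \<subseteq> \<sigma>" using simplex_support[OF \<sigma>(2)] by auto
  then have "finite {v. cd x v \<noteq> 0}" using finite_simplex[OF \<sigma>(1)] finite_subset by blast
  then have "overlap x y = (\<Sum>v\<in>{v. cd x v \<noteq> 0} \<inter> F. min (cd x v) (cd y v))"
    unfolding overlap_def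
  proof (intro sum.mono_neutral_right ballI)
    fix v assume "v \<in> {v. cd x v \<noteq> 0} - {v. cd x v \<noteq> 0} \<inter> F"
    then show "min (cd x v) (cd y v) = 0"
      using sub[of v] coord_nonneg[OF x, of v] by (auto simp: min_def)
  qed auto
  also have "\<dots> = (\<Sum>v\<in>F. min (cd x v) (cd y v))"
    using F coord_nonneg[OF y] by (intro sum.mono_neutral_left) (auto simp: min_def)
  finally show ?thesis .
qed

lemma overlap_nonneg: "x \<in> topspace X \<Longrightarrow> y \<in> topspace X \<Longrightarrow> 0 \<le> overlap x y"
  by (auto simp: overlap_def coord_nonneg intro!: sum_nonneg)

lemma overlap_same:
  assumes "x \<in> topspace X" shows "overlap x x = 1"
proof -
  obtain \<sigma> where \<sigma>: "\<sigma> \<in> S" "cd x \<in> geometric_simplex \<sigma>" by (rule carrier_simplex[OF assms])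
  then show ?thesis
    using overlap_eq[OF assms assms finite_simplex[OF \<sigma>(1)]] simplex_support[OF \<sigma>(2)]
    by (simp add: geometric_simplex_def)
qed

text \<open>Where the coordinate of \<open>f z\<close> at \<open>v\<close> is positive, the support
  of \<open>f z\<close> lies in the finite union of the simplices at \<open>v\<close>, so the index
  set of the sum can be fixed locally.\<close>

lemma continuous_overlap:
  assumes f: "continuous_map Z X f" and g: "continuous_map Z X g"
  shows "continuous_map Z euclideanreal (\<lambda>z. overlap (f z) (g z))"
proof -
  let ?T = "\<lambda>v. {z \<in> topspace Z. cd (f z) v \<in> {0<..}}"
  have fX: "f z \<in> topspace X" "g z \<in> topspace X" if "z \<in> topspace Z" for z
    using f g that by (auto simp: continuous_map_def)
  show ?thesis
  proof (rule pasting_lemma[where I = UNIV and T = ?T and f = "\<lambda>_ z. overlap (f z) (g z)"])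
    show "openin Z (?T v)" for v
      by (intro openin_continuous_map_preimage[OF continuous_coord_compose[OF f]]) auto
    show "continuous_map (subtopology Z (?T v)) euclideanreal (\<lambda>z. overlap (f z) (g z))" for v
    proof (cases "?T v = {}")
      case True
      show ?thesis unfolding True by simp
    next
      case False
      let ?F = "\<Union>{\<sigma> \<in> S. v \<in> \<sigma>}"
      have fin: "finite ?F" using False finite_star fX finite_simplex by fastforce
      have "continuous_map (subtopology Z (?T v)) euclideanreal (\<lambda>z. \<Sum>w\<in>?F. min (cd (f z) w) (cd (g z) w))"
        by (intro continuous_map_from_subtopology continuous_intros fin continuous_coord_compose f g)
      then show ?thesis
      proof (rule continuous_map_eq)
        fix z assume "z \<in> topspace (subtopology Z (?T v))"
        then have z: "z \<in> topspace Z" "0 < cd (f z) v" by auto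
        obtain \<sigma> where \<sigma>: "\<sigma> \<in> S" "cd (f z) \<in> geometric_simplex \<sigma>" by (rule carrier_simplex[OF fX(1)[OF z(1)]])
        have "v \<in> \<sigma>" using z simplex_support[OF \<sigma>(2), of v] by auto
        show "(\<Sum>w\<in>?F. min (cd (f z) w) (cd (g z) w)) = overlap (f z) (g z)"
          by (rule overlap_eq[symmetric, OF fX[OF z(1)] fin]) (use simplex_support[OF \<sigma>(2)] \<open>v \<in> \<sigma>\<close> \<sigma> in blast)
      qed
    qed
    show "\<exists>v. v \<in> UNIV \<and> z \<in> ?T v \<and> overlap (f z) (g z) = overlap (f z) (g z)" if z: "z \<in> topspace Z" for z
      using exists_positive_coord[OF fX(1)[OF z]] z by auto
  qed auto
qed

definition meet :: "'a \<Rightarrow> 'a \<Rightarrow> 'a" where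
  "meet x y = point (\<lambda>v. min (cd x v) (cd y v) / overlap x y)"

lemma meet:
  assumes x: "x \<in> topspace X" and y: "y \<in> topspace X" and pos: "0 < overlap x y"
  shows "meet x y \<in> topspace X" "cd (meet x y) v = min (cd x v) (cd y v) / overlap x y"
    "common_simplex C (meet x y) x" "common_simplex C y (meet x y)"
proof -
  obtain \<sigma> where \<sigma>: "\<sigma> \<in> S" "cd x \<in> geometric_simplex \<sigma>" by (rule carrier_simplex[OF x])
  obtain \<tau> where \<tau>: "\<tau> \<in> S" "cd y \<in> geometric_simplex \<tau>" by (rule carrier_simplex[OF y])
  let ?t = "\<lambda>v. min (cd x v) (cd y v) / overlap x y"
  have 1: "?t \<in> geometric_simplex \<sigma>"
    using overlap_eq[OF x y finite_simplex[OF \<sigma>(1)]] simplex_support[OF \<sigma>(2)] pos coord_nonneg[OF x] coord_nonneg[OF y] \<sigma>(2)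
    by (auto simp: geometric_simplex_def min_def simp flip: sum_divide_distrib)
  have 2: "?t \<in> geometric_simplex \<tau>"
    using overlap_eq[OF x y finite_simplex[OF \<tau>(1)]] simplex_support[OF \<tau>(2)] pos coord_nonneg[OF x] coord_nonneg[OF y] \<tau>(2)
    by (auto simp: geometric_simplex_def min_def simp flip: sum_divide_distrib) (metis order.antisym)
  show "meet x y \<in> topspace X" unfolding meet_def by (rule point_in[OF \<sigma>(1) 1])
  have 3: "cd (meet x y) = ?t" unfolding meet_def by (rule coord_point[OF \<sigma>(1) 1])
  then show "cd (meet x y) v = ?t v" by simp
  show "common_simplex C (meet x y) x" by (rule common_simplexI[OF \<sigma>(1)]) (use 1 3 \<sigma> in auto)
  show "common_simplex C y (meet x y)" by (rule common_simplexI[OF \<tau>(1)]) (use 2 3 \<tau> in auto)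
qed

lemma meet_same: "x \<in> topspace X \<Longrightarrow> meet x x = x"
  by (simp add: meet_def overlap_same point_coord)

lemma continuous_meet:
  assumes f: "continuous_map Z X f" and g: "continuous_map Z X g"
    and pos: "\<And>z. z \<in> topspace Z \<Longrightarrow> 0 < overlap (f z) (g z)"
  shows "continuous_map Z X (\<lambda>z. meet (f z) (g z))"
proof (rule continuous_map_into_complex)
  have fX: "f z \<in> topspace X" "g z \<in> topspace X" if "z \<in> topspace Z" for z
    using f g that by (auto simp: continuous_map_def)
  show "meet (f z) (g z) \<in> topspace X" if "z \<in> topspace Z" for z
    using meet(1)[OF fX[OF that] pos[OF that]] .
  fix v
  have "continuous_map Z euclideanreal (\<lambda>z. min (cd (f z) v) (cd (g z) v) / overlap (f z) (g z))"
    by (intro continuous_intros continuous_coord_compose f g continuous_overlap) (use pos in force)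
  then show "continuous_map Z euclideanreal (\<lambda>z. cd (meet (f z) (g z)) v)"
    by (rule continuous_map_eq) (use meet(2)[OF fX pos] in auto)
qed

end

section \<open>Classes of tuples\<close>

text \<open>Maps on tuples read the entries from \<open>x 0\<close> upwards. Concatenation,
  subdivision and the twisted homomorphisms all arise from such folds.\<close>

primrec fold_steps :: "('a \<Rightarrow> 'a \<Rightarrow> 's \<Rightarrow> 's) \<Rightarrow> (nat \<Rightarrow> 'a) \<Rightarrow> 's \<Rightarrow> nat \<Rightarrow> 's" where
  "fold_steps F x s 0 = s"
| "fold_steps F x s (Suc n) = F (x (Suc n)) (x n) (fold_steps F x s n)"

lemma fold_steps_cong:
  "(\<And>i. i \<le> n \<Longrightarrow> x i = y i) \<Longrightarrow> fold_steps F x s n = fold_steps F y s n"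
  by (induction n) auto

definition tuple_snoc :: "'a tuple \<Rightarrow> 'a \<Rightarrow> 'a tuple" where
  "tuple_snoc p z = (Suc (fst p), (snd p)(Suc (fst p) := z))"

definition unit_class :: "'a scomplex \<Rightarrow> 'a \<Rightarrow> 'a tuple set" where
  "unit_class C b = tuple_class C (0, \<lambda>j\<in>{..0}. b)"

context lf_complex
begin

abbreviation "L \<equiv> milnor_L C"
abbreviation "cls \<equiv> tuple_class C"
abbreviation "valid p \<equiv> snd p \<in> L_tuples C (fst p)"

definition tuples :: "nat \<Rightarrow> (nat \<Rightarrow> 'a) topology" where
  "tuples n = subtopology (product_topology (\<lambda>_. X) {..n}) (L_tuples C n)"

lemma topspace_tuples: "topspace (tuples n) = L_tuples C n"
  by (auto simp: tuples_def L_tuples_def)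

lemma L_eq: "L = quotient_topology (sum_topology tuples UNIV) cls"
  unfolding milnor_L_def tuples_def ..

lemma quotient_map_cls: "quotient_map (sum_topology tuples UNIV) L cls"
  unfolding L_eq by (rule quotient_map_quotient_topology)

lemma topspace_L: "topspace L = {cls p | p. valid p}"
proof -
  have "topspace (sum_topology tuples UNIV) = {p. valid p}"
    by (auto simp: topspace_tuples)
  then show ?thesis unfolding L_eq setcompr_eq_image by simp
qed

lemma in_L: "valid p \<Longrightarrow> cls p \<in> topspace L"
  unfolding topspace_L by blast

lemma L_cases:
  assumes "c \<in> topspace L"
  obtains n x where "x \<in> L_tuples C n" "c = cls (n, x)"
proof -
  obtain p where "valid p" "c = cls p"
    using assms unfolding topspace_L by blast
  then show ?thesis by (intro that[of "snd p" "fst p"]) simp_all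
qed

lemma L_tuples_in: "x \<in> L_tuples C n \<Longrightarrow> i \<le> n \<Longrightarrow> x i \<in> topspace X"
  by (auto simp: L_tuples_def)

lemma L_tuples_adjacent: "x \<in> L_tuples C n \<Longrightarrow> i < n \<Longrightarrow> common_simplex C (x (Suc i)) (x i)"
  by (auto simp: L_tuples_def)

text \<open>An omission creates a single new pair of neighbours, and none if the last entry goes;
  hence the restriction to \<open>i \<le> n\<close> in \<open>adj\<close>.\<close>

lemma omit_entry_L_tuples:
  assumes x: "x \<in> L_tuples C (Suc n)" and i: "1 \<le> i"
    and adj: "i \<le> n \<Longrightarrow> common_simplex C (x (Suc i)) (x (i - 1))"
  shows "omit_entry n i x \<in> L_tuples C n"
proof -
  have "common_simplex C (omit_entry n i x (Suc j)) (omit_entry n i x j)" if j: "j < n" for j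
  proof -
    consider "Suc j < i" | "Suc j = i" | "i \<le> j" by linarith
    then show ?thesis
    proof cases
      case 1
      then show ?thesis using j L_tuples_adjacent[OF x, of j] by (simp add: omit_entry_def)
    next
      case 2
      then show ?thesis using j adj by (auto simp: omit_entry_def)
    next
      case 3
      then show ?thesis using j L_tuples_adjacent[OF x, of "Suc j"] by (simp add: omit_entry_def)
    qed
  qed
  moreover have "omit_entry n i x \<in> {..n} \<rightarrow>\<^sub>E topspace X"
    using L_tuples_in[OF x] by (auto simp: omit_entry_def)
  ultimately show ?thesis by (auto simp: L_tuples_def)
qed

lemma tuple_step_valid:
  assumes "tuple_step C p q"
  shows "valid p" "valid q" "snd p (fst p) = snd q (fst q)" "snd p 0 = snd q 0"
  using assms
proof (induction rule: tuple_step.induct)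
  case (repeat x n i)
  { case 1 then show ?case using repeat by simp
  next case 2
    have "common_simplex C (x (Suc i)) (x (i - 1))" if "i \<le> n"
      using L_tuples_adjacent[of x "Suc n" i] repeat that by simp
    then show ?case using omit_entry_L_tuples repeat by simp
  next case 3
    show ?case
    proof (cases "i \<le> n")
      case True
      then show ?thesis by (simp add: omit_entry_def)
    next
      case False
      with repeat have "i = Suc n" by simp
      then show ?thesis using repeat by (simp add: omit_entry_def)
    qed
  next case 4 then show ?case using repeat by (simp add: omit_entry_def) }
next
  case (backtrack x n i)
  { case 1 then show ?case using backtrack by simp
  next case 2
    have "common_simplex C (x (Suc i)) (x (i - 1))"
      using common_simplex_refl[OF L_tuples_in[of x "Suc n" "Suc i"]] backtrack by simp
    then show ?case using omit_entry_L_tuples backtrack by simp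
  next case 3 then show ?case using backtrack by (simp add: omit_entry_def)
  next case 4 then show ?case using backtrack by (simp add: omit_entry_def) }
qed

lemma cls_eq_iff: "cls p = cls q \<longleftrightarrow> equivclp (tuple_step C) p q"
proof
  assume eq: "cls p = cls q"
  have "q \<in> cls p" unfolding eq by (simp add: tuple_class_def)
  then show "equivclp (tuple_step C) p q" by (simp add: tuple_class_def)
next
  assume pq: "equivclp (tuple_step C) p q"
  have "equivclp (tuple_step C) p r \<longleftrightarrow> equivclp (tuple_step C) q r" for r
    by (meson equivclp_sym equivclp_trans pq)
  then show "cls p = cls q" by (simp add: tuple_class_def)
qed

lemma cls_invariant:
  assumes eq: "cls p = cls q" and step: "\<And>p q. tuple_step C p q \<Longrightarrow> f p = f q"
  shows "f p = f q"
proof -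
  have "equivclp (tuple_step C) p q" using eq cls_eq_iff by blast
  then show ?thesis by (induction rule: equivclp_induct) (use step in metis)+
qed

lemma cls_step: "tuple_step C p q \<Longrightarrow> cls p = cls q"
  using cls_eq_iff by blast

lemma valid_cls_eq: "cls p = cls q \<Longrightarrow> valid p \<longleftrightarrow> valid q"
  by (rule cls_invariant) (use tuple_step_valid in auto)

lemma mem_cls: "q \<in> cls p \<longleftrightarrow> cls p = cls q"
  by (simp add: cls_eq_iff) (simp add: tuple_class_def)

lemma cls_image_eq:
  assumes "\<And>p q. tuple_step C p q \<Longrightarrow> f p = f q"
  shows "f ` cls p = {f p}"
proof -
  have "f p = f q" if "q \<in> cls p" for q
    by (rule cls_invariant[OF _ assms]) (use that mem_cls in simp_all)
  moreover have "p \<in> cls p" by (simp add: mem_cls)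
  ultimately show ?thesis by fastforce
qed

lemma class_end_cls [simp]: "class_end (cls (n, x)) = x n"
proof -
  have "(\<lambda>(n, x). x n) ` cls (n, x) = {(\<lambda>(n, x). x n) (n, x)}"
    by (rule cls_image_eq) (use tuple_step_valid(3) in \<open>simp add: case_prod_unfold\<close>)
  then show ?thesis by (simp add: class_end_def)
qed

lemma class_start_cls [simp]: "class_start (cls (n, x)) = x 0"
proof -
  have "(\<lambda>(n, x). x 0) ` cls (n, x) = {(\<lambda>(n, x). x 0) (n, x)}"
    by (rule cls_image_eq) (use tuple_step_valid(4) in \<open>simp add: case_prod_unfold\<close>)
  then show ?thesis by (simp add: class_start_def)
qed

lemma class_end_in: "c \<in> topspace L \<Longrightarrow> class_end c \<in> topspace X"
  by (erule L_cases) (auto intro: L_tuples_in)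

lemma unit_class:
  assumes "b \<in> topspace X"
  shows "unit_class C b \<in> topspace L" "class_end (unit_class C b) = b" "class_start (unit_class C b) = b"
  using assms by (auto simp: unit_class_def L_tuples_def intro!: in_L)

text \<open>This is the criterion for a fold to descend to classes: \<open>stay\<close> deals with
  repetitions, \<open>undo\<close> with backtracks. \<open>Ok\<close> confines both to states that
  belong to the current point, where alone cancellation can be expected.\<close>

lemma fold_steps_step:
  assumes step: "tuple_step C p q"
    and s0: "s \<in> Ok (snd p 0)"
    and Ok: "\<And>y x s. common_simplex C y x \<Longrightarrow> x \<in> topspace X \<Longrightarrow> y \<in> topspace X \<Longrightarrow> s \<in> Ok x \<Longrightarrow> F y x s \<in> Ok y"
    and stay: "\<And>x s. x \<in> topspace X \<Longrightarrow> s \<in> Ok x \<Longrightarrow> F x x s = s"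
    and undo: "\<And>x y s. common_simplex C y x \<Longrightarrow> x \<in> topspace X \<Longrightarrow> y \<in> topspace X \<Longrightarrow> s \<in> Ok x \<Longrightarrow> F x y (F y x s) = s"
  shows "fold_steps F (snd p) s (fst p) = fold_steps F (snd q) s (fst q)"
proof -
  have ok: "fold_steps F x s k \<in> Ok (x k)" if "x \<in> L_tuples C m" "k \<le> m" "s \<in> Ok (x 0)" for x m k
    using that(2)
  proof (induction k)
    case (Suc k)
    then show ?case using that Ok[OF L_tuples_adjacent[OF that(1), of k]] L_tuples_in[OF that(1)] by simp
  qed (use that in simp)
  from step s0 show ?thesis
  proof (induction rule: tuple_step.induct)
    case (repeat x n i)
    let ?y = "omit_entry n i x"
    obtain j where i: "i = Suc j" using repeat(2) by (cases i) auto
    \<comment> \<open>After the repetition the shortened tuple runs one index behind. The equal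
      entries have the indices \<open>i - 1\<close> and \<open>i\<close>, so this begins at
      \<open>i - 1\<close>.\<close>
    have "fold_steps F ?y s k = fold_steps F x s (Suc k)" if "i - 1 \<le> k" "k \<le> n" for k
      using that
    proof (induction rule: dec_induct)
      case base
      have "fold_steps F ?y s (i - 1) = fold_steps F x s (i - 1)"
        using repeat base by (intro fold_steps_cong) (auto simp: omit_entry_def)
      also have "\<dots> = fold_steps F x s (Suc (i - 1))"
        using stay[OF L_tuples_in[OF repeat(1), of j] ok[OF repeat(1), of j]] repeat i by simp
      finally show ?case .
    next
      case (step k)
      have "?y (Suc k) = x (Suc (Suc k))" using step i by (simp add: omit_entry_def)
      moreover have "?y k = x (Suc k)"
      proof (cases "i \<le> k")
        case True
        then show ?thesis using step by (simp add: omit_entry_def)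
      next
        case False
        then have "i = Suc k" using step by simp
        then show ?thesis using repeat step by (simp add: omit_entry_def)
      qed
      ultimately show ?case using step by simp
    qed
    from this[of n] show ?case using repeat by simp
  next
    case (backtrack x n i)
    let ?y = "omit_entry n i x"
    obtain j where i: "i = Suc j" using backtrack(2) by (cases i) auto
    \<comment> \<open>Omitting the turning point makes its two equal neighbours adjacent: the
      shortened tuple makes one stationary step where the original goes forth and back.\<close>
    have "fold_steps F ?y s k = fold_steps F x s (Suc k)" if "i \<le> k" "k \<le> n" for k
      using that
    proof (induction rule: dec_induct)
      case base
      have okj: "fold_steps F x s j \<in> Ok (x j)" using ok[OF backtrack(1), of j] backtrack i by simp
      have xj: "x j \<in> topspace X" "x (Suc j) \<in> topspace X" using L_tuples_in[OF backtrack(1)] backtrack i by auto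
      have eq: "x (Suc (Suc j)) = x j" using backtrack i by simp
      have "fold_steps F ?y s j = fold_steps F x s j"
        using backtrack i by (intro fold_steps_cong) (auto simp: omit_entry_def)
      moreover have "?y (Suc j) = x j" "?y j = x j"
        using backtrack i by (auto simp: omit_entry_def)
      ultimately have "fold_steps F ?y s i = fold_steps F x s j"
        using stay[OF xj(1) okj] i by simp
      moreover have "fold_steps F x s (Suc i) = fold_steps F x s j"
        using undo[OF _ xj okj] L_tuples_adjacent[OF backtrack(1), of j] backtrack i eq by simp
      ultimately show ?case by simp
    next
      case (step k)
      then show ?case by (simp add: omit_entry_def)
    qed
    from this[of n] show ?case using backtrack by simp
  qed
qed

section \<open>Appending a point to a class\<close>

lemma tuple_snoc_valid:
  assumes "valid p" "z \<in> topspace X" "common_simplex C z (snd p (fst p))"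
  shows "valid (tuple_snoc p z)"
  using assms by (auto simp: L_tuples_def tuple_snoc_def PiE_iff extensional_def less_Suc_eq)

text \<open>Later constructions append single points instead of concatenating paths, which keeps the
  length of representing tuples under control. The chosen representative is immaterial by
  \<open>csnoc_cls\<close>.\<close>

definition csnoc :: "'a tuple set \<Rightarrow> 'a \<Rightarrow> 'a tuple set" where
  "csnoc c z = cls (tuple_snoc (SOME p. p \<in> c) z)"

lemma omit_entry_snoc:
  "i \<le> Suc n \<Longrightarrow> omit_entry (Suc n) i (x(Suc (Suc n) := z)) = (omit_entry n i x)(Suc n := z)"
  by (auto simp: omit_entry_def fun_eq_iff)

lemma tuple_step_snoc:
  assumes "tuple_step C p q" "z \<in> topspace X" "common_simplex C z (snd p (fst p))"
  shows "tuple_step C (tuple_snoc p z) (tuple_snoc q z)"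
  using assms
proof (induction rule: tuple_step.induct)
  case (repeat x n i)
  moreover have "i - 1 \<noteq> Suc (Suc n)" using repeat by simp
  ultimately show ?case
    using tuple_step.repeat[of "x(Suc (Suc n) := z)" C "Suc n" i] tuple_snoc_valid[of "(Suc n, x)" z]
    by (simp add: tuple_snoc_def omit_entry_snoc)
next
  case (backtrack x n i)
  moreover have "i - 1 \<noteq> Suc (Suc n)" using backtrack by simp
  ultimately show ?case
    using tuple_step.backtrack[of "x(Suc (Suc n) := z)" C "Suc n" i] tuple_snoc_valid[of "(Suc n, x)" z]
    by (simp add: tuple_snoc_def omit_entry_snoc)
qed

lemma csnoc_cls:
  assumes p: "valid p" and z: "z \<in> topspace X" "common_simplex C z (snd p (fst p))"
  shows "csnoc (cls p) z = cls (tuple_snoc p z)"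
proof -
  let ?q = "SOME q. q \<in> cls p"
  let ?f = "\<lambda>q. if common_simplex C z (snd q (fst q)) then cls (tuple_snoc q z) else {}"
  have eq: "cls p = cls ?q"
    using someI[of "\<lambda>q. q \<in> cls p" p] by (simp add: mem_cls)
  have "?f p = ?f ?q"
  proof (rule cls_invariant[OF eq])
    fix p q assume step: "tuple_step C p q"
    show "?f p = ?f q"
      using tuple_step_valid(3)[OF step] cls_step[OF tuple_step_snoc[OF step z(1)]] by auto
  qed
  moreover have "snd p (fst p) = snd ?q (fst ?q)"
    by (rule cls_invariant[OF eq]) (rule tuple_step_valid(3))
  ultimately show ?thesis using z by (simp add: csnoc_def)
qed

lemma csnoc:
  assumes c: "c \<in> topspace L" and z: "z \<in> topspace X" "common_simplex C z (class_end c)"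
  shows "csnoc c z \<in> topspace L" "class_end (csnoc c z) = z" "class_start (csnoc c z) = class_start c"
proof -
  obtain n x where x: "x \<in> L_tuples C n" "c = cls (n, x)" using L_cases[OF c] .
  have v: "valid (tuple_snoc (n, x) z)" and eq: "csnoc c z = cls (tuple_snoc (n, x) z)"
    using tuple_snoc_valid[of "(n, x)" z] csnoc_cls[of "(n, x)" z] x z by auto
  show "csnoc c z \<in> topspace L" using v in_L eq by simp
  show "class_end (csnoc c z) = z" "class_start (csnoc c z) = class_start c"
    unfolding eq by (simp_all add: tuple_snoc_def x(2))
qed

lemma csnoc_stay:
  assumes c: "c \<in> topspace L"
  shows "csnoc c (class_end c) = c"
proof -
  obtain n x where x: "x \<in> L_tuples C n" "c = cls (n, x)" using L_cases[OF c] .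
  have xn: "x n \<in> topspace X" using L_tuples_in[OF x(1)] by simp
  have v: "valid (tuple_snoc (n, x) (x n))"
    using tuple_snoc_valid[of "(n, x)" "x n"] x xn common_simplex_refl by simp
  have "tuple_step C (tuple_snoc (n, x) (x n)) (n, omit_entry n (Suc n) (x(Suc n := x n)))"
    using tuple_step.repeat[of "x(Suc n := x n)" C n "Suc n"] v by (simp add: tuple_snoc_def)
  moreover have "omit_entry n (Suc n) (x(Suc n := x n)) = x"
    using x(1) by (auto simp: omit_entry_def fun_eq_iff L_tuples_def PiE_def extensional_def)
  ultimately have "cls (tuple_snoc (n, x) (x n)) = c"
    using cls_step x(2) by metis
  then show ?thesis using csnoc_cls[of "(n, x)" "x n"] x xn common_simplex_refl by simp
qed

text \<open>Removing the turning point \<open>z\<close> leaves the old end twice;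
  \<open>csnoc_stay\<close> then removes the repetition.\<close>

lemma csnoc_back:
  assumes c: "c \<in> topspace L" and z: "z \<in> topspace X" "common_simplex C z (class_end c)"
  shows "csnoc (csnoc c z) (class_end c) = c"
proof -
  obtain n x where x: "x \<in> L_tuples C n" "c = cls (n, x)" using L_cases[OF c] .
  have xn: "x n \<in> topspace X" using L_tuples_in[OF x(1)] by simp
  let ?p = "tuple_snoc (n, x) z"
  have vp: "valid ?p" and eq: "csnoc c z = cls ?p"
    using tuple_snoc_valid[of "(n, x)" z] csnoc_cls[of "(n, x)" z] x z by auto
  have "common_simplex C (x n) z" using common_simplex_sym z x by simp
  then have vpp: "valid (tuple_snoc ?p (x n))" and eq2: "csnoc (csnoc c z) (x n) = cls (tuple_snoc ?p (x n))"
    using tuple_snoc_valid[of ?p "x n"] csnoc_cls[of ?p "x n"] vp xn unfolding eq by (auto simp: tuple_snoc_def)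
  have "tuple_step C (tuple_snoc ?p (x n)) (Suc n, omit_entry (Suc n) (Suc n) (snd (tuple_snoc ?p (x n))))"
    using tuple_step.backtrack[of "snd (tuple_snoc ?p (x n))" C "Suc n" "Suc n"] vpp
    by (simp add: tuple_snoc_def)
  moreover have "(Suc n, omit_entry (Suc n) (Suc n) (snd (tuple_snoc ?p (x n)))) = tuple_snoc (n, x) (x n)"
    using x(1) by (auto simp: omit_entry_def fun_eq_iff L_tuples_def PiE_def extensional_def tuple_snoc_def)
  ultimately have "cls (tuple_snoc ?p (x n)) = cls (tuple_snoc (n, x) (x n))"
    using cls_step by metis
  also have "\<dots> = c"
    using csnoc_stay[OF c] csnoc_cls[of "(n, x)" "x n"] x xn common_simplex_refl by simp
  finally show ?thesis using eq2 x(2) by simp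
qed

lemma csnoc_fold_in:
  assumes x: "x \<in> L_tuples C n" and c: "c \<in> topspace L" "class_end c = x 0" and k: "k \<le> n"
  shows "fold_steps (\<lambda>y _ c. csnoc c y) x c k \<in> topspace L"
    "class_end (fold_steps (\<lambda>y _ c. csnoc c y) x c k) = x k"
    "class_start (fold_steps (\<lambda>y _ c. csnoc c y) x c k) = class_start c"
proof -
  let ?f = "fold_steps (\<lambda>y _ c. csnoc c y) x c"
  have "?f k \<in> topspace L \<and> class_end (?f k) = x k \<and> class_start (?f k) = class_start c"
    using k by (induction k) (use c csnoc L_tuples_in[OF x] L_tuples_adjacent[OF x] in auto)
  then show "?f k \<in> topspace L" "class_end (?f k) = x k" "class_start (?f k) = class_start c" by auto
qed

lemma csnoc_fold_step:
  assumes "tuple_step C p q" "c \<in> topspace L" "class_end c = snd p 0"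
  shows "fold_steps (\<lambda>y _ c. csnoc c y) (snd p) c (fst p) = fold_steps (\<lambda>y _ c. csnoc c y) (snd q) c (fst q)"
  by (rule fold_steps_step[OF assms(1), where Ok = "\<lambda>x. {c \<in> topspace L. class_end c = x}"])
    (use assms csnoc csnoc_stay csnoc_back common_simplex_sym in auto)

lemma concat_tuple_cls:
  assumes x: "x \<in> L_tuples C n" and q: "valid q" and adj: "x 0 = snd q (fst q)"
  shows "valid (concat_tuple (n, x) q)"
    "cls (concat_tuple (n, x) q) = fold_steps (\<lambda>y _ c. csnoc c y) x (cls q) n"
proof -
  obtain m y where qq: "q = (m, y)" by force
  let ?f = "fold_steps (\<lambda>y _ c. csnoc c y) x (cls q)"
  let ?p = "\<lambda>k. concat_tuple (k, x) q"
  have "valid (?p k) \<and> snd (?p k) (fst (?p k)) = x k \<and> cls (?p k) = ?f k" if "k \<le> n" for k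
    using that
  proof (induction k)
    case 0
    \<comment> \<open>The first appended entry repeats the end of \<open>q\<close> and does not
      change the class. Hence the fold starts at \<open>cls q\<close> itself.\<close>
    have "?p 0 = tuple_snoc q (x 0)"
      using q by (auto simp: concat_tuple_def tuple_snoc_def qq fun_eq_iff L_tuples_def PiE_def extensional_def)
    moreover have x0: "x 0 \<in> topspace X" "common_simplex C (x 0) (snd q (fst q))"
      using L_tuples_in[OF x, of 0] common_simplex_refl adj by auto
    moreover have "csnoc (cls q) (x 0) = cls q"
      using csnoc_stay[OF in_L[OF q]] adj by (simp add: qq)
    moreover have "snd (tuple_snoc q (x 0)) (fst (tuple_snoc q (x 0))) = x 0"
      by (simp add: tuple_snoc_def)
    ultimately show ?case
      using tuple_snoc_valid[OF q x0] csnoc_cls[OF q x0] by (metis fold_steps.simps(1))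
  next
    case (Suc k)
    have eq: "?p (Suc k) = tuple_snoc (?p k) (x (Suc k))"
      by (auto simp: concat_tuple_def tuple_snoc_def qq fun_eq_iff)
    have a: "valid (?p k)" "snd (?p k) (fst (?p k)) = x k" "cls (?p k) = ?f k"
      using Suc by auto
    have b: "x (Suc k) \<in> topspace X" "common_simplex C (x (Suc k)) (snd (?p k) (fst (?p k)))"
      using L_tuples_in[OF x, of "Suc k"] L_tuples_adjacent[OF x, of k] Suc.prems a by auto
    have "snd (tuple_snoc (?p k) (x (Suc k))) (fst (tuple_snoc (?p k) (x (Suc k)))) = x (Suc k)"
      by (simp add: tuple_snoc_def)
    then show ?case
      unfolding eq using tuple_snoc_valid[OF a(1) b] csnoc_cls[OF a(1) b] a(3) by simp
  qed
  from this[of n] show "valid (concat_tuple (n, x) q)"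
    "cls (concat_tuple (n, x) q) = fold_steps (\<lambda>y _ c. csnoc c y) x (cls q) n" by auto
qed

text \<open>The union in \<open>concat_class\<close> runs over equal classes: a change of
  representative on the left is absorbed by \<open>csnoc_fold_step\<close>, and on the right only
  the class enters the fold.\<close>

lemma concat_class_cls:
  assumes x: "x \<in> L_tuples C n" and c: "c \<in> topspace L" "class_end c = x 0"
  shows "concat_class C (cls (n, x)) c = fold_steps (\<lambda>y _ c. csnoc c y) x c n"
proof -
  have "cls (concat_tuple p q) = fold_steps (\<lambda>y _ c. csnoc c y) x c n" 
    if p: "p \<in> cls (n, x)" and q: "q \<in> c" for p q
  proof -
    obtain m y where y: "y \<in> L_tuples C m" "c = cls (m, y)" using L_cases[OF c(1)] .
    have cq: "c = cls q" "valid q" using q y valid_cls_eq[of q "(m, y)"] by (auto simp: mem_cls)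
    have pc: "cls (n, x) = cls p" using p by (simp add: mem_cls)
    have vp: "valid p" using valid_cls_eq[OF pc] x by simp
    have p0: "snd p 0 = x 0" using class_start_cls[of n x] class_start_cls[of "fst p" "snd p"] pc by simp
    have "fold_steps (\<lambda>y _ c. csnoc c y) x c n = fold_steps (\<lambda>y _ c. csnoc c y) (snd p) c (fst p)"
    proof -
      let ?f = "\<lambda>p. (snd p 0, if class_end c = snd p 0 then fold_steps (\<lambda>y _ c. csnoc c y) (snd p) c (fst p) else {})"
      have "?f (n, x) = ?f p"
        by (rule cls_invariant[OF pc]) (use csnoc_fold_step[OF _ c(1)] tuple_step_valid(4) in auto)
      then show ?thesis using c p0 by simp
    qed
    moreover have "cls (concat_tuple p q) = fold_steps (\<lambda>y _ c. csnoc c y) (snd p) (cls q) (fst p)"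
      using concat_tuple_cls(2)[of "snd p" "fst p" q] vp cq p0 c class_end_cls[of "fst q" "snd q"] by simp
    ultimately show ?thesis using cq by simp
  qed
  moreover have "cls p \<noteq> {}" for p
    using mem_cls[of p p] by auto
  then have "cls (n, x) \<noteq> {}" "c \<noteq> {}"
    using L_cases[OF c(1)] by metis+
  ultimately show ?thesis unfolding concat_class_def by auto
qed

lemma concat_class:
  assumes "c \<in> topspace L" "g \<in> topspace L" "class_end g = class_start c"
  shows "concat_class C c g \<in> topspace L" "class_end (concat_class C c g) = class_end c"
    "class_start (concat_class C c g) = class_start g"
proof -
  obtain n x where x: "x \<in> L_tuples C n" "c = cls (n, x)" using L_cases[OF assms(1)] .
  show "concat_class C c g \<in> topspace L" "class_end (concat_class C c g) = class_end c"
    "class_start (concat_class C c g) = class_start g"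
    using csnoc_fold_in[OF x(1) assms(2), of n] concat_class_cls[OF x(1) assms(2)] assms x by auto
qed

text \<open>Loops act at the start of a path, while points are appended at its end. The equivariance
  of transports and of the twisted fold comes from this.\<close>

lemma concat_csnoc:
  assumes c: "c \<in> topspace L" and z: "z \<in> topspace X" "common_simplex C z (class_end c)"
    and g: "g \<in> topspace L" "class_end g = class_start c"
  shows "concat_class C (csnoc c z) g = csnoc (concat_class C c g) z"
proof -
  obtain n x where x: "x \<in> L_tuples C n" "c = cls (n, x)" using L_cases[OF c] .
  let ?x = "x(Suc n := z)"
  have v: "?x \<in> L_tuples C (Suc n)" and eq: "csnoc c z = cls (Suc n, ?x)"
    using tuple_snoc_valid[of "(n, x)" z] csnoc_cls[of "(n, x)" z] x z by (auto simp: tuple_snoc_def)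
  have "fold_steps (\<lambda>y _ c. csnoc c y) ?x g n = fold_steps (\<lambda>y _ c. csnoc c y) x g n"
    by (rule fold_steps_cong) simp
  then show ?thesis
    using concat_class_cls[OF v g(1)] concat_class_cls[OF x(1) g(1)] g x unfolding eq by simp
qed

lemma concat_unit:
  assumes "g \<in> topspace L"
  shows "concat_class C (unit_class C (class_end g)) g = g"
proof -
  have "(\<lambda>j\<in>{..0}. class_end g) \<in> L_tuples C 0"
    using class_end_in[OF assms] by (auto simp: L_tuples_def)
  from concat_class_cls[OF this assms] show ?thesis by (simp add: unit_class_def)
qed

lemma cls_fold: "x \<in> L_tuples C n \<Longrightarrow> cls (n, x) = fold_steps (\<lambda>y _ c. csnoc c y) x (unit_class C (x 0)) n"
proof (induction n arbitrary: x)
  case 0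
  then have "(\<lambda>j\<in>{..0}. x 0) = x"
    by (auto simp: L_tuples_def fun_eq_iff PiE_def extensional_def)
  then show ?case by (simp add: unit_class_def)
next
  case (Suc n)
  define y where "y = restrict x {..n}"
  have x: "y \<in> L_tuples C n"
    using Suc.prems by (auto simp: L_tuples_def y_def)
  have "tuple_snoc (n, y) (x (Suc n)) = (Suc n, x)"
    using Suc.prems by (auto simp: L_tuples_def fun_eq_iff tuple_snoc_def PiE_def extensional_def y_def)
  then have "cls (Suc n, x) = csnoc (cls (n, y)) (x (Suc n))"
    using csnoc_cls[of "(n, y)" "x (Suc n)"] x y_def L_tuples_in[OF Suc.prems, of "Suc n"] L_tuples_adjacent[OF Suc.prems, of n]
    by simp
  moreover have "fold_steps (\<lambda>y _ c. csnoc c y) y (unit_class C (x 0)) n = fold_steps (\<lambda>y _ c. csnoc c y) x (unit_class C (x 0)) n"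
    by (rule fold_steps_cong) (simp add: y_def)
  moreover have "y 0 = x 0" by (simp add: y_def)
  ultimately show ?case using Suc.IH[OF x] by simp
qed

end

section \<open>Homotopies from twisted cocycles\<close>

text \<open>The entry \<open>x 0\<close> stands at index \<open>m + 1\<close>, so a joining step
  from \<open>y m\<close> to \<open>x 0\<close> comes between the two folds.\<close>

lemma fold_steps_concat:
  assumes y: "\<And>j. j \<le> m \<Longrightarrow> z j = y j" and x: "\<And>j. j \<le> n \<Longrightarrow> z (j + m + 1) = x j"
  shows "k \<le> n \<Longrightarrow> fold_steps F z s (k + m + 1) = fold_steps F x (F (x 0) (y m) (fold_steps F y s m)) k"
proof (induction k)
  case 0
  then show ?case using x[of 0] y[of m] fold_steps_cong[of m z y F s] y by simp
next
  case (Suc k)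
  then show ?case using x[of "Suc k"] x[of k] by simp
qed

context lf_complex
begin

section \<open>The topology on classes of paths and loops\<close>

lemma continuous_end: "continuous_map L X class_end"
proof (rule continuous_compose_quotient_map[OF quotient_map_cls])
  show "continuous_map (sum_topology tuples UNIV) X (class_end \<circ> cls)"
    by (rule continuous_map_from_sum_topology)
      (auto simp: tuples_def intro!: continuous_map_from_subtopology continuous_map_product_projection)
qed

lemma continuous_start: "continuous_map L X class_start"
proof (rule continuous_compose_quotient_map[OF quotient_map_cls])
  show "continuous_map (sum_topology tuples UNIV) X (class_start \<circ> cls)"
    by (rule continuous_map_from_sum_topology)
      (auto simp: tuples_def intro!: continuous_map_from_subtopology continuous_map_product_projection)
qed

definition paths :: "'a \<Rightarrow> 'a tuple set set" where
  "paths b = {c \<in> topspace L. class_start c = b}"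

lemma closedin_paths: "b \<in> topspace X \<Longrightarrow> closedin L (paths b)"
  using closedin_continuous_map_preimage[OF continuous_start closedin_singleton[of b]] by (simp add: paths_def)

lemma closedin_loops: "b \<in> topspace X \<Longrightarrow> closedin L (loop_classes C b)"
proof -
  assume b: "b \<in> topspace X"
  have "loop_classes C b = paths b \<inter> {c \<in> topspace L. class_end c \<in> {b}}"
    by (auto simp: loop_classes_def paths_def)
  moreover have "closedin L (paths b \<inter> {c \<in> topspace L. class_end c \<in> {b}})"
    by (intro closedin_Int closedin_paths[OF b] closedin_continuous_map_preimage[OF continuous_end closedin_singleton[OF b]])
  ultimately show ?thesis by (simp only:)
qed

lemma loops_paths: "g \<in> loop_classes C b \<longleftrightarrow> g \<in> paths b \<and> class_end g = b"
  by (auto simp: loop_classes_def paths_def)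

text \<open>A quotient map restricts to a quotient map over a closed set. Points of the complex are
  closed, hence so are the sets of paths and loops at \<open>b\<close>, and continuity on them can
  be tested on tuples.\<close>

lemma quotient_map_classes:
  assumes A: "closedin L A"
  shows "quotient_map (sum_topology (\<lambda>n. subtopology (tuples n) {x. cls (n, x) \<in> A}) UNIV) (subtopology L A) cls"
proof -
  have "quotient_map (subtopology (sum_topology tuples UNIV) {p \<in> topspace (sum_topology tuples UNIV). cls p \<in> A}) (subtopology L A) cls"
    by (rule quotient_map_restriction[OF quotient_map_cls refl]) (use A in blast)
  moreover have "subtopology (sum_topology tuples UNIV) {p \<in> topspace (sum_topology tuples UNIV). cls p \<in> A} =
      subtopology (sum_topology tuples UNIV) (Sigma UNIV (\<lambda>n. {x. cls (n, x) \<in> A}))"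
  proof -
    have "{p \<in> topspace (sum_topology tuples UNIV). cls p \<in> A} =
        topspace (sum_topology tuples UNIV) \<inter> Sigma UNIV (\<lambda>n. {x. cls (n, x) \<in> A})" by auto
    then show ?thesis by (simp only: subtopology_restrict)
  qed
  ultimately show ?thesis by (simp add: subtopology_sum_topology)
qed

lemma continuous_from_Times_classes:
  assumes A: "closedin L A"
    and "\<And>n. continuous_map (prod_topology (top_of_set {0..1::real}) (subtopology (tuples n) {x. cls (n, x) \<in> A})) Y
           (\<lambda>(s, x). f (s, cls (n, x)))"
  shows "continuous_map (prod_topology (top_of_set {0..1::real}) (subtopology L A)) Y f"
  by (rule continuous_compose_quotient_map[OF quotient_map_Times_unit_interval[OF quotient_map_classes[OF A]]],
      rule continuous_map_from_Times_sum) (use assms in \<open>simp add: case_prod_unfold\<close>)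

text \<open>Concatenation and the quotient topology interact badly in general; families of classes that are
  represented by a continuous family of tuples of a fixed length avoid the problem.\<close>

definition word_family :: "'z topology \<Rightarrow> ('z \<Rightarrow> 'a tuple set) \<Rightarrow> bool" where
  "word_family Z f \<longleftrightarrow> (\<exists>n T. continuous_map Z (tuples n) T \<and> (\<forall>z \<in> topspace Z. f z = cls (n, T z)))"

lemma word_family_continuous: "word_family Z f \<Longrightarrow> continuous_map Z L f"
proof -
  assume "word_family Z f"
  then obtain n T where T: "continuous_map Z (tuples n) T" "\<forall>z \<in> topspace Z. f z = cls (n, T z)"
    by (auto simp: word_family_def)
  have "continuous_map (tuples n) L (cls \<circ> Pair n)"
    by (rule continuous_map_compose[OF continuous_map_component_injection quotient_imp_continuous_map[OF quotient_map_cls]]) simp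
  from continuous_map_compose[OF T(1) this] show ?thesis
    by (rule continuous_map_eq) (use T(2) in auto)
qed

lemma word_family_in: "word_family Z f \<Longrightarrow> z \<in> topspace Z \<Longrightarrow> f z \<in> topspace L"
  using word_family_continuous by (fastforce simp: continuous_map_def)

lemma word_family_cls: "word_family (tuples n) (\<lambda>x. cls (n, x))"
  unfolding word_family_def by (rule exI[of _ n], rule exI[of _ "\<lambda>x. x"]) simp

lemma word_family_unit: "b \<in> topspace X \<Longrightarrow> word_family Z (\<lambda>z. unit_class C b)"
  unfolding word_family_def unit_class_def
  by (rule exI[of _ 0], rule exI[of _ "\<lambda>_ . \<lambda>j\<in>{..0}. b"]) (auto simp: topspace_tuples L_tuples_def)

lemma word_family_csnoc:
  assumes f: "word_family Z f" and g: "continuous_map Z X g"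
    and adj: "\<And>z. z \<in> topspace Z \<Longrightarrow> common_simplex C (g z) (class_end (f z))"
  shows "word_family Z (\<lambda>z. csnoc (f z) (g z))"
proof -
  obtain n T where T: "continuous_map Z (tuples n) T" "\<And>z. z \<in> topspace Z \<Longrightarrow> f z = cls (n, T z)"
    using f by (auto simp: word_family_def)
  have gX: "g z \<in> topspace X" and Tz: "T z \<in> L_tuples C n" if "z \<in> topspace Z" for z
    using g T(1) that by (auto simp: continuous_map_def topspace_tuples)
  let ?T = "\<lambda>z. (T z)(Suc n := g z)"
  have snoc: "?T z \<in> L_tuples C (Suc n)" "csnoc (f z) (g z) = cls (Suc n, ?T z)" if z: "z \<in> topspace Z" for z
    using tuple_snoc_valid[of "(n, T z)" "g z"] csnoc_cls[of "(n, T z)" "g z"] adj[OF z] gX[OF z] Tz[OF z] T(2)[OF z]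
    by (auto simp: tuple_snoc_def)
  have "continuous_map Z X (\<lambda>z. ?T z k)" if k: "k \<le> Suc n" for k
  proof (cases "k = Suc n")
    case True
    then show ?thesis using g by simp
  next
    case False
    with k have "k \<in> {..n}" by simp
    then have "continuous_map (tuples n) X (\<lambda>x. x k)"
      unfolding tuples_def by (intro continuous_map_from_subtopology continuous_map_product_projection)
    from continuous_map_compose[OF T(1) this] show ?thesis using False by (simp add: o_def)
  qed
  then have "continuous_map Z (tuples (Suc n)) ?T"
    unfolding tuples_def continuous_map_in_subtopology continuous_map_componentwise
    using snoc(1) by (auto simp: L_tuples_def PiE_def)
  then show ?thesis
    unfolding word_family_def using snoc(2) by blast
qed

text \<open>The inserted points are \<open>x\<close> and \<open>y\<close> themselves for
  \<open>s = 0\<close> and meet at the midpoint for \<open>s = 1\<close>; hence the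
  \<open>s/2\<close>.\<close>

definition subdivide_step :: "real \<Rightarrow> 'a \<Rightarrow> 'a \<Rightarrow> 'a tuple set \<Rightarrow> 'a tuple set" where
  "subdivide_step s y x c = csnoc (csnoc (csnoc c (segment (s/2) x y)) (segment (s/2) y x)) y"

lemma subdivide_points:
  assumes xy: "common_simplex C y x" and s: "0 \<le> s" "s \<le> 1"
  defines "u \<equiv> segment (s/2) x y" and "v \<equiv> segment (s/2) y x"
  shows "u \<in> topspace X" "v \<in> topspace X"
    "common_simplex C u x" "common_simplex C v u" "common_simplex C y v"
    "common_simplex C v y" "common_simplex C u v" "common_simplex C x u"
proof -
  obtain \<sigma> where \<sigma>: "\<sigma> \<in> S" "cd y \<in> geometric_simplex \<sigma>" "cd x \<in> geometric_simplex \<sigma>"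
    using xy by (auto simp: common_simplex_def)
  have uv: "cd u \<in> geometric_simplex \<sigma>" "cd v \<in> geometric_simplex \<sigma>" "u \<in> topspace X" "v \<in> topspace X"
    using segment_simplex[OF \<sigma>(1,3,2), of "s/2"] segment_simplex[OF \<sigma>, of "s/2"] s by (auto simp: u_def v_def)
  then show "u \<in> topspace X" "v \<in> topspace X" by auto
  show "common_simplex C u x" "common_simplex C v u" "common_simplex C y v"
    "common_simplex C v y" "common_simplex C u v" "common_simplex C x u"
    using uv \<sigma> by (auto intro: common_simplexI)
qed

end

section \<open>The family from a conjugate of \<alpha> to \<beta> after subdivision\<close>

locale twisted_hom = lf_complex C for C :: "'a scomplex" +
  fixes b :: 'a and H :: "'h tgroup" and \<alpha> \<beta> \<delta> :: "'a tuple set \<Rightarrow> 'h"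
  assumes b: "b \<in> topspace (sc_space C)"
    and top_G: "topological_group (milnor_loop_group C b)" and top_H: "topological_group H"
    and \<alpha>: "\<alpha> \<in> hom (milnor_loop_group C b) H"
    and \<beta>: "\<beta> \<in> hom (milnor_loop_group C b) H"
    and cont_\<beta>: "continuous_map (topol (milnor_loop_group C b)) (topol H) \<beta>"
    and cont_\<delta>: "continuous_map (subtopology (milnor_L C) (lf_complex.paths C b)) (topol H) \<delta>"
    and twist: "\<And>c g. c \<in> lf_complex.paths C b \<Longrightarrow> g \<in> loop_classes C b \<Longrightarrow>
        \<delta> (concat_class C c g) = inv\<^bsub>H\<^esub> \<beta> g \<otimes>\<^bsub>H\<^esub> \<delta> c \<otimes>\<^bsub>H\<^esub> \<alpha> g"
begin

abbreviation "G \<equiv> milnor_loop_group C b"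

lemma G_simps: "carrier G = loop_classes C b" "mult G = concat_class C" "topol G = subtopology L (loop_classes C b)"
  by (simp_all add: milnor_loop_group_def)

sublocale H: group H
  using top_H by (simp add: topological_group_def)

lemma topspace_H: "topspace (topol H) = carrier H"
  using top_H by (simp add: topological_group_def)

lemma \<alpha>_in [simp]: "g \<in> loop_classes C b \<Longrightarrow> \<alpha> g \<in> carrier H"
  using \<alpha> by (auto simp: hom_def G_simps)

lemma \<beta>_in [simp]: "g \<in> loop_classes C b \<Longrightarrow> \<beta> g \<in> carrier H"
  using \<beta> by (auto simp: hom_def G_simps)

lemma \<beta>_mult: "g \<in> loop_classes C b \<Longrightarrow> g' \<in> loop_classes C b \<Longrightarrow> \<beta> (concat_class C g g') = \<beta> g \<otimes>\<^bsub>H\<^esub> \<beta> g'"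
  using \<beta> by (auto simp: hom_def G_simps)

lemma \<delta>_in [simp]: "c \<in> paths b \<Longrightarrow> \<delta> c \<in> carrier H"
  using cont_\<delta> topspace_H by (auto simp: continuous_map_def paths_def Pi_iff)

lemma continuous_H_mult:
  "continuous_map Z (topol H) f \<Longrightarrow> continuous_map Z (topol H) g \<Longrightarrow> continuous_map Z (topol H) (\<lambda>z. f z \<otimes>\<^bsub>H\<^esub> g z)"
  using continuous_map_compose[of Z "prod_topology (topol H) (topol H)" "\<lambda>z. (f z, g z)" "topol H" "\<lambda>(x, y). x \<otimes>\<^bsub>H\<^esub> y"] top_H
  by (simp add: topological_group_def continuous_map_pairedI o_def)

lemma continuous_H_inv:
  "continuous_map Z (topol H) f \<Longrightarrow> continuous_map Z (topol H) (\<lambda>z. inv\<^bsub>H\<^esub> f z)"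
  using continuous_map_compose[of Z "topol H" f "topol H" "\<lambda>x. inv\<^bsub>H\<^esub> x"] top_H
  by (simp add: topological_group_def o_def)

text \<open>The element \<open>\<delta> c2 \<otimes> inv \<delta> c1\<close> corrects the step from \<open>c1\<close> to \<open>c2\<close>, which is
  thereby transported along \<open>\<alpha>\<close>, while the two outer steps are transported along \<open>\<beta>\<close>. Keeping the
  correction in the middle makes the reversed step the exact inverse, so that the fold descends to
  classes of tuples.\<close>

definition twist_step :: "real \<Rightarrow> 'a \<Rightarrow> 'a \<Rightarrow> 'a tuple set \<times> 'h \<Rightarrow> 'a tuple set \<times> 'h" where
  "twist_step s y x = (\<lambda>(c, h).
     let c1 = csnoc c (segment (s/2) x y); c2 = csnoc c1 (segment (s/2) y x)
     in (csnoc c2 y, \<delta> c2 \<otimes>\<^bsub>H\<^esub> inv\<^bsub>H\<^esub> \<delta> c1 \<otimes>\<^bsub>H\<^esub> h))"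

lemma twist_step_apply:
  "twist_step s y x (c, h) =
    (csnoc (csnoc (csnoc c (segment (s/2) x y)) (segment (s/2) y x)) y,
     \<delta> (csnoc (csnoc c (segment (s/2) x y)) (segment (s/2) y x)) \<otimes>\<^bsub>H\<^esub> inv\<^bsub>H\<^esub> \<delta> (csnoc c (segment (s/2) x y)) \<otimes>\<^bsub>H\<^esub> h)"
  by (simp add: twist_step_def Let_def)

abbreviation "twist_fold s x \<equiv> fold_steps (twist_step s) x (unit_class C b, \<one>\<^bsub>H\<^esub>)"

definition states :: "'a \<Rightarrow> ('a tuple set \<times> 'h) set" where
  "states x = {c \<in> paths b. class_end c = x} \<times> carrier H"

lemma csnoc_paths:
  "c \<in> paths b \<Longrightarrow> z \<in> topspace X \<Longrightarrow> common_simplex C z (class_end c) \<Longrightarrow> csnoc c z \<in> paths b \<and> class_end (csnoc c z) = z"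
  using csnoc by (auto simp: paths_def)

lemma twist_step_states:
  assumes s: "0 \<le> s" "s \<le> 1" and yx: "common_simplex C y x" and x: "x \<in> topspace X" and y: "y \<in> topspace X"
    and c: "c \<in> paths b" "class_end c = x"
  defines "c1 \<equiv> csnoc c (segment (s/2) x y)"
  defines "c2 \<equiv> csnoc c1 (segment (s/2) y x)"
  shows "c1 \<in> paths b" "c2 \<in> paths b" "csnoc c2 y \<in> paths b" "class_end (csnoc c2 y) = y"
    "class_end c1 = segment (s/2) x y" "class_end c2 = segment (s/2) y x"
proof -
  note p = subdivide_points[OF yx s]
  have 1: "c1 \<in> paths b \<and> class_end c1 = segment (s/2) x y"
    unfolding c1_def by (rule csnoc_paths) (use p c in auto)
  then have 2: "c2 \<in> paths b \<and> class_end c2 = segment (s/2) y x"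
    unfolding c2_def by (intro csnoc_paths) (use p in auto)
  then have "csnoc c2 y \<in> paths b \<and> class_end (csnoc c2 y) = y"
    by (intro csnoc_paths) (use p y in auto)
  with 1 2 show "c1 \<in> paths b" "c2 \<in> paths b" "csnoc c2 y \<in> paths b" "class_end (csnoc c2 y) = y"
    "class_end c1 = segment (s/2) x y" "class_end c2 = segment (s/2) y x" by auto
qed

lemma twist_step_in:
  assumes s: "0 \<le> s" "s \<le> 1" and yx: "common_simplex C y x" "x \<in> topspace X" "y \<in> topspace X"
    and st: "st \<in> states x"
  shows "twist_step s y x st \<in> states y"
proof -
  obtain c h where ch: "st = (c, h)" "c \<in> paths b" "class_end c = x" "h \<in> carrier H"
    using st by (auto simp: states_def)
  show ?thesis
    using twist_step_states[OF s yx ch(2,3)] ch by (auto simp: twist_step_apply states_def)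
qed

lemma twist_step_stay:
  assumes x: "x \<in> topspace X" and st: "st \<in> states x"
  shows "twist_step s x x st = st"
proof -
  obtain c h where ch: "st = (c, h)" "c \<in> paths b" "class_end c = x" "h \<in> carrier H"
    using st by (auto simp: states_def)
  have "csnoc c x = c" using csnoc_stay[of c] ch by (auto simp: paths_def)
  then show ?thesis using ch by (simp add: twist_step_apply segment_same[OF x])
qed

text \<open>Run backwards, the step visits the same two points in the opposite order. After
  cancellation its \<open>c1\<close> is the old \<open>c2\<close> and vice versa, so the two
  corrections are inverse and stand next to each other.\<close>

lemma twist_step_undo:
  assumes s: "0 \<le> s" "s \<le> 1" and yx: "common_simplex C y x" "x \<in> topspace X" "y \<in> topspace X"
    and st: "st \<in> states x"
  shows "twist_step s x y (twist_step s y x st) = st"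
proof -
  obtain c h where ch: "st = (c, h)" "c \<in> paths b" "class_end c = x" "h \<in> carrier H"
    using st by (auto simp: states_def)
  let ?u = "segment (s/2) x y" and ?v = "segment (s/2) y x"
  let ?c1 = "csnoc c ?u"
  let ?c2 = "csnoc ?c1 ?v"
  note p = subdivide_points[OF yx(1) s]
  note q = twist_step_states[OF s yx ch(2,3)]
  have "csnoc (csnoc ?c2 y) ?v = ?c2"
    using csnoc_back[of ?c2 y] q p yx by (simp add: paths_def)
  moreover have "csnoc ?c2 ?u = ?c1"
    using csnoc_back[of ?c1 ?v] q p by (simp add: paths_def)
  moreover have "csnoc ?c1 x = c"
    using csnoc_back[of c ?u] q p ch by (simp add: paths_def)
  moreover have "\<delta> ?c1 \<otimes>\<^bsub>H\<^esub> inv\<^bsub>H\<^esub> \<delta> ?c2 \<otimes>\<^bsub>H\<^esub> (\<delta> ?c2 \<otimes>\<^bsub>H\<^esub> inv\<^bsub>H\<^esub> \<delta> ?c1 \<otimes>\<^bsub>H\<^esub> h) = h"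
    using q ch by (simp add: H.m_assoc[symmetric] H.inv_solve_right'[symmetric]) (simp add: H.m_assoc)
  ultimately show ?thesis
    by (simp add: twist_step_apply ch)
qed

lemma unit_state: "(unit_class C b, \<one>\<^bsub>H\<^esub>) \<in> states b"
  using unit_class[OF b] by (auto simp: states_def paths_def)

lemma twist_fold_in:
  assumes s: "0 \<le> s" "s \<le> 1" and x: "x \<in> L_tuples C n" "x 0 = b" and k: "k \<le> n"
  shows "twist_fold s x k \<in> states (x k)"
  using k
proof (induction k)
  case 0
  then show ?case using unit_state x by simp
next
  case (Suc k)
  then show ?case
    using twist_step_in[OF s L_tuples_adjacent[OF x(1), of k]] L_tuples_in[OF x(1)] by simp
qed

text \<open>In the application a state \<open>(c, h)\<close> stands for the point \<psi>(c) \<cdot>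
  h of the bundle. Transport along \<alpha> takes \<psi>(c1) \<cdot> h, which is \<phi>(c1) times
  the inverse of \<delta>(c1) times h, to the same multiple of \<phi>(c2) = \<psi>(c2) \<cdot>
  \<delta>(c2). At the end \<open>c\<close> is a loop, and \<psi>(c) is \<psi> of the constant path
  times \<beta>(c).\<close>

definition twisted :: "real \<Rightarrow> 'a tuple set \<Rightarrow> 'h" where
  "twisted s g = (let p = SOME p. p \<in> g; st = twist_fold s (snd p) (fst p) in \<beta> (fst st) \<otimes>\<^bsub>H\<^esub> snd st)"

lemma twisted_cls:
  assumes s: "0 \<le> s" "s \<le> 1" and x: "x \<in> L_tuples C n" "x 0 = b"
  shows "twisted s (cls (n, x)) = \<beta> (fst (twist_fold s x n)) \<otimes>\<^bsub>H\<^esub> snd (twist_fold s x n)"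
proof -
  define q where "q = (SOME q. q \<in> cls (n, x))"
  have eq: "cls (n, x) = cls q"
    using someI[of "\<lambda>q. q \<in> cls (n, x)" "(n, x)"] by (simp add: mem_cls q_def)
  have q0: "snd q 0 = b"
    using eq x(2) class_start_cls[of n x] class_start_cls[of "fst q" "snd q"] by simp
  let ?f = "\<lambda>p. if snd p 0 = b then twist_fold s (snd p) (fst p) else (unit_class C b, \<one>\<^bsub>H\<^esub>)"
  have "?f (n, x) = ?f q"
  proof (rule cls_invariant[OF eq])
    fix p q assume step: "tuple_step C p q"
    have "twist_fold s (snd p) (fst p) = twist_fold s (snd q) (fst q)" if "snd p 0 = b"
      by (rule fold_steps_step[OF step, where Ok = states])
        (use that unit_state twist_step_in[OF s] twist_step_stay twist_step_undo[OF s] in auto)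
    then show "?f p = ?f q" using tuple_step_valid(4)[OF step] by auto
  qed
  then show ?thesis using x q0 by (simp add: twisted_def Let_def flip: q_def)
qed

text \<open>Replacing \<open>c1\<close> and \<open>c2\<close> by their translates by
  \<open>g\<close> conjugates the correction by \<beta>(g): the factors \<alpha>(g) from
  \<open>twist\<close> cancel between \<delta>(c2) and the inverse of \<delta>(c1).\<close>

lemma twist_fold_translate:
  assumes s: "0 \<le> s" "s \<le> 1" and x: "x \<in> L_tuples C n" "x 0 = b" and k: "k \<le> n"
    and g: "g \<in> loop_classes C b" and h: "h \<in> carrier H"
  shows "fold_steps (twist_step s) x (g, h) k =
    (concat_class C (fst (twist_fold s x k)) g, inv\<^bsub>H\<^esub> \<beta> g \<otimes>\<^bsub>H\<^esub> snd (twist_fold s x k) \<otimes>\<^bsub>H\<^esub> \<beta> g \<otimes>\<^bsub>H\<^esub> h)"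
  using k
proof (induction k)
  case 0
  have "concat_class C (unit_class C b) g = g"
    using concat_unit[of g] g by (auto simp: loop_classes_def)
  then show ?case using g h by simp
next
  case (Suc k)
  obtain c k' where st: "twist_fold s x k = (c, k')" by force
  with twist_fold_in[OF s x, of k] Suc.prems have c: "c \<in> paths b" "class_end c = x k" "k' \<in> carrier H"
    by (auto simp: states_def)
  let ?u = "segment (s/2) (x k) (x (Suc k))" and ?v = "segment (s/2) (x (Suc k)) (x k)"
  have adj: "common_simplex C (x (Suc k)) (x k)" "x k \<in> topspace X" "x (Suc k) \<in> topspace X"
    using L_tuples_adjacent[OF x(1), of k] L_tuples_in[OF x(1)] Suc.prems by auto
  note p = subdivide_points[OF adj(1) s]
  note q = twist_step_states[OF s adj c(1,2)]
  have cs: "csnoc (concat_class C c g) z = concat_class C (csnoc c z) g"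
    if "c \<in> paths b" "z \<in> topspace X" "common_simplex C z (class_end c)" for c z
    using concat_csnoc[of c z g] that g by (auto simp: paths_def loop_classes_def)
  have "csnoc (concat_class C c g) ?u = concat_class C (csnoc c ?u) g"
    by (rule cs) (use p c in auto)
  moreover have "csnoc (concat_class C (csnoc c ?u) g) ?v = concat_class C (csnoc (csnoc c ?u) ?v) g"
    by (rule cs) (use p q in auto)
  moreover have "csnoc (concat_class C (csnoc (csnoc c ?u) ?v) g) (x (Suc k)) = concat_class C (csnoc (csnoc (csnoc c ?u) ?v) (x (Suc k))) g"
    by (rule cs) (use p q adj in auto)
  moreover have "\<delta> (concat_class C (csnoc (csnoc c ?u) ?v) g) \<otimes>\<^bsub>H\<^esub> inv\<^bsub>H\<^esub> \<delta> (concat_class C (csnoc c ?u) g) \<otimes>\<^bsub>H\<^esub>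
        (inv\<^bsub>H\<^esub> \<beta> g \<otimes>\<^bsub>H\<^esub> k' \<otimes>\<^bsub>H\<^esub> \<beta> g \<otimes>\<^bsub>H\<^esub> h) =
      inv\<^bsub>H\<^esub> \<beta> g \<otimes>\<^bsub>H\<^esub> (\<delta> (csnoc (csnoc c ?u) ?v) \<otimes>\<^bsub>H\<^esub> inv\<^bsub>H\<^esub> \<delta> (csnoc c ?u) \<otimes>\<^bsub>H\<^esub> k') \<otimes>\<^bsub>H\<^esub> \<beta> g \<otimes>\<^bsub>H\<^esub> h"
  proof -
    have cancel: "y \<otimes>\<^bsub>H\<^esub> (inv\<^bsub>H\<^esub> y \<otimes>\<^bsub>H\<^esub> z) = z" if "y \<in> carrier H" "z \<in> carrier H" for y z
      using that by (simp add: H.m_assoc[symmetric])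
    show ?thesis
      using q g c h by (simp add: twist H.inv_mult_group H.m_assoc cancel)
  qed
  ultimately show ?case
    using Suc by (simp add: st twist_step_apply)
qed

lemma loop_tuple:
  assumes "g \<in> loop_classes C b"
  obtains n x where "x \<in> L_tuples C n" "g = cls (n, x)" "x 0 = b" "x n = b"
proof -
  have "g \<in> topspace L" using assms by (simp add: loop_classes_def)
  then obtain n x where "x \<in> L_tuples C n" "g = cls (n, x)" by (rule L_cases)
  with assms show ?thesis by (intro that[of x n]) (auto simp: loop_classes_def)
qed

lemma twist_fold_loop:
  assumes s: "0 \<le> s" "s \<le> 1" and x: "x \<in> L_tuples C n" "x 0 = b" "x n = b"
  shows "fst (twist_fold s x n) \<in> loop_classes C b" "snd (twist_fold s x n) \<in> carrier H"
  using twist_fold_in[OF s x(1,2), of n] x(3) by (auto simp: states_def loops_paths)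

text \<open>For a product the fold first reads \<open>g'\<close>, ending at some
  \<open>(c, h)\<close>, and then reads \<open>g\<close> from there. The conjugation by \<beta>(c)
  in \<open>twist_fold_translate\<close> combines with \<beta> of the concatenated loop to give the
  product of the two values.\<close>

lemma twisted_hom:
  assumes s: "0 \<le> s" "s \<le> 1"
  shows "twisted s \<in> hom G H"
proof (rule homI)
  show "twisted s g \<in> carrier H" if gG: "g \<in> carrier G" for g
  proof -
    obtain n x where x: "x \<in> L_tuples C n" "g = cls (n, x)" "x 0 = b" "x n = b"
      by (rule loop_tuple[of g]) (use gG in \<open>auto simp: G_simps\<close>)
    show ?thesis using twisted_cls[OF s x(1,3)] twist_fold_loop[OF s x(1,3,4)] x(2) by simp
  qed
  show "twisted s (g \<otimes>\<^bsub>G\<^esub> g') = twisted s g \<otimes>\<^bsub>H\<^esub> twisted s g'" if gG: "g \<in> carrier G" "g' \<in> carrier G" for g g'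
  proof -
    obtain n x where x: "x \<in> L_tuples C n" "g = cls (n, x)" "x 0 = b" "x n = b"
      by (rule loop_tuple[of g]) (use gG in \<open>auto simp: G_simps\<close>)
    obtain m y where y: "y \<in> L_tuples C m" "g' = cls (m, y)" "y 0 = b" "y m = b"
      by (rule loop_tuple[of g']) (use gG in \<open>auto simp: G_simps\<close>)
    have g': "g' \<in> topspace L" "class_end g' = x 0"
      using gG y x by (auto simp: G_simps loop_classes_def)
    let ?z = "snd (concat_tuple (n, x) (m, y))"
    have z: "?z \<in> L_tuples C (n + m + 1)" "cls (n + m + 1, ?z) = g \<otimes>\<^bsub>G\<^esub> g'" "?z 0 = b"
      using concat_tuple_cls[of x n "(m, y)"] x y concat_class_cls[OF x(1) g']
      by (auto simp: concat_tuple_def G_simps)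
    have z1: "?z j = y j" if "j \<le> m" for j using that by (simp add: concat_tuple_def)
    have z2: "?z (j + m + 1) = x j" if "j \<le> n" for j using that by (simp add: concat_tuple_def)
    obtain c h where ch: "twist_fold s y m = (c, h)" by force
    have c: "c \<in> loop_classes C b" "h \<in> carrier H"
      using twist_fold_loop[OF s y(1,3,4)] ch by auto
    have "twist_fold s ?z (n + m + 1) = fold_steps (twist_step s) x (twist_step s (x 0) (y m) (twist_fold s y m)) n"
      by (rule fold_steps_concat[where z = "?z" and m = m and n = n and x = x and y = y, OF z1 z2 order_refl])
    \<comment> \<open>Both loops are based at \<open>b\<close>, so the joining step is
      stationary.\<close>
    also have "twist_step s (x 0) (y m) (twist_fold s y m) = (c, h)"
      using twist_step_stay[OF b, of "(c, h)" s] c x y by (simp add: ch states_def loops_paths)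
    finally have "twisted s (g \<otimes>\<^bsub>G\<^esub> g') = \<beta> (concat_class C (fst (twist_fold s x n)) c) \<otimes>\<^bsub>H\<^esub>
        (inv\<^bsub>H\<^esub> \<beta> c \<otimes>\<^bsub>H\<^esub> snd (twist_fold s x n) \<otimes>\<^bsub>H\<^esub> \<beta> c \<otimes>\<^bsub>H\<^esub> h)"
      using twisted_cls[OF s z(1,3)] twist_fold_translate[OF s x(1,3) order_refl c] z(2) by simp
    also have "\<dots> = (\<beta> (fst (twist_fold s x n)) \<otimes>\<^bsub>H\<^esub> snd (twist_fold s x n)) \<otimes>\<^bsub>H\<^esub> (\<beta> c \<otimes>\<^bsub>H\<^esub> h)"
    proof -
      have cancel: "y \<otimes>\<^bsub>H\<^esub> (inv\<^bsub>H\<^esub> y \<otimes>\<^bsub>H\<^esub> z) = z" if "y \<in> carrier H" "z \<in> carrier H" for y z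
        using that by (simp add: H.m_assoc[symmetric])
      show ?thesis
        using twist_fold_loop[OF s x(1,3,4)] c by (simp add: \<beta>_mult H.m_assoc cancel)
    qed
    also have "\<dots> = twisted s g \<otimes>\<^bsub>H\<^esub> twisted s g'"
      using twisted_cls[OF s x(1,3)] twisted_cls[OF s y(1,3)] x(2) y(2) ch by simp
    finally show ?thesis .
  qed
qed

lemma continuous_\<delta>_word:
  assumes "word_family Z f" "\<And>z. z \<in> topspace Z \<Longrightarrow> f z \<in> paths b"
  shows "continuous_map Z (topol H) (\<lambda>z. \<delta> (f z))"
proof -
  have "continuous_map Z (subtopology L (paths b)) f"
    using word_family_continuous[OF assms(1)] assms(2) by (auto simp: continuous_map_in_subtopology)
  from continuous_map_compose[OF this cont_\<delta>] show ?thesis by (simp add: o_def)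
qed

text \<open>On tuples of a fixed length every intermediate path is a word family. The induction
  carries this along with the continuity of the second component, because \<delta> has to be applied
  to the paths at each step.\<close>

lemma continuous_twisted:
  "continuous_map (prod_topology (top_of_set {0..1::real}) (topol G)) (topol H) (\<lambda>(s, g). twisted s g)"
  unfolding G_simps
proof (rule continuous_from_Times_classes[OF closedin_loops[OF b]])
  fix n
  let ?T = "subtopology (tuples n) {x. cls (n, x) \<in> loop_classes C b}"
  let ?Z = "prod_topology (top_of_set {0..1::real}) ?T"
  have Z: "0 \<le> fst z" "fst z \<le> 1" "snd z \<in> L_tuples C n" "snd z 0 = b" "snd z n = b" if "z \<in> topspace ?Z" for z
    using that by (auto simp: topspace_tuples loop_classes_def)
  have s: "continuous_map ?Z euclideanreal (\<lambda>z. fst z / 2)"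
    by (intro continuous_intros continuous_map_into_fulltopology[OF continuous_map_fst]) auto
  have x: "continuous_map ?Z X (\<lambda>z. snd z k)" if "k \<le> n" for k
  proof -
    have "continuous_map ?T X (\<lambda>x. x k)"
      unfolding tuples_def using that by (intro continuous_map_from_subtopology continuous_map_product_projection) simp
    from continuous_map_compose[OF continuous_map_snd this] show ?thesis by (simp add: o_def)
  qed
  have "word_family ?Z (\<lambda>z. fst (twist_fold (fst z) (snd z) k)) \<and>
        continuous_map ?Z (topol H) (\<lambda>z. snd (twist_fold (fst z) (snd z) k))" if "k \<le> n" for k
    using that
  proof (induction k)
    case 0
    then show ?case using word_family_unit[OF b] topspace_H by simp
  next
    case (Suc k)
    let ?c = "\<lambda>z. fst (twist_fold (fst z) (snd z) k)"
    let ?u = "\<lambda>z. segment (fst z / 2) (snd z k) (snd z (Suc k))" and ?v = "\<lambda>z. segment (fst z / 2) (snd z (Suc k)) (snd z k)"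
    let ?c1 = "\<lambda>z. csnoc (?c z) (?u z)"
    let ?c2 = "\<lambda>z. csnoc (?c1 z) (?v z)"
    have adj: "common_simplex C (snd z (Suc k)) (snd z k)" if "z \<in> topspace ?Z" for z
      using L_tuples_adjacent Z(3)[OF that] Suc.prems by auto
    have q: "?c1 z \<in> paths b" "?c2 z \<in> paths b" "class_end (?c z) = snd z k" "class_end (?c1 z) = ?u z" "class_end (?c2 z) = ?v z"
      if z: "z \<in> topspace ?Z" for z
    proof -
      have c: "?c z \<in> paths b" "class_end (?c z) = snd z k"
        using twist_fold_in[OF Z(1-4)[OF z], of k] Suc.prems by (auto simp: states_def)
      note twist_step_states[OF Z(1,2)[OF z] adj[OF z] L_tuples_in[OF Z(3)[OF z]] L_tuples_in[OF Z(3)[OF z]] c]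
      then show "?c1 z \<in> paths b" "?c2 z \<in> paths b" "class_end (?c z) = snd z k" "class_end (?c1 z) = ?u z" "class_end (?c2 z) = ?v z"
        using c Suc.prems by auto
    qed
    have p: "common_simplex C (?u z) (snd z k)" "common_simplex C (?v z) (?u z)" "common_simplex C (snd z (Suc k)) (?v z)"
      if z: "z \<in> topspace ?Z" for z
      using subdivide_points[OF adj[OF z] Z(1,2)[OF z]] by auto
    have u: "continuous_map ?Z X ?u"
      by (rule continuous_segment[OF x x s]) (use adj common_simplex_sym Z Suc.prems in auto)
    have v: "continuous_map ?Z X ?v"
      by (rule continuous_segment[OF x x s]) (use adj Z Suc.prems in auto)
    have w0: "word_family ?Z ?c" using Suc by simp
    have w1: "word_family ?Z ?c1"
      by (rule word_family_csnoc[OF w0 u]) (use p q in auto)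
    have w2: "word_family ?Z ?c2"
      by (rule word_family_csnoc[OF w1 v]) (use p q in auto)
    have w3: "word_family ?Z (\<lambda>z. csnoc (?c2 z) (snd z (Suc k)))"
      by (rule word_family_csnoc[OF w2 x]) (use p q Suc.prems in auto)
    have "continuous_map ?Z (topol H) (\<lambda>z. \<delta> (?c2 z) \<otimes>\<^bsub>H\<^esub> inv\<^bsub>H\<^esub> \<delta> (?c1 z) \<otimes>\<^bsub>H\<^esub> snd (twist_fold (fst z) (snd z) k))"
      by (intro continuous_H_mult continuous_H_inv continuous_\<delta>_word w1 w2) (use q Suc in auto)
    moreover have "twist_fold (fst z) (snd z) (Suc k) = (csnoc (?c2 z) (snd z (Suc k)),
        \<delta> (?c2 z) \<otimes>\<^bsub>H\<^esub> inv\<^bsub>H\<^esub> \<delta> (?c1 z) \<otimes>\<^bsub>H\<^esub> snd (twist_fold (fst z) (snd z) k))" for z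
      using twist_step_apply[of "fst z" "snd z (Suc k)" "snd z k" "?c z" "snd (twist_fold (fst z) (snd z) k)"] by simp
    ultimately show ?case using w3 by (simp only: fst_conv snd_conv)
  qed
  from this[of n] have w: "word_family ?Z (\<lambda>z. fst (twist_fold (fst z) (snd z) n))"
     and h: "continuous_map ?Z (topol H) (\<lambda>z. snd (twist_fold (fst z) (snd z) n))" by auto
  have "continuous_map ?Z (topol G) (\<lambda>z. fst (twist_fold (fst z) (snd z) n))"
    using word_family_continuous[OF w] twist_fold_loop(1)[OF Z]
    by (auto simp: continuous_map_in_subtopology G_simps)
  from continuous_map_compose[OF this cont_\<beta>] h
  have "continuous_map ?Z (topol H) (\<lambda>z. \<beta> (fst (twist_fold (fst z) (snd z) n)) \<otimes>\<^bsub>H\<^esub> snd (twist_fold (fst z) (snd z) n))"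
    by (intro continuous_H_mult) (simp_all add: o_def)
  then show "continuous_map ?Z (topol H) (\<lambda>(s, x). (\<lambda>(s, g). twisted s g) (s, cls (n, x)))"
    by (rule continuous_map_eq) (use twisted_cls[OF Z(1-4)] in \<open>auto simp: case_prod_unfold\<close>)
qed

text \<open>For \<open>s = 0\<close> the outer steps are stationary and the whole step follows
  \<alpha>. The corrections telescope to \<delta>(g) times the inverse of \<delta> at the constant
  path, and \<open>twist\<close> for the constant path evaluates \<delta>(g).\<close>

lemma twisted_0:
  assumes g: "g \<in> loop_classes C b"
  shows "twisted 0 g = \<delta> (unit_class C b) \<otimes>\<^bsub>H\<^esub> \<alpha> g \<otimes>\<^bsub>H\<^esub> inv\<^bsub>H\<^esub> \<delta> (unit_class C b)"
proof -
  obtain n x where x: "x \<in> L_tuples C n" "g = cls (n, x)" "x 0 = b" "x n = b"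
    using g by (rule loop_tuple)
  let ?f = "fold_steps (\<lambda>y _ c. csnoc c y) x (unit_class C b)"
  have u: "unit_class C b \<in> paths b"
    using unit_class[OF b] by (simp add: paths_def)
  have "twist_fold 0 x k = (?f k, \<delta> (?f k) \<otimes>\<^bsub>H\<^esub> inv\<^bsub>H\<^esub> \<delta> (unit_class C b))" if "k \<le> n" for k
    using that
  proof (induction k)
    case 0
    then show ?case using u by simp
  next
    case (Suc k)
    have f: "?f k \<in> topspace L" "class_end (?f k) = x k" "class_start (?f k) = b"
      using csnoc_fold_in[OF x(1), of "unit_class C b" k] unit_class[OF b] Suc.prems x by auto
    have adj: "common_simplex C (x (Suc k)) (x k)" "x k \<in> topspace X" "x (Suc k) \<in> topspace X"
      using L_tuples_adjacent[OF x(1), of k] L_tuples_in[OF x(1)] Suc.prems by auto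
    have 1: "csnoc (?f k) (x k) = ?f k" using csnoc_stay[OF f(1)] f(2) by simp
    have f': "csnoc (?f k) (x (Suc k)) \<in> topspace L" "class_end (csnoc (?f k) (x (Suc k))) = x (Suc k)"
       "class_start (csnoc (?f k) (x (Suc k))) = b"
      using csnoc[OF f(1) adj(3)] adj(1) f by auto
    have 2: "csnoc (csnoc (?f k) (x (Suc k))) (x (Suc k)) = csnoc (?f k) (x (Suc k))"
      using csnoc_stay[OF f'(1)] f'(2) by simp
    have "\<delta> (csnoc (?f k) (x (Suc k))) \<otimes>\<^bsub>H\<^esub> inv\<^bsub>H\<^esub> \<delta> (?f k) \<otimes>\<^bsub>H\<^esub> (\<delta> (?f k) \<otimes>\<^bsub>H\<^esub> inv\<^bsub>H\<^esub> \<delta> (unit_class C b)) =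
        \<delta> (csnoc (?f k) (x (Suc k))) \<otimes>\<^bsub>H\<^esub> inv\<^bsub>H\<^esub> \<delta> (unit_class C b)"
      using f f' u by (simp add: paths_def H.m_assoc) (simp add: paths_def H.m_assoc[symmetric])
    then show ?case
      using Suc 1 2 by (simp add: twist_step_apply segment_0 adj)
  qed
  from this[of n] have "twist_fold 0 x n = (g, \<delta> g \<otimes>\<^bsub>H\<^esub> inv\<^bsub>H\<^esub> \<delta> (unit_class C b))"
    using cls_fold[OF x(1)] x by simp
  then have "twisted 0 g = \<beta> g \<otimes>\<^bsub>H\<^esub> (\<delta> g \<otimes>\<^bsub>H\<^esub> inv\<^bsub>H\<^esub> \<delta> (unit_class C b))"
    using twisted_cls[OF _ _ x(1,3), of 0] x(2) by simp
  also have "\<delta> g = inv\<^bsub>H\<^esub> \<beta> g \<otimes>\<^bsub>H\<^esub> \<delta> (unit_class C b) \<otimes>\<^bsub>H\<^esub> \<alpha> g"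
    using twist[OF u g] concat_unit[of g] g by (auto simp: loop_classes_def)
  finally show ?thesis
    using g u by (simp add: H.m_assoc[symmetric])
qed

text \<open>For \<open>s = 1\<close> the inserted points coincide, so \<open>c1 = c2\<close> and all
  corrections are trivial. What remains depends on \<beta> alone.\<close>

lemma twisted_1:
  assumes x: "x \<in> L_tuples C n" "x 0 = b" "x n = b"
  shows "twisted 1 (cls (n, x)) = \<beta> (fold_steps (subdivide_step 1) x (unit_class C b) n)"
proof -
  have "twist_fold 1 x k = (fold_steps (subdivide_step 1) x (unit_class C b) k, \<one>\<^bsub>H\<^esub>)" if "k \<le> n" for k
    using that
  proof (induction k)
    case (Suc k)
    let ?c = "fold_steps (subdivide_step 1) x (unit_class C b) k"
    have c: "?c \<in> paths b" "class_end ?c = x k"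
      using twist_fold_in[OF _ _ x(1,2), of 1 k] Suc by (auto simp: states_def)
    have adj: "common_simplex C (x (Suc k)) (x k)" "x k \<in> topspace X" "x (Suc k) \<in> topspace X"
      using L_tuples_adjacent[OF x(1), of k] L_tuples_in[OF x(1)] Suc.prems by auto
    note q = twist_step_states[OF _ _ adj c, of 1]
    have "csnoc (csnoc ?c (segment (1/2) (x k) (x (Suc k)))) (segment (1/2) (x (Suc k)) (x k)) = csnoc ?c (segment (1/2) (x k) (x (Suc k)))"
      using csnoc_stay[of "csnoc ?c (segment (1/2) (x k) (x (Suc k)))"] q segment_half[of "x k" "x (Suc k)"] by (simp add: paths_def)
    moreover have "fold_steps (subdivide_step 1) x (unit_class C b) (Suc k) =
        csnoc (csnoc (csnoc ?c (segment (1/2) (x k) (x (Suc k)))) (segment (1/2) (x (Suc k)) (x k))) (x (Suc k))"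
      by (simp add: subdivide_step_def)
    moreover have "twist_fold 1 x (Suc k) = twist_step 1 (x (Suc k)) (x k) (?c, \<one>\<^bsub>H\<^esub>)"
      using Suc by simp
    ultimately show ?case
      using q by (simp add: twist_step_apply del: fold_steps.simps)
  qed simp
  from this[of n] show ?thesis
    using twisted_cls[OF _ _ x(1,2), of 1] twist_fold_loop(1)[OF _ _ x, of 1] by simp
qed

lemma homotopic_twisted:
  "homotopic_with (\<lambda>_. True) (milnor_B G) (milnor_B H) (milnor_B_map H (twisted 0)) (milnor_B_map H (twisted 1))"
  by (rule homotopic_milnor_B_map_family[OF top_G top_H continuous_twisted twisted_hom])

lemma continuous_twisted_at:
  assumes "0 \<le> s" "s \<le> 1"
  shows "continuous_map (topol G) (topol H) (twisted s)"
proof -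
  have "continuous_map (topol G) (prod_topology (top_of_set {0..1::real}) (topol G)) (\<lambda>g. (s, g))"
    using assms by (intro continuous_map_pairedI) auto
  from continuous_map_compose[OF this continuous_twisted] show ?thesis by (simp add: o_def)
qed

end

theorem twisted_homotopic:
  assumes tw: "twisted_hom C b H \<alpha> \<beta> \<delta>"
    and cont_\<alpha>: "continuous_map (topol (milnor_loop_group C b)) (topol H) \<alpha>"
  shows "homotopic_with (\<lambda>_. True) (milnor_B (milnor_loop_group C b)) (milnor_B H) (milnor_B_map H \<alpha>) (milnor_B_map H \<beta>)"
proof -
  interpret twisted_hom C b H \<alpha> \<beta> \<delta> by fact
  \<comment> \<open>With trivial \<delta> the second family starts at \<beta> and reaches the same
    subdivided \<beta> as the first.\<close>
  interpret U: twisted_hom C b H \<beta> \<beta> "\<lambda>_. \<one>\<^bsub>H\<^esub>"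
  proof
    show "\<one>\<^bsub>H\<^esub> = inv\<^bsub>H\<^esub> \<beta> g \<otimes>\<^bsub>H\<^esub> \<one>\<^bsub>H\<^esub> \<otimes>\<^bsub>H\<^esub> \<beta> g" if "c \<in> paths b" "g \<in> loop_classes C b" for c g
      using that by simp
  qed (use b top_G top_H \<beta> cont_\<beta> topspace_H in auto)
  have u: "unit_class C b \<in> paths b"
    using unit_class[OF b] by (simp add: paths_def)
  have "homotopic_with (\<lambda>_. True) (milnor_B G) (milnor_B H) (milnor_B_map H (twisted 0)) (milnor_B_map H \<alpha>)"
    by (rule homotopic_milnor_B_map_conjugate[OF top_G top_H \<delta>_in[OF u] cont_\<alpha> \<alpha> continuous_twisted_at twisted_hom])
      (use twisted_0 in \<open>auto simp: G_simps\<close>)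
  \<comment> \<open>The two ends agree on the carrier only; conjugation by the unit turns this into
    a homotopy of the induced maps.\<close>
  moreover have "homotopic_with (\<lambda>_. True) (milnor_B G) (milnor_B H) (milnor_B_map H (twisted 1)) (milnor_B_map H (U.twisted 1))"
  proof (rule homotopic_milnor_B_map_conjugate[OF top_G top_H H.one_closed U.continuous_twisted_at U.twisted_hom continuous_twisted_at twisted_hom])
    fix g assume gG: "g \<in> carrier G"
    obtain n x where x: "x \<in> L_tuples C n" "g = cls (n, x)" "x 0 = b" "x n = b"
      by (rule loop_tuple[of g]) (use gG in \<open>auto simp: G_simps\<close>)
    have "twisted 1 g = U.twisted 1 g"
      using twisted_1[OF x(1,3,4)] U.twisted_1[OF x(1,3,4)] x(2) by simp
    moreover have "U.twisted 1 g \<in> carrier H"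
      using U.twisted_hom[of 1] gG by (auto simp: hom_def)
    ultimately show "twisted 1 g = \<one>\<^bsub>H\<^esub> \<otimes>\<^bsub>H\<^esub> U.twisted 1 g \<otimes>\<^bsub>H\<^esub> inv\<^bsub>H\<^esub> \<one>\<^bsub>H\<^esub>" by simp
  qed auto
  moreover have "homotopic_with (\<lambda>_. True) (milnor_B G) (milnor_B H) (milnor_B_map H (U.twisted 0)) (milnor_B_map H \<beta>)"
    by (rule homotopic_milnor_B_map_conjugate[OF top_G top_H H.one_closed cont_\<beta> \<beta> U.continuous_twisted_at U.twisted_hom])
      (use U.twisted_0 in \<open>auto simp: G_simps\<close>)
  ultimately show ?thesis
    using homotopic_twisted U.homotopic_twisted
    by (meson homotopic_with_trans homotopic_with_symD)
qed

section \<open>Transport along a deformation\<close>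

text \<open>Sublevel sets of \<open>m\<close> are projections along \<open>K\<close>: of closed sets
  for a weak inequality, where compactness makes the projection closed, and of open sets for a
  strict one.\<close>

lemma
  fixes f :: "'k \<times> 'y \<Rightarrow> real"
  assumes K: "compact_space K" "topspace K \<noteq> {}"
    and f: "continuous_map (prod_topology K Y) euclideanreal f"
  defines "m \<equiv> \<lambda>y. Inf ((\<lambda>k. f (k, y)) ` topspace K)"
  shows compact_parametric_Inf_attained: "\<And>y. y \<in> topspace Y \<Longrightarrow> \<exists>k\<in>topspace K. m y = f (k, y)"
    and compact_parametric_Inf_lower: "\<And>y k. y \<in> topspace Y \<Longrightarrow> k \<in> topspace K \<Longrightarrow> m y \<le> f (k, y)"
    and continuous_compact_parametric_Inf: "continuous_map Y euclideanreal m"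
proof -
  have *: "\<exists>k0\<in>topspace K. m y = f (k0, y) \<and> (\<forall>k\<in>topspace K. m y \<le> f (k, y))" if y: "y \<in> topspace Y" for y
  proof -
    have "continuous_map K (prod_topology K Y) (\<lambda>k. (k, y))"
      using y by (intro continuous_map_pairedI) auto
    from continuous_map_compose[OF this f] have cont: "continuous_map K euclideanreal (\<lambda>k. f (k, y))"
      by (simp add: o_def)
    have "compact ((\<lambda>k. f (k, y)) ` topspace K)"
      using image_compactin[OF _ cont] K(1) by (simp add: compact_space_def)
    then obtain k0 where k0: "k0 \<in> topspace K" "\<forall>k\<in>topspace K. f (k0, y) \<le> f (k, y)"
      using compact_attains_inf[of "(\<lambda>k. f (k, y)) ` topspace K"] K(2) by auto
    then have "m y = f (k0, y)"
      unfolding m_def by (intro cInf_eq_minimum) auto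
    with k0 show ?thesis by auto
  qed
  show "\<exists>k\<in>topspace K. m y = f (k, y)" if "y \<in> topspace Y" for y using *[OF that] by blast
  show "m y \<le> f (k, y)" if "y \<in> topspace Y" "k \<in> topspace K" for y k using *[OF that(1)] that(2) by blast
  have "closedin Y {y \<in> topspace Y. m y \<le> a}" for a
  proof -
    have "closedin (prod_topology K Y) {p \<in> topspace (prod_topology K Y). f p \<in> {..a}}"
      by (rule closedin_continuous_map_preimage[OF f]) simp
    then have "closedin Y (snd ` {p \<in> topspace (prod_topology K Y). f p \<in> {..a}})"
      using closed_map_snd[OF K(1)] by (auto simp: closed_map_def)
    moreover have "snd ` {p \<in> topspace (prod_topology K Y). f p \<in> {..a}} = {y \<in> topspace Y. m y \<le> a}"
    proof (intro equalityI subsetI)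
      fix y assume "y \<in> snd ` {p \<in> topspace (prod_topology K Y). f p \<in> {..a}}"
      then obtain k where "k \<in> topspace K" "y \<in> topspace Y" "f (k, y) \<le> a" by auto
      then show "y \<in> {y \<in> topspace Y. m y \<le> a}" using *[of y] by force
    next
      fix y assume "y \<in> {y \<in> topspace Y. m y \<le> a}"
      then obtain k where "k \<in> topspace K" "y \<in> topspace Y" "f (k, y) \<le> a" using *[of y] by auto
      then show "y \<in> snd ` {p \<in> topspace (prod_topology K Y). f p \<in> {..a}}"
        by (intro image_eqI[of _ _ "(k, y)"]) auto
    qed
    ultimately show ?thesis by simp
  qed
  moreover have "closedin Y {y \<in> topspace Y. m y \<ge> a}" for a
  proof -
    have "openin (prod_topology K Y) {p \<in> topspace (prod_topology K Y). f p \<in> {..<a}}"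
      by (rule openin_continuous_map_preimage[OF f]) simp
    then have "openin Y (snd ` {p \<in> topspace (prod_topology K Y). f p \<in> {..<a}})"
      using open_map_snd by (auto simp: open_map_def)
    moreover have "snd ` {p \<in> topspace (prod_topology K Y). f p \<in> {..<a}} = topspace Y - {y \<in> topspace Y. m y \<ge> a}"
    proof (intro equalityI subsetI)
      fix y assume "y \<in> snd ` {p \<in> topspace (prod_topology K Y). f p \<in> {..<a}}"
      then obtain k where "k \<in> topspace K" "y \<in> topspace Y" "f (k, y) < a" by auto
      then show "y \<in> topspace Y - {y \<in> topspace Y. m y \<ge> a}" using *[of y] by force
    next
      fix y assume "y \<in> topspace Y - {y \<in> topspace Y. m y \<ge> a}"
      then obtain k where "k \<in> topspace K" "y \<in> topspace Y" "f (k, y) < a" using *[of y] by auto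
      then show "y \<in> snd ` {p \<in> topspace (prod_topology K Y). f p \<in> {..<a}}"
        by (intro image_eqI[of _ _ "(k, y)"]) auto
    qed
    ultimately show ?thesis by (auto simp: closedin_def)
  qed
  ultimately show "continuous_map Y euclideanreal m"
    by (simp add: continuous_map_upper_lower_semicontinuous_le)
qed

section \<open>Moving ends of paths along a homotopy\<close>

locale complex_deformation = lf_complex C for C :: "'a scomplex" +
  fixes h :: "real \<times> 'a \<Rightarrow> 'a"
  assumes h: "continuous_map (prod_topology (top_of_set {0..1}) (sc_space C)) (sc_space C) h"
    and h0: "\<And>y. y \<in> topspace (sc_space C) \<Longrightarrow> h (0, y) = y"
begin

lemma h_in: "0 \<le> t \<Longrightarrow> t \<le> 1 \<Longrightarrow> y \<in> topspace X \<Longrightarrow> h (t, y) \<in> topspace X"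
  using h by (auto simp: continuous_map_def Pi_iff)

lemma continuous_h:
  assumes "continuous_map Z euclideanreal t" "\<And>z. z \<in> topspace Z \<Longrightarrow> 0 \<le> t z \<and> t z \<le> 1" "continuous_map Z X y"
  shows "continuous_map Z X (\<lambda>z. h (t z, y z))"
proof -
  have "continuous_map Z (prod_topology (top_of_set {0..1}) X) (\<lambda>z. (t z, y z))"
    using assms by (intro continuous_map_pairedI) (auto simp: continuous_map_in_subtopology)
  from continuous_map_compose[OF this h] show ?thesis by (simp add: o_def)
qed

text \<open>This is positive on the whole square: off the diagonal by the first summand, on the
  diagonal because \<open>overlap\<close> is 1 there. Compactness then gives a positive infimum for
  each \<open>y\<close>.\<close>

definition separation :: "(real \<times> real) \<times> 'a \<Rightarrow> real" where
  "separation = (\<lambda>((t, t'), y). \<bar>t - t'\<bar> + overlap (h (t, y)) (h (t', y)))"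

definition square :: "(real \<times> real) topology" where
  "square = prod_topology (top_of_set {0..1}) (top_of_set {0..1})"

text \<open>The half leaves room in \<open>overlap_pos\<close>: times at distance at most
  \<open>mesh y\<close> use up only half of the infimum, and the overlap supplies the rest.\<close>

definition mesh :: "'a \<Rightarrow> real" where
  "mesh y = Inf ((\<lambda>k. separation (k, y)) ` topspace square) / 2"

lemma square: "compact_space square" "topspace square = {0..1} \<times> {0..1}"
  unfolding square_def
  by (intro iffD2[OF compact_space_prod_topology] disjI2 conjI compact_space_subtopology) auto

lemma continuous_separation: "continuous_map (prod_topology square X) euclideanreal separation"
proof -
  let ?Z = "prod_topology square X"
  have t: "continuous_map ?Z euclideanreal (\<lambda>z. fst (fst z))"
    using continuous_map_compose[OF continuous_map_fst[of square X] continuous_map_into_fulltopology[OF continuous_map_fst[of "top_of_set {0..1::real}" "top_of_set {0..1::real}", folded square_def]]]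
    by (simp add: o_def)
  have t': "continuous_map ?Z euclideanreal (\<lambda>z. snd (fst z))"
    using continuous_map_compose[OF continuous_map_fst[of square X] continuous_map_into_fulltopology[OF continuous_map_snd[of "top_of_set {0..1::real}" "top_of_set {0..1::real}", folded square_def]]]
    by (simp add: o_def)
  have "continuous_map ?Z euclideanreal (\<lambda>z. \<bar>fst (fst z) - snd (fst z)\<bar> + overlap (h (fst (fst z), snd z)) (h (snd (fst z), snd z)))"
    by (intro continuous_intros continuous_overlap continuous_h t t' continuous_map_snd) (auto simp: square)
  then show ?thesis by (simp add: separation_def case_prod_unfold)
qed

lemma continuous_mesh: "continuous_map X euclideanreal mesh"
  unfolding mesh_def
  by (intro continuous_intros continuous_compact_parametric_Inf square continuous_separation) (auto simp: square)

lemma mesh_pos: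
  assumes y: "y \<in> topspace X"
  shows "0 < mesh y"
proof -
  obtain k where k: "k \<in> topspace square" "Inf ((\<lambda>k. separation (k, y)) ` topspace square) = separation (k, y)"
    using compact_parametric_Inf_attained[OF square(1) _ continuous_separation y] by (auto simp: square)
  obtain t t' where tt: "k = (t, t')" by force
  have "0 < separation (k, y)"
  proof (cases "t = t'")
    case True
    then show ?thesis using k(1) y overlap_same[OF h_in] by (auto simp: separation_def tt square)
  next
    case False
    then show ?thesis using k(1) y overlap_nonneg[OF h_in h_in, of t y t' y] by (auto simp: separation_def tt square)
  qed
  then show ?thesis using k(2) by (simp add: mesh_def)
qed

lemma overlap_pos:
  assumes y: "y \<in> topspace X" and t: "0 \<le> t" "t \<le> 1" "0 \<le> t'" "t' \<le> 1" and close: "\<bar>t - t'\<bar> \<le> mesh y"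
  shows "0 < overlap (h (t, y)) (h (t', y))"
proof -
  have "Inf ((\<lambda>k. separation (k, y)) ` topspace square) \<le> separation ((t, t'), y)"
    by (rule compact_parametric_Inf_lower[OF square(1) _ continuous_separation y]) (use t in \<open>auto simp: square\<close>)
  then have "2 * mesh y \<le> \<bar>t - t'\<bar> + overlap (h (t, y)) (h (t', y))"
    by (simp add: mesh_def separation_def)
  with close mesh_pos[OF y] show ?thesis by linarith
qed

text \<open>The times advance by \<open>mesh y\<close> and are cut off at 1. The step depends on
  \<open>y\<close>, but each single stop is continuous in \<open>y\<close>.\<close>

definition stop :: "nat \<Rightarrow> 'a \<Rightarrow> 'a" where
  "stop i y = h (min 1 (real i * mesh y), y)"

lemma stop:
  assumes y: "y \<in> topspace X"
  shows "stop i y \<in> topspace X" "0 < overlap (stop i y) (stop (Suc i) y)" "stop 0 y = y"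
    "1 \<le> real i * mesh y \<Longrightarrow> stop i y = h (1, y)"
proof -
  have m: "0 < mesh y" by (rule mesh_pos[OF y])
  then have t: "0 \<le> min 1 (real i * mesh y)" "min 1 (real i * mesh y) \<le> 1" for i by auto
  show "stop i y \<in> topspace X" unfolding stop_def by (rule h_in[OF t y])
  have "\<bar>min 1 (real i * mesh y) - min 1 (real (Suc i) * mesh y)\<bar> \<le> mesh y"
    using m by (auto simp: min_def algebra_simps)
  then show "0 < overlap (stop i y) (stop (Suc i) y)"
    unfolding stop_def by (rule overlap_pos[OF y t t])
  show "stop 0 y = y" by (simp add: stop_def h0[OF y])
  show "1 \<le> real i * mesh y \<Longrightarrow> stop i y = h (1, y)" by (simp add: stop_def)
qed

lemma continuous_stop:
  assumes f: "continuous_map Z X f"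
  shows "continuous_map Z X (\<lambda>z. stop i (f z))"
  unfolding stop_def
proof (rule continuous_h[OF _ _ f])
  show "continuous_map Z euclideanreal (\<lambda>z. min 1 (real i * mesh (f z)))"
    using continuous_map_compose[OF f continuous_mesh] by (intro continuous_intros) (simp add: o_def)
  show "0 \<le> min 1 (real i * mesh (f z)) \<and> min 1 (real i * mesh (f z)) \<le> 1" if "z \<in> topspace Z" for z
  proof -
    have "0 < mesh (f z)"
      using mesh_pos f that by (auto simp: continuous_map_def)
    then show ?thesis by simp
  qed
qed

text \<open>Consecutive stops overlap but may lie in no common simplex; \<open>meet\<close> bridges
  the gap.\<close>

primrec partial_transport :: "nat \<Rightarrow> 'a tuple set \<Rightarrow> 'a tuple set" where
  "partial_transport 0 c = c"
| "partial_transport (Suc i) c =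
    csnoc (csnoc (partial_transport i c) (meet (stop i (class_end c)) (stop (Suc i) (class_end c))))
      (stop (Suc i) (class_end c))"

lemma partial_transport:
  assumes c: "c \<in> topspace L"
  shows "partial_transport i c \<in> topspace L \<and> class_start (partial_transport i c) = class_start c \<and>
     class_end (partial_transport i c) = stop i (class_end c)"
proof (induction i)
  case 0
  then show ?case using c stop(3)[OF class_end_in[OF c]] by simp
next
  case (Suc i)
  note s = stop[OF class_end_in[OF c]]
  note m = meet[OF s(1) s(1) s(2)]
  let ?c1 = "csnoc (partial_transport i c) (meet (stop i (class_end c)) (stop (Suc i) (class_end c)))"
  have 1: "?c1 \<in> topspace L" "class_end ?c1 = meet (stop i (class_end c)) (stop (Suc i) (class_end c))"
    "class_start ?c1 = class_start c"
    using csnoc[of "partial_transport i c"] m Suc by auto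
  then show ?case using csnoc[of ?c1 "stop (Suc i) (class_end c)"] m s by auto
qed

text \<open>Once time 1 is reached, consecutive stops and their \<open>meet\<close> coincide, so
  further points only repeat the end.\<close>

lemma partial_transport_stable:
  assumes c: "c \<in> topspace L" and i: "1 \<le> real i * mesh (class_end c)"
  shows "i \<le> j \<Longrightarrow> partial_transport j c = partial_transport i c"
proof (induction j rule: dec_induct)
  case (step j)
  let ?y = "class_end c"
  note y = class_end_in[OF c]
  have j: "1 \<le> real k * mesh ?y" if "i \<le> k" for k
  proof -
    have "real i * mesh ?y \<le> real k * mesh ?y"
      using that mesh_pos[OF y] by (intro mult_right_mono) auto
    then show ?thesis using i by linarith
  qed
  have "stop (Suc j) ?y = stop j ?y" using stop(4)[OF y] j[of j] j[of "Suc j"] step(1) by simp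
  moreover have "csnoc (partial_transport j c) (stop j ?y) = partial_transport j c"
    using csnoc_stay[of "partial_transport j c"] partial_transport[OF c, of j] by simp
  ultimately show ?case using step meet_same[OF stop(1)[OF y]] by simp
qed simp

text \<open>The appended points depend only on the end of the path, which a loop acting at the start
  leaves unchanged.\<close>

lemma partial_transport_concat:
  assumes c: "c \<in> topspace L" and g: "g \<in> topspace L" "class_end g = class_start c"
  shows "partial_transport i (concat_class C c g) = concat_class C (partial_transport i c) g"
proof (induction i)
  case (Suc i)
  note s = stop[OF class_end_in[OF c]]
  note m = meet[OF s(1) s(1) s(2)]
  note pt = partial_transport[OF c, of i]
  let ?m = "meet (stop i (class_end c)) (stop (Suc i) (class_end c))"
  have 1: "csnoc (concat_class C (partial_transport i c) g) ?m = concat_class C (csnoc (partial_transport i c) ?m) g"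
    by (rule concat_csnoc[symmetric]) (use pt m g in auto)
  have c1: "csnoc (partial_transport i c) ?m \<in> topspace L" "class_end (csnoc (partial_transport i c) ?m) = ?m"
    "class_start (csnoc (partial_transport i c) ?m) = class_start c"
    using csnoc[of "partial_transport i c" ?m] m pt by auto
  have 2: "csnoc (concat_class C (csnoc (partial_transport i c) ?m) g) (stop (Suc i) (class_end c)) =
      concat_class C (csnoc (csnoc (partial_transport i c) ?m) (stop (Suc i) (class_end c))) g"
    by (rule concat_csnoc[symmetric]) (use c1 m s g in auto)
  show ?case using Suc concat_class(2)[OF c g] by (simp add: 1 2)
qed simp

lemma word_family_partial_transport:
  assumes f: "word_family Z f"
  shows "word_family Z (\<lambda>z. partial_transport i (f z))"
proof (induction i)
  case 0
  then show ?case using f by simp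
next
  case (Suc i)
  have fz: "f z \<in> topspace L" "class_end (f z) \<in> topspace X" if "z \<in> topspace Z" for z
    using word_family_in[OF f that] class_end_in by auto
  have e: "continuous_map Z X (\<lambda>z. class_end (f z))"
    using continuous_map_compose[OF word_family_continuous[OF f] continuous_end] by (simp add: o_def)
  have m: "continuous_map Z X (\<lambda>z. meet (stop i (class_end (f z))) (stop (Suc i) (class_end (f z))))"
    by (intro continuous_meet continuous_stop e stop(2) fz)
  have w: "word_family Z (\<lambda>z. csnoc (partial_transport i (f z)) (meet (stop i (class_end (f z))) (stop (Suc i) (class_end (f z)))))"
    by (rule word_family_csnoc[OF Suc m]) (use partial_transport[OF fz(1)] meet[OF stop(1) stop(1) stop(2)] fz in auto)
  have end1: "class_end (csnoc (partial_transport i (f z)) (meet (stop i (class_end (f z))) (stop (Suc i) (class_end (f z))))) =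
      meet (stop i (class_end (f z))) (stop (Suc i) (class_end (f z)))" if "z \<in> topspace Z" for z
    by (rule csnoc) (use partial_transport[OF fz(1)[OF that]] meet[OF stop(1) stop(1) stop(2)] fz[OF that] in auto)
  have "word_family Z (\<lambda>z. csnoc (csnoc (partial_transport i (f z)) (meet (stop i (class_end (f z))) (stop (Suc i) (class_end (f z)))))
     (stop (Suc i) (class_end (f z))))"
    by (rule word_family_csnoc[OF w continuous_stop[OF e]]) (use end1 meet[OF stop(1) stop(1) stop(2)] fz in auto)
  then show ?case by simp
qed

lemma continuous_partial_transport: "continuous_map L L (partial_transport i)"
proof (rule continuous_compose_quotient_map[OF quotient_map_cls], rule continuous_map_from_sum_topology)
  fix n
  show "continuous_map (tuples n) L (\<lambda>x. (partial_transport i \<circ> cls) (n, x))"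
    using word_family_continuous[OF word_family_partial_transport[OF word_family_cls]] by simp
qed

definition transport :: "'a tuple set \<Rightarrow> 'a tuple set" where
  "transport c = partial_transport (nat \<lceil>1 / mesh (class_end c)\<rceil>) c"

lemma transport_eq:
  assumes c: "c \<in> topspace L" and i: "1 \<le> real i * mesh (class_end c)"
  shows "transport c = partial_transport i c"
proof -
  have m: "0 < mesh (class_end c)" by (rule mesh_pos[OF class_end_in[OF c]])
  let ?n = "nat \<lceil>1 / mesh (class_end c)\<rceil>"
  have "1 / mesh (class_end c) \<le> real ?n" by linarith
  then have n: "1 \<le> real ?n * mesh (class_end c)" by (rule iffD1[OF pos_divide_le_eq[OF m]])
  have "1 / mesh (class_end c) \<le> real i" using m i by (simp add: field_simps)
  then have "?n \<le> i" by linarith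
  then show ?thesis unfolding transport_def using partial_transport_stable[OF c n] by simp
qed

lemma large_enough:
  assumes "c \<in> topspace L"
  obtains i where "1 < real i * mesh (class_end c)"
  using reals_Archimedean3[OF mesh_pos[OF class_end_in[OF assms]]] by blast

lemma transport:
  assumes c: "c \<in> topspace L"
  shows "transport c \<in> topspace L" "class_start (transport c) = class_start c"
    "class_end (transport c) = h (1, class_end c)"
proof -
  obtain i where i: "1 < real i * mesh (class_end c)" by (rule large_enough[OF c])
  then show "transport c \<in> topspace L" "class_start (transport c) = class_start c"
    "class_end (transport c) = h (1, class_end c)"
    using transport_eq[OF c, of i] partial_transport[OF c, of i] stop(4)[OF class_end_in[OF c], of i] by auto
qed

lemma transport_concat:
  assumes c: "c \<in> topspace L" and g: "g \<in> topspace L" "class_end g = class_start c"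
  shows "transport (concat_class C c g) = concat_class C (transport c) g"
  using partial_transport_concat[OF assms] concat_class(2)[OF assms] by (simp add: transport_def)

text \<open>The number of steps in \<open>transport\<close> jumps, but by
  \<open>transport_eq\<close> any sufficient number gives the same class. The strict inequality
  makes the sets where \<open>i\<close> steps suffice open, and these sets cover.\<close>

lemma continuous_transport: "continuous_map L L transport"
proof -
  have e: "continuous_map L euclideanreal (\<lambda>c. real i * mesh (class_end c))" for i
    using continuous_map_compose[OF continuous_end continuous_mesh] by (intro continuous_intros) (simp add: o_def)
  let ?T = "\<lambda>i. {c \<in> topspace L. real i * mesh (class_end c) \<in> {1<..}}"
  show ?thesis
  proof (rule pasting_lemma[where I = UNIV and T = ?T and f = "\<lambda>_. transport"])
    show "openin L (?T i)" for i by (rule openin_continuous_map_preimage[OF e]) simp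
    show "continuous_map (subtopology L (?T i)) L transport" for i
      by (rule continuous_map_eq[OF continuous_map_from_subtopology[OF continuous_partial_transport[of i]]])
        (rule transport_eq[symmetric], auto)
    show "\<exists>i. i \<in> UNIV \<and> c \<in> ?T i \<and> transport c = transport c" if "c \<in> topspace L" for c
      using large_enough[OF that] that by force
  qed auto
qed

end

section \<open>Comparing bundle morphisms\<close>

text \<open>The translation function of a principal bundle: the action is free and transitive on
  fibres.\<close>

definition bundle_quotient :: "'h tgroup \<Rightarrow> ('q, 'h, 'x) gbundle \<Rightarrow> 'q \<Rightarrow> 'q \<Rightarrow> 'h" where
  "bundle_quotient H Q q q' = (THE h. h \<in> carrier H \<and> act Q q h = q')"

locale principal_bundle =
  fixes H :: "'h tgroup" and X :: "'x topology" and Q :: "('q, 'h, 'x) gbundle"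
  assumes is_bundle: "G_bundle H X Q"
begin

sublocale H: group H
  using is_bundle by (simp add: G_bundle_def topological_group_def)

lemma topspace_H: "topspace (topol H) = carrier H"
  using is_bundle by (simp add: G_bundle_def topological_group_def)

lemma act_in: "q \<in> topspace (total Q) \<Longrightarrow> h \<in> carrier H \<Longrightarrow> act Q q h \<in> topspace (total Q)"
  using is_bundle topspace_H by (auto simp: G_bundle_def continuous_map_def Pi_iff)

lemma proj_act: "q \<in> topspace (total Q) \<Longrightarrow> h \<in> carrier H \<Longrightarrow> proj Q (act Q q h) = proj Q q"
  using is_bundle by (simp add: G_bundle_def)

lemma act_act: "q \<in> topspace (total Q) \<Longrightarrow> h \<in> carrier H \<Longrightarrow> k \<in> carrier H \<Longrightarrow> act Q (act Q q h) k = act Q q (h \<otimes>\<^bsub>H\<^esub> k)"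
  using is_bundle by (simp add: G_bundle_def)

definition trivialization :: "'x set \<Rightarrow> ('q \<Rightarrow> 'x \<times> 'h) \<Rightarrow> bool" where
  "trivialization U \<theta> \<longleftrightarrow> openin X U \<and>
     homeomorphic_map (subtopology (total Q) {p \<in> topspace (total Q). proj Q p \<in> U})
       (prod_topology (subtopology X U) (topol H)) \<theta> \<and>
     (\<forall>p \<in> topspace (total Q). proj Q p \<in> U \<longrightarrow>
        fst (\<theta> p) = proj Q p \<and> (\<forall>g \<in> carrier H. \<theta> (act Q p g) = (fst (\<theta> p), snd (\<theta> p) \<otimes>\<^bsub>H\<^esub> g)))"

lemma exists_trivialization:
  assumes "q \<in> topspace (total Q)"
  obtains U \<theta> where "trivialization U \<theta>" "proj Q q \<in> U"
proof -
  have "proj Q q \<in> topspace X"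
    using is_bundle assms by (auto simp: G_bundle_def continuous_map_def)
  then show ?thesis using is_bundle that unfolding G_bundle_def trivialization_def by meson
qed

text \<open>In a chart the action is right multiplication on the second coordinate, so the equation
  for \<open>h\<close> is solved by one division. Existence, uniqueness and continuity of the
  translation function all come from this formula.\<close>

lemma trivialization_quotient:
  assumes \<theta>: "trivialization U \<theta>" and q: "q \<in> topspace (total Q)" "q' \<in> topspace (total Q)"
    and pr: "proj Q q = proj Q q'" "proj Q q \<in> U"
  shows "bundle_quotient H Q q q' = inv\<^bsub>H\<^esub> snd (\<theta> q) \<otimes>\<^bsub>H\<^esub> snd (\<theta> q')"
    and "snd (\<theta> q) \<in> carrier H" "snd (\<theta> q') \<in> carrier H"
    and "act Q q h = q' \<Longrightarrow> h \<in> carrier H \<Longrightarrow> h = bundle_quotient H Q q q'"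
    and "act Q q (bundle_quotient H Q q q') = q'"
proof -
  let ?T = "subtopology (total Q) {p \<in> topspace (total Q). proj Q p \<in> U}"
  have hom: "homeomorphic_map ?T (prod_topology (subtopology X U) (topol H)) \<theta>"
    using \<theta> by (simp add: trivialization_def)
  have k: "snd (\<theta> p) \<in> carrier H" if "p \<in> topspace (total Q)" "proj Q p \<in> U" for p
  proof -
    have "\<theta> p \<in> \<theta> ` topspace ?T" using that by auto
    then have "\<theta> p \<in> (topspace X \<inter> U) \<times> carrier H"
      unfolding homeomorphic_imp_surjective_map[OF hom] by (simp add: topspace_H)
    then show ?thesis by (simp add: mem_Times_iff)
  qed
  show c: "snd (\<theta> q) \<in> carrier H" "snd (\<theta> q') \<in> carrier H"
    using k q pr by auto
  have iff: "act Q q h = q' \<longleftrightarrow> h = inv\<^bsub>H\<^esub> snd (\<theta> q) \<otimes>\<^bsub>H\<^esub> snd (\<theta> q')" if h: "h \<in> carrier H" for h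
  proof -
    have "act Q q h = q' \<longleftrightarrow> \<theta> (act Q q h) = \<theta> q'"
      using inj_on_eq_iff[OF homeomorphic_imp_injective_map[OF hom], of "act Q q h" q'] act_in[OF q(1) h] proj_act[OF q(1) h] q pr
      by auto
    also have "\<dots> \<longleftrightarrow> snd (\<theta> q) \<otimes>\<^bsub>H\<^esub> h = snd (\<theta> q')"
      using \<theta> q pr h by (auto simp: trivialization_def prod_eq_iff)
    also have "\<dots> \<longleftrightarrow> h = inv\<^bsub>H\<^esub> snd (\<theta> q) \<otimes>\<^bsub>H\<^esub> snd (\<theta> q')"
      using c h by (metis H.inv_solve_left)
    finally show ?thesis .
  qed
  show eq: "bundle_quotient H Q q q' = inv\<^bsub>H\<^esub> snd (\<theta> q) \<otimes>\<^bsub>H\<^esub> snd (\<theta> q')"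
    unfolding bundle_quotient_def by (rule the_equality) (use iff c in auto)
  show "act Q q h = q' \<Longrightarrow> h \<in> carrier H \<Longrightarrow> h = bundle_quotient H Q q q'"
    using iff eq by auto
  show "act Q q (bundle_quotient H Q q q') = q'"
    using iff[of "bundle_quotient H Q q q'"] eq c by auto
qed

lemma bundle_quotient:
  assumes "q \<in> topspace (total Q)" "q' \<in> topspace (total Q)" "proj Q q = proj Q q'"
  shows "bundle_quotient H Q q q' \<in> carrier H" "act Q q (bundle_quotient H Q q q') = q'"
    "act Q q h = q' \<Longrightarrow> h \<in> carrier H \<Longrightarrow> bundle_quotient H Q q q' = h"
proof -
  obtain U \<theta> where U: "trivialization U \<theta>" "proj Q q \<in> U" by (rule exists_trivialization[OF assms(1)])
  note t = trivialization_quotient[OF U(1) assms U(2)]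
  show "bundle_quotient H Q q q' \<in> carrier H" using t(1-3) by simp
  show "act Q q (bundle_quotient H Q q q') = q'" by (rule t(5))
  show "act Q q h = q' \<Longrightarrow> h \<in> carrier H \<Longrightarrow> bundle_quotient H Q q q' = h" using t(4) by simp
qed

lemma continuous_bundle_quotient:
  assumes f: "continuous_map Z (total Q) f" and g: "continuous_map Z (total Q) g"
    and pr: "\<And>z. z \<in> topspace Z \<Longrightarrow> proj Q (f z) = proj Q (g z)"
  shows "continuous_map Z (topol H) (\<lambda>z. bundle_quotient H Q (f z) (g z))"
proof -
  have fg: "f z \<in> topspace (total Q)" "g z \<in> topspace (total Q)" if "z \<in> topspace Z" for z
    using f g that by (auto simp: continuous_map_def)
  have pf: "continuous_map Z X (\<lambda>z. proj Q (f z))"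
    using continuous_map_compose[OF f, of X "proj Q"] is_bundle by (simp add: G_bundle_def o_def)
  let ?T = "\<lambda>U. {z \<in> topspace Z. proj Q (f z) \<in> U}"
  show ?thesis
  proof (rule pasting_lemma[where I = "{U. \<exists>\<theta>. trivialization U \<theta>}" and T = ?T
        and f = "\<lambda>_ z. bundle_quotient H Q (f z) (g z)"])
    fix U assume "U \<in> {U. \<exists>\<theta>. trivialization U \<theta>}"
    then obtain \<theta> where \<theta>: "trivialization U \<theta>" by auto
    show "openin Z (?T U)"
      by (rule openin_continuous_map_preimage[OF pf]) (use \<theta> in \<open>simp add: trivialization_def\<close>)
    let ?Z = "subtopology Z (?T U)"
    have \<theta>c: "continuous_map ?Z (topol H) (\<lambda>z. snd (\<theta> (k z)))"
      if k: "continuous_map Z (total Q) k" "\<And>z. z \<in> topspace Z \<Longrightarrow> proj Q (f z) \<in> U \<Longrightarrow> proj Q (k z) \<in> U" for k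
    proof -
      have "continuous_map ?Z (subtopology (total Q) {p \<in> topspace (total Q). proj Q p \<in> U}) k"
      proof -
        have "k z \<in> topspace (total Q)" if "z \<in> topspace Z" for z
          using k(1) that by (auto simp: continuous_map_def)
        then show ?thesis
          using k by (auto simp: continuous_map_in_subtopology continuous_map_from_subtopology)
      qed
      moreover have "continuous_map (subtopology (total Q) {p \<in> topspace (total Q). proj Q p \<in> U}) (topol H) (snd \<circ> \<theta>)"
        using \<theta> by (intro continuous_map_compose[OF homeomorphic_imp_continuous_map continuous_map_snd]) (auto simp: trivialization_def)
      ultimately show ?thesis using continuous_map_compose by (fastforce simp: o_def)
    qed
    have "continuous_map ?Z (prod_topology (topol H) (topol H)) (\<lambda>z. (inv\<^bsub>H\<^esub> snd (\<theta> (f z)), snd (\<theta> (g z))))"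
    proof (rule continuous_map_pairedI)
      have "continuous_map (topol H) (topol H) (\<lambda>x. inv\<^bsub>H\<^esub> x)"
        using is_bundle by (simp add: G_bundle_def topological_group_def)
      from continuous_map_compose[OF \<theta>c[OF f] this] show "continuous_map ?Z (topol H) (\<lambda>z. inv\<^bsub>H\<^esub> snd (\<theta> (f z)))"
        by (simp add: o_def)
      show "continuous_map ?Z (topol H) (\<lambda>z. snd (\<theta> (g z)))"
        by (rule \<theta>c[OF g]) (use pr in auto)
    qed
    moreover have "continuous_map (prod_topology (topol H) (topol H)) (topol H) (\<lambda>(x, y). x \<otimes>\<^bsub>H\<^esub> y)"
      using is_bundle by (simp add: G_bundle_def topological_group_def)
    ultimately have "continuous_map ?Z (topol H) ((\<lambda>(x, y). x \<otimes>\<^bsub>H\<^esub> y) \<circ> (\<lambda>z. (inv\<^bsub>H\<^esub> snd (\<theta> (f z)), snd (\<theta> (g z)))))"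
      by (rule continuous_map_compose)
    then show "continuous_map ?Z (topol H) (\<lambda>z. bundle_quotient H Q (f z) (g z))"
      by (rule continuous_map_eq) (use trivialization_quotient(1)[OF \<theta> fg] pr in auto)
  next
    fix z assume z: "z \<in> topspace Z"
    obtain U \<theta> where "trivialization U \<theta>" "proj Q (f z) \<in> U" by (rule exists_trivialization[OF fg(1)[OF z]])
    then show "\<exists>j. j \<in> {U. \<exists>\<theta>. trivialization U \<theta>} \<and> z \<in> ?T j \<and> bundle_quotient H Q (f z) (g z) = bundle_quotient H Q (f z) (g z)"
      using z by auto
  qed auto
qed

end

theorem bundle_morphisms_homotopic:
  fixes X :: "'a pointed" and C :: "'a scomplex" and s :: "'a \<Rightarrow> 'a"
  defines "b \<equiv> s (snd X)"
  assumes model: "simplicial_model X C s"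
    and \<phi>: "bundle_morphism (fst X) (milnor_loop_group C b) (pullback_bundle (fst X) s (milnor_path_bundle C b)) H Q \<alpha> \<phi>"
    and \<psi>: "bundle_morphism (fst X) (milnor_loop_group C b) (pullback_bundle (fst X) s (milnor_path_bundle C b)) H Q \<beta> \<psi>"
  shows "homotopic_with (\<lambda>_. True) (milnor_B (milnor_loop_group C b)) (milnor_B H) (milnor_B_map H \<alpha>) (milnor_B_map H \<beta>)"
proof -
  let ?G = "milnor_loop_group C b"
  let ?P = "pullback_bundle (fst X) s (milnor_path_bundle C b)"
  interpret lf_complex C
    using model by unfold_locales (auto simp: simplicial_model_def)
  have b: "b \<in> topspace (sc_space C)"
    using model by (auto simp: simplicial_model_def simplicial_complex_def sc_vertex_def b_def)
  obtain r where r: "continuous_map (sc_space C) (fst X) r"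
    and sr: "homotopic_with (\<lambda>_. True) (sc_space C) (sc_space C) (s \<circ> r) id"
    using model by (auto simp: simplicial_model_def)
  \<comment> \<open>The homotopy is reversed so that it starts at the identity and can extend a path
    from its end.\<close>
  obtain h :: "real \<times> 'a \<Rightarrow> 'a" where h: "continuous_map (prod_topology (top_of_set {0..1}) (sc_space C)) (sc_space C) h"
    and "\<forall>y. h (0, y) = id y" "\<forall>y. h (1, y) = (s \<circ> r) y"
    using homotopic_with_symD[OF sr] unfolding homotopic_with_def by blast
  then have h01: "h (0, y) = y" "h (1, y) = s (r y)" for y
    by auto
  interpret complex_deformation C h
    by unfold_locales (use h h01 in auto)
  interpret principal_bundle H "fst X" Q
    by unfold_locales (use \<phi> in \<open>simp add: bundle_morphism_def\<close>)
  have ch: "continuous_map (topol ?G) (topol H) \<alpha>" "\<alpha> \<in> hom ?G H" "continuous_map (topol ?G) (topol H) \<beta>" "\<beta> \<in> hom ?G H"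
    using \<phi> \<psi> by (auto simp: bundle_morphism_def)
  have G: "topological_group ?G" and H: "topological_group H"
    using \<phi> by (auto simp: bundle_morphism_def G_bundle_def)
  have carrier_G: "carrier ?G = loop_classes C b" by (simp add: milnor_loop_group_def)
  \<comment> \<open>A path from \<open>b\<close> to \<open>y\<close> is extended to
    \<open>s (r y)\<close>; together with \<open>r y\<close> it is then a point of the pullback
    along \<open>s\<close>.\<close>
  define pt where "pt c = (r (class_end c), transport c)" for c
  have topP: "p \<in> topspace (total ?P) \<longleftrightarrow> fst p \<in> topspace (fst X) \<and> snd p \<in> paths b \<and> s (fst p) = class_end (snd p)" for p
    by (auto simp: pullback_bundle_def milnor_path_bundle_def paths_def mem_Times_iff)
  have pt: "pt c \<in> topspace (total ?P)" if "c \<in> paths b" for c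
    using that transport[of c] class_end_in[of c] r h01(2) unfolding topP
    by (auto simp: pt_def paths_def continuous_map_def)
  have cont_pt: "continuous_map (subtopology L (paths b)) (total ?P) pt"
  proof -
    have "continuous_map (subtopology L (paths b)) (fst X) (\<lambda>c. r (class_end c))"
      using continuous_map_compose[OF continuous_end r] by (simp add: o_def continuous_map_from_subtopology)
    moreover have "continuous_map (subtopology L (paths b)) (subtopology L (paths b)) transport"
      using continuous_map_from_subtopology[OF continuous_transport] transport
      by (auto simp: continuous_map_in_subtopology paths_def)
    ultimately have "continuous_map (subtopology L (paths b)) (prod_topology (fst X) (subtopology L (paths b))) pt"
      unfolding pt_def by (rule continuous_map_pairedI)
    then show ?thesis
      using pt by (auto simp: pullback_bundle_def milnor_path_bundle_def continuous_map_in_subtopology paths_def)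
  qed
  have pt_act: "pt (concat_class C c g) = act ?P (pt c) g" if "c \<in> paths b" "g \<in> loop_classes C b" for c g
    using that transport_concat[of c g] concat_class(2)[of c g]
    by (simp add: pt_def pullback_bundle_def milnor_path_bundle_def paths_def loop_classes_def)
  define \<delta> where "\<delta> c = bundle_quotient H Q (\<psi> (pt c)) (\<phi> (pt c))" for c
  have in_Q: "\<phi> (pt c) \<in> topspace (total Q)" "\<psi> (pt c) \<in> topspace (total Q)" "proj Q (\<psi> (pt c)) = proj Q (\<phi> (pt c))"
    if "c \<in> paths b" for c
    using pt[OF that] \<phi> \<psi> by (auto simp: bundle_morphism_def continuous_map_def)
  have "twisted_hom C b H \<alpha> \<beta> \<delta>"
  proof (unfold_locales)
    show "continuous_map (subtopology L (paths b)) (topol H) \<delta>"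
      unfolding \<delta>_def
    proof (rule continuous_bundle_quotient)
      show "continuous_map (subtopology L (paths b)) (total Q) (\<lambda>c. \<psi> (pt c))"
        using continuous_map_compose[OF cont_pt, of "total Q" \<psi>] \<psi> by (simp add: bundle_morphism_def o_def)
      show "continuous_map (subtopology L (paths b)) (total Q) (\<lambda>c. \<phi> (pt c))"
        using continuous_map_compose[OF cont_pt, of "total Q" \<phi>] \<phi> by (simp add: bundle_morphism_def o_def)
    qed (use in_Q in auto)
    fix c g assume c: "c \<in> paths b" and g: "g \<in> loop_classes C b"
    have ab: "\<alpha> g \<in> carrier H" "\<beta> g \<in> carrier H"
      using ch g by (auto simp: hom_def carrier_G)
    have \<delta>: "\<delta> c \<in> carrier H" "act Q (\<psi> (pt c)) (\<delta> c) = \<phi> (pt c)"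
      unfolding \<delta>_def using bundle_quotient(1,2)[OF in_Q(2,1,3)] c by auto
    have \<phi>g: "\<phi> (pt (concat_class C c g)) = act Q (\<phi> (pt c)) (\<alpha> g)"
      and \<psi>g: "\<psi> (pt (concat_class C c g)) = act Q (\<psi> (pt c)) (\<beta> g)"
      using \<phi> \<psi> pt[OF c] g by (auto simp: bundle_morphism_def pt_act[OF c g] carrier_G)
    \<comment> \<open>Uniqueness of translation: the claimed element takes \<psi>(c) \<cdot>
      \<beta>(g) to \<psi>(c) \<cdot> \<delta>(c) \<alpha>(g), which is \<phi>(c) \<cdot>
      \<alpha>(g).\<close>
    show "\<delta> (concat_class C c g) = inv\<^bsub>H\<^esub> \<beta> g \<otimes>\<^bsub>H\<^esub> \<delta> c \<otimes>\<^bsub>H\<^esub> \<alpha> g"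
      unfolding \<delta>_def[of "concat_class C c g"] \<phi>g \<psi>g
    proof (rule bundle_quotient(3))
      have cancel: "\<beta> g \<otimes>\<^bsub>H\<^esub> (inv\<^bsub>H\<^esub> \<beta> g \<otimes>\<^bsub>H\<^esub> \<delta> c \<otimes>\<^bsub>H\<^esub> \<alpha> g) = \<delta> c \<otimes>\<^bsub>H\<^esub> \<alpha> g"
        using ab \<delta>(1) by (simp add: H.m_assoc[symmetric])
      show "act Q (act Q (\<psi> (pt c)) (\<beta> g)) (inv\<^bsub>H\<^esub> \<beta> g \<otimes>\<^bsub>H\<^esub> \<delta> c \<otimes>\<^bsub>H\<^esub> \<alpha> g) = act Q (\<phi> (pt c)) (\<alpha> g)"
        using ab \<delta> in_Q[OF c] act_act[of "\<psi> (pt c)" "\<delta> c" "\<alpha> g"] by (simp add: act_act cancel)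
    qed (use ab \<delta> in_Q[OF c] act_in proj_act in auto)
  qed (use b G H ch in auto)
  then show ?thesis by (rule twisted_homotopic[OF _ ch(1)])
qed

section \<open>The competing morphisms for identities and composites\<close>

lemma bundle_morphism_id:
  assumes "G_bundle G X P"
    and "G_bundle G X (pullback_bundle X id P)"
  shows "bundle_morphism X G P G (pullback_bundle X id P) id (\<lambda>p. (proj P p, p))"
proof -
  have "continuous_map (total P) X (proj P)"
    using assms(1) by (simp add: G_bundle_def)
  moreover from this have "proj P p \<in> topspace X" if "p \<in> topspace (total P)" for p
    using that by (auto simp: continuous_map_def)
  moreover have "id \<in> hom G G"
    by (auto simp: hom_def)
  ultimately show ?thesis
    using assms unfolding bundle_morphism_def
    by (auto simp: G_bundle_def pullback_bundle_def continuous_map_in_subtopology continuous_map_paired)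
qed

text \<open>The base coordinate of a value of \<psi> lies in \<open>Y\<close>; it is dropped and
  replaced by the projection to \<open>X\<close>.\<close>

lemma bundle_morphism_compose:
  assumes f: "continuous_map X Y f"
    and \<phi>: "bundle_morphism X G P G' (pullback_bundle X f P') a \<phi>"
    and \<psi>: "bundle_morphism Y G' P' G'' (pullback_bundle Y g P'') a' \<psi>"
    and Q: "G_bundle G'' X (pullback_bundle X (g \<circ> f) P'')"
  shows "bundle_morphism X G P G'' (pullback_bundle X (g \<circ> f) P'') (a' \<circ> a)
           (\<lambda>p. (proj P p, snd (\<psi> (snd (\<phi> p)))))"
proof -
  let ?T = "total (pullback_bundle X f P')" and ?T' = "total (pullback_bundle Y g P'')"
  have \<phi>c: "continuous_map (total P) ?T \<phi>" and \<psi>c: "continuous_map (total P') ?T' \<psi>"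
    using \<phi> \<psi> by (auto simp: bundle_morphism_def)
  have pr: "continuous_map (total P) X (proj P)"
    using \<phi> by (simp add: bundle_morphism_def G_bundle_def)
  have \<phi>p: "fst (\<phi> p) = proj P p" "snd (\<phi> p) \<in> topspace (total P')" "f (proj P p) = proj P' (snd (\<phi> p))" "proj P p \<in> topspace X"
    if p: "p \<in> topspace (total P)" for p
  proof -
    have "\<phi> p \<in> topspace ?T" using \<phi>c p by (auto simp: continuous_map_def)
    moreover have 1: "fst (\<phi> p) = proj P p" using \<phi> p by (simp add: bundle_morphism_def pullback_bundle_def)
    ultimately show "fst (\<phi> p) = proj P p" "snd (\<phi> p) \<in> topspace (total P')" "f (proj P p) = proj P' (snd (\<phi> p))" "proj P p \<in> topspace X"
      by (auto simp: pullback_bundle_def)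
  qed
  have \<psi>p: "fst (\<psi> p) = proj P' p" "snd (\<psi> p) \<in> topspace (total P'')" "g (proj P' p) = proj P'' (snd (\<psi> p))"
    if p: "p \<in> topspace (total P')" for p
  proof -
    have "\<psi> p \<in> topspace ?T'" using \<psi>c p by (auto simp: continuous_map_def)
    moreover have 1: "fst (\<psi> p) = proj P' p" using \<psi> p by (simp add: bundle_morphism_def pullback_bundle_def)
    ultimately show "fst (\<psi> p) = proj P' p" "snd (\<psi> p) \<in> topspace (total P'')" "g (proj P' p) = proj P'' (snd (\<psi> p))"
      by (auto simp: pullback_bundle_def)
  qed
  have s1: "continuous_map ?T (total P') snd" and s2: "continuous_map ?T' (total P'') snd"
    by (auto simp: pullback_bundle_def intro: continuous_map_from_subtopology continuous_map_snd)
  have "continuous_map (total P) (total P'') (snd \<circ> (\<psi> \<circ> (snd \<circ> \<phi>)))"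
    by (intro continuous_map_compose[OF _ s2] continuous_map_compose[OF _ \<psi>c] continuous_map_compose[OF _ s1] \<phi>c)
  then have "continuous_map (total P) (prod_topology X (total P'')) (\<lambda>p. (proj P p, snd (\<psi> (snd (\<phi> p)))))"
    using pr by (intro continuous_map_pairedI) (simp_all add: o_def)
  then have "continuous_map (total P) (total (pullback_bundle X (g \<circ> f) P'')) (\<lambda>p. (proj P p, snd (\<psi> (snd (\<phi> p)))))"
    using \<phi>p \<psi>p by (auto simp: pullback_bundle_def continuous_map_in_subtopology)
  moreover have "snd (\<psi> (snd (\<phi> (act P p k)))) = act P'' (snd (\<psi> (snd (\<phi> p)))) (a' (a k))" "proj P (act P p k) = proj P p"
    if p: "p \<in> topspace (total P)" and k: "k \<in> carrier G" for p k
  proof -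
    have ak: "a k \<in> carrier G'" using \<phi> k by (auto simp: bundle_morphism_def hom_def)
    have "snd (\<phi> (act P p k)) = act P' (snd (\<phi> p)) (a k)"
      using \<phi> p k by (simp add: bundle_morphism_def pullback_bundle_def case_prod_unfold)
    moreover have "snd (\<psi> (act P' (snd (\<phi> p)) (a k))) = act P'' (snd (\<psi> (snd (\<phi> p)))) (a' (a k))"
      using \<psi> \<phi>p(2)[OF p] ak by (simp add: bundle_morphism_def pullback_bundle_def case_prod_unfold)
    ultimately show "snd (\<psi> (snd (\<phi> (act P p k)))) = act P'' (snd (\<psi> (snd (\<phi> p)))) (a' (a k))" by simp
    show "proj P (act P p k) = proj P p"
      using \<phi> p k by (simp add: bundle_morphism_def G_bundle_def)
  qed
  moreover have "a' \<circ> a \<in> hom G G''"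
    using \<phi> \<psi> by (simp add: bundle_morphism_def hom_def Pi_iff)
  moreover have "continuous_map (topol G) (topol G'') (a' \<circ> a)"
    using \<phi> \<psi> by (auto simp: bundle_morphism_def intro: continuous_map_compose)
  moreover have "G_bundle G X P" using \<phi> by (simp add: bundle_morphism_def)
  ultimately show ?thesis
    using Q by (simp add: bundle_morphism_def) (simp add: pullback_bundle_def)
qed

theorem proposition3p11:
  fixes K :: "'a pointed \<Rightarrow> 'a scomplex"
    and s :: "'a pointed \<Rightarrow> 'a \<Rightarrow> 'a"
    and Om :: "'a pointed \<Rightarrow> 'a pointed \<Rightarrow> ('a \<Rightarrow> 'a) \<Rightarrow> 'a tuple set \<Rightarrow> 'a tuple set"
    and \<phi> :: "'a pointed \<Rightarrow> 'a pointed \<Rightarrow> ('a \<Rightarrow> 'a)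
               \<Rightarrow> 'a \<times> 'a tuple set \<Rightarrow> 'a \<times> 'a \<times> 'a tuple set"
  assumes model: "\<And>X. nice_space X \<Longrightarrow> simplicial_model X (K X) (s X)"
    and hom: "\<And>X Y f. nice_space X \<Longrightarrow> nice_space Y \<Longrightarrow> pointed_map X Y f \<Longrightarrow>
           nice_hom (Omega K s X) (Omega K s Y) (Om X Y f)"
    and morphism: "\<And>X Y f. nice_space X \<Longrightarrow> nice_space Y \<Longrightarrow> pointed_map X Y f \<Longrightarrow>
           bundle_morphism (fst X) (Omega K s X) (path_bundle K s X)
             (Omega K s Y) (pullback_bundle (fst X) f (path_bundle K s Y)) (Om X Y f) (\<phi> X Y f)"
  shows "(\<forall>X. nice_space X \<longrightarrow>
            alg_equivalent (Omega K s X) (Omega K s X) (Om X X id) id) \<and>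
         (\<forall>X Y Z f g. nice_space X \<longrightarrow> nice_space Y \<longrightarrow> nice_space Z \<longrightarrow>
            pointed_map X Y f \<longrightarrow> pointed_map Y Z g \<longrightarrow>
            alg_equivalent (Omega K s X) (Omega K s Z) (Om X Z (g \<circ> f)) (Om Y Z g \<circ> Om X Y f))"
proof (intro conjI allI impI)
  fix X :: "'a pointed" assume X: "nice_space X"
  have "pointed_map X X id" by (simp add: pointed_map_def)
  note hom = hom[OF X X this] and mor = morphism[OF X X this]
  have id: "bundle_morphism (fst X) (Omega K s X) (path_bundle K s X) (Omega K s X)
      (pullback_bundle (fst X) id (path_bundle K s X)) id (\<lambda>p. (proj (path_bundle K s X) p, p))"
    \<comment> \<open>The chosen morphism over the identity supplies that the path bundle and its
      pullback are bundles.\<close>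
    by (rule bundle_morphism_id) (use mor in \<open>auto simp: bundle_morphism_def\<close>)
  have "nice_hom (Omega K s X) (Omega K s X) id"
    using hom id by (simp add: nice_hom_def bundle_morphism_def)
  then show "alg_equivalent (Omega K s X) (Omega K s X) (Om X X id) id"
    using hom bundle_morphisms_homotopic[OF model[OF X]] mor id
    unfolding alg_equivalent_def Omega_def path_bundle_def by blast
next
  fix X Y Z :: "'a pointed" and f g
  assume X: "nice_space X" and Y: "nice_space Y" and Z: "nice_space Z"
    and f: "pointed_map X Y f" and g: "pointed_map Y Z g"
  have gf: "pointed_map X Z (g \<circ> f)"
    using f g by (auto simp: pointed_map_def intro: continuous_map_compose)
  have comp: "bundle_morphism (fst X) (Omega K s X) (path_bundle K s X) (Omega K s Z)
      (pullback_bundle (fst X) (g \<circ> f) (path_bundle K s Z)) (Om Y Z g \<circ> Om X Y f)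
      (\<lambda>p. (proj (path_bundle K s X) p, snd (\<phi> Y Z g (snd (\<phi> X Y f p)))))"
    \<comment> \<open>The chosen morphism over \<open>g \<circ> f\<close> supplies that its target
      is a bundle.\<close>
    by (rule bundle_morphism_compose[OF _ morphism[OF X Y f] morphism[OF Y Z g]])
      (use f morphism[OF X Z gf] in \<open>auto simp: pointed_map_def bundle_morphism_def\<close>)
  have "nice_hom (Omega K s X) (Omega K s Z) (Om Y Z g \<circ> Om X Y f)"
    using hom[OF X Y f] hom[OF Y Z g] comp by (simp add: nice_hom_def bundle_morphism_def)
  then show "alg_equivalent (Omega K s X) (Omega K s Z) (Om X Z (g \<circ> f)) (Om Y Z g \<circ> Om X Y f)"
    using hom[OF X Z gf] bundle_morphisms_homotopic[OF model[OF X]] morphism[OF X Z gf] comp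
    unfolding alg_equivalent_def Omega_def path_bundle_def by blast
qed

end
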